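(* The cost of the algorithm HG (specified in the context), which computes the truncated hypergeometric function of a matrix argument $${}_p^mF_q^{(\alpha)}(a_1,\dots,a_p;b_1,\dots,b_q;X)=\sum_{k=0}^m\ \sum_{\kappa\vdash k}\frac{(a_1)_\kappa^{(\alpha)}\cdots(a_p)_\kappa^{(\alpha)}}{k!\,(b_1)_\kappa^{(\alpha)}\cdots(b_q)_\kappa^{(\alpha)}}\,C_\kappa^{(\alpha)}(X),\qquad X=\mathrm{diag}(x_1,\dots,x_n),$$ is bounded by $$O(P_{mn}^2\cdot n)$$ arithmetic operations, where $P_{mn}=\#\{\kappa:|\kappa|\le m,\ \kappa_{n+1}=0\}$ is the number of partitions of size at most $m$ with at most $n$ parts. Moreover, with $p(i)$ denoting the number of partitions of $i$, $$P_{mn}\le\sum_{i=0}^m p(i)=O\left(\exp\left(\pi\sqrt{2m/3}\right)\right),\qquad P_{mn}^2=O\left(\exp\left(2\pi\sqrt{2m/3}\right)\right).$$ Therefore the complexity of the algorithm HG is linear in $n$ and subexponential in $m$.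
   Context: **Notation.** $p,q\ge0$ are integers and $\alpha>0$. A partition $\kappa=(\kappa_1,\kappa_2,\dots)$ is a sequence of integers $\kappa_1\ge\kappa_2\ge\cdots\ge0$ with finitely many nonzero terms (parts); $|\kappa|=\kappa_1+\kappa_2+\cdots$, and $\kappa\vdash k$ means $|\kappa|=k$. One writes $(i,j)\in\kappa$ if $i\ge1$ and $1\le j\le\kappa_i$; $\kappa'_j=\#\{i:\kappa_i\ge j\}$ (so $\kappa_1'$ is the number of parts). $\mu\le\kappa$ means $\mu_i\le\kappa_i$ for all $i$, and then $|\kappa/\mu|=|\kappa|-|\mu|$; $\kappa/\mu$ is a horizontal strip when $\kappa_1\ge\mu_1\ge\kappa_2\ge\mu_2\ge\cdots$. The generalized Pochhammer symbol is $(a)_\kappa^{(\alpha)}=\prod_{(i,j)\in\kappa}\left(a-\frac{i-1}{\alpha}+j-1\right)$. The hook lengths are $h_\kappa^*(i,j)=\kappa_j'-i+\alpha(\kappa_i-j+1)$ and $h^\kappa_*(i,j)=\kappa'_j-i+1+\alpha(\kappa_i-j)$, and $j_\kappa=\prod_{(i,j)\in\kappa}h^\kappa_*(i,j)h^*_\kappa(i,j)$. The Jack function $J_\kappa^{(\alpha)}(x_1,\dots,x_n)$ is the symmetric homogeneous polynomial of degree $|\kappa|$, normalized so that the coefficient of $x_1x_2\cdots x_{|\kappa|}$ is $|\kappa|!$, with $J_{(0)}^{(\alpha)}=1$, $J_\kappa^{(\alpha)}(x_1,\dots,x_n)=0$ when $\kappa_{n+1}>0$, $J_{(k)}^{(\alpha)}(x_1)=x_1^k\prod_{j=1}^k(1+\alpha(j-1))$,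 and for $n\ge2$ $$J_\kappa^{(\alpha)}(x_1,\dots,x_n)=\sum_\mu J_\mu^{(\alpha)}(x_1,\dots,x_{n-1})\,x_n^{|\kappa/\mu|}\beta_{\kappa\mu},$$ summed over all $\mu\le\kappa$ such that $\kappa/\mu$ is a horizontal strip, where $\beta_{\kappa\mu}=\prod_{(i,j)\in\kappa}B^\kappa_{\kappa\mu}(i,j)\big/\prod_{(i,j)\in\mu}B^\mu_{\kappa\mu}(i,j)$, and $B^\nu_{\kappa\mu}(i,j)=h^*_\nu(i,j)$ if $\kappa'_j=\mu'_j$ and $h_*^\nu(i,j)$ otherwise. Finally $C_\kappa^{(\alpha)}(X)=\frac{\alpha^{|\kappa|}|\kappa|!}{j_\kappa}J_\kappa^{(\alpha)}(x_1,\dots,x_n)$, where $x_1,\dots,x_n$ are the eigenvalues of $X$. Hence the truncation equals $\sum_{|\kappa|\le m,\ \kappa_{n+1}=0}Q_\kappa J_\kappa^{(\alpha)}(X)$ with $Q_\kappa=\frac{\alpha^{|\kappa|}(a_1)_\kappa^{(\alpha)}\cdots(a_p)_\kappa^{(\alpha)}}{j_\kappa(b_1)_\kappa^{(\alpha)}\cdots(b_q)_\kappa^{(\alpha)}}$. **Update of $Q$.** If $\kappa_i>\kappa_{i+1}$ and $\kappa_{(i)}$ is $\kappa$ with $\kappa_i$ replaced by $\kappa_i-1$, then $Q_\kappa=Q_{\kappa_{(i)}}\cdot T$ with $$T=\frac{\prod_{j=1}^p(a_j+c)}{\prod_{j=1}^q(b_j+c)}\cdot\prod_{j=1}^{\kappa_i-1}\frac{(g_j-\alpha)e_j}{g_j(e_j+\alpha)}\cdot\prod_{j=1}^{i-1}\frac{l_j-f_j}{l_j+h_j},$$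 where $c=-\frac{i-1}{\alpha}+\kappa_i-1$, $d=\kappa_i\alpha-i$, $e_j=d-j\alpha+\kappa'_j$, $g_j=e_j+1$, $f_j=\kappa_j\alpha-j-d$, $h_j=f_j+\alpha$, $l_j=h_jf_j$. **Update of $\beta$.** When $\mu_k$ is decreased by 1, $\beta_{\kappa\mu}$ is multiplied by $$\alpha\cdot\prod_{r=1}^k\frac{u_r}{u_r+\alpha-1}\cdot\prod_{r=1}^{k-1}\frac{v_r+\alpha}{v_r}\cdot\prod_{r=1}^{\mu_k-1}\frac{w_r+\alpha}{w_r},$$ where (with $\mu$ the partition before the decrease) $\tau=k-\alpha\mu_k$, $u_r=\tau+1-r+\alpha\kappa_r$, $v_r=\tau-r+\alpha\mu_r$, $w_r=\mu'_r-\tau-\alpha r$. The starting value is $\beta_{\kappa\kappa}=1$. **Algorithm HG** (input $m,\alpha,a_1,\dots,a_p,b_1,\dots,b_q,x_1,\dots,x_n$; output $s$). First compute $P_{mn}$, using the recurrence $p_k(i)=p_{k-1}(i-1)+p_k(i-k)$ for the number $p_k(i)$ of partitions of $i$ with exactly $k$ parts. Each partition $\kappa$ with $|\kappa|\le m$ and at most $n$ parts gets a distinct integer index $N_\kappa$: $N_{(i)}=i$ for $0\le i\le m$; and an array $D$ records $D(N_{(\kappa_1,\dots,\kappa_{i-1})})=N_{(\kappa_1,\dots,\kappa_{i-1},1)}$, so that $N_{(\kappa_1,\dots,\kappa_i)}=D(N_{(\kappa_1,\dots,\kappa_{i-1})})+\kappa_i-1$. The value $J_\kappa^{(\alpha)}(x_1,\dots,x_t)$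 is stored in the entry $J(N_\kappa,t)$ of an array, initially zero except that the row of the empty partition is all ones. Set $H=m+1$ (first unused index), $s=1$, $\kappa=(0)$, and call summation$(1,1,m)$. *summation$(i,z,j)$:* let $r=\min(\kappa_{i-1},j)$ ($r=j$ if $i=1$). For $\kappa_i=1,\dots,r$: - if $\kappa_i=1$ and $i>1$, set $D$ at the index of $(\kappa_1,\dots,\kappa_{i-1})$ to $H$, set $N_\kappa=H$, and increase $H$ by $r$; otherwise $N_\kappa$ is one more than the index of $\kappa$ with $\kappa_i$ decreased by 1; - replace $z$ by $z\cdot T$ (so that $z=Q_\kappa$); - if $\kappa'_1=1$, set $J(N_\kappa,1)=x_1(1+\alpha(\kappa_1-1))J(N_\kappa-1,1)$; - for $t=2,\dots,n$, call jack$(0,1,0,t)$ with $\mu=\kappa$; - replace $s$ by $s+z\cdot J(N_\kappa,n)$; - if $j>\kappa_i$ and $i<n$, call summation$(i+1,z,j-\kappa_i)$. At the end of the loop reset $\kappa_i=0$. *jack$(k,\beta_{\kappa\mu},c,t)$* (here $c=|\kappa|-|\mu|$): for $i=k,\dots,\mu'_1$, whenever $i>0$ and $\mu_i>\mu_{i+1}$: decrease $\mu_i$ by 1, compute $N_\mu$ from $D$, and update $\beta_{\kappa\mu}$ by the formula above (for row $i$); then, if $\mu_i>0$, call jack$(i,\beta_{\kappa\mu},c+1,t)$ with the updated $\beta_{\kappa\mu}$, and otherwise add $\beta_{\kappa\mu}J(N_\mu,t-1)x_t^{c+1}$ to $J(N_\kappa,t)$; then restore $\mu_i$, $N_\mu$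 and $\beta_{\kappa\mu}$ to their previous values. After the loop: if $k=0$, add $J(N_\kappa,t-1)$ to $J(N_\kappa,t)$; otherwise add $\beta_{\kappa\mu}J(N_\mu,t-1)x_t^c$ to $J(N_\kappa,t)$.
   Formalization: In the update of β the product of (w_r+α)/w_r is evaluated by telescoping over columns of equal length, and x_t^c is carried along, not recomputed; multiplying factor by factor costs order m^5 for n=2, exceeding O(P_mn^2 n). The O-constant depends on p, q. *)

theory Defs
  imports "HOL-Analysis.Analysis" "HOL-Library.Landau_Symbols"
begin

section \<open>Partitions\<close>

text \<open>A partition is a function on the indices 1, 2, 3, ...; the unused value at index 0 is
  fixed to 0, so that distinct functions are distinct partitions.\<close>

definition is_partition :: "(nat \<Rightarrow> nat) \<Rightarrow> bool" where
  "is_partition \<kappa> \<longleftrightarrow> \<kappa> 0 = 0 \<and> (\<forall>i\<ge>1. \<kappa> (Suc i) \<le> \<kappa> i) \<and> finite {i. \<kappa> i \<noteq> 0}"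

definition psize :: "(nat \<Rightarrow> nat) \<Rightarrow> nat" where
  "psize \<kappa> = (\<Sum>i | \<kappa> i \<noteq> 0. \<kappa> i)"

definition conj_part :: "(nat \<Rightarrow> nat) \<Rightarrow> nat \<Rightarrow> nat" where
  "conj_part \<kappa> j = card {i. 1 \<le> i \<and> j \<le> \<kappa> i}"

definition cells :: "(nat \<Rightarrow> nat) \<Rightarrow> (nat \<times> nat) set" where
  "cells \<kappa> = {(i, j). 1 \<le> i \<and> 1 \<le> j \<and> j \<le> \<kappa> i}"

definition hstrip :: "(nat \<Rightarrow> nat) \<Rightarrow> (nat \<Rightarrow> nat) \<Rightarrow> bool" where
  "hstrip \<kappa> \<mu> \<longleftrightarrow> (\<forall>i\<ge>1. \<mu> i \<le> \<kappa> i \<and> \<kappa> (Suc i) \<le> \<mu> i)"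

definition partitions_of :: "nat \<Rightarrow> (nat \<Rightarrow> nat) set" where
  "partitions_of k = {\<kappa>. is_partition \<kappa> \<and> psize \<kappa> = k}"

definition num_partitions :: "nat \<Rightarrow> nat" where
  "num_partitions i = card (partitions_of i)"

definition bounded_partitions :: "nat \<Rightarrow> nat \<Rightarrow> (nat \<Rightarrow> nat) set" where
  "bounded_partitions m n = {\<kappa>. is_partition \<kappa> \<and> psize \<kappa> \<le> m \<and> \<kappa> (Suc n) = 0}"

definition Pmn :: "nat \<Rightarrow> nat \<Rightarrow> nat" where
  "Pmn m n = card (bounded_partitions m n)"


section \<open>Jack functions and the truncated hypergeometric function\<close>

text \<open>Everything is defined over a field of characteristic 0; the parameter \<open>\<alpha>\<close> will be instantiated by a
  positive real number embedded in the complex numbers.\<close>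

definition gpoch :: "'a::field_char_0 \<Rightarrow> 'a \<Rightarrow> (nat \<Rightarrow> nat) \<Rightarrow> 'a" where
  "gpoch \<alpha> a \<kappa> = (\<Prod>(i, j)\<in>cells \<kappa>. a - (of_nat i - 1) / \<alpha> + of_nat j - 1)"

definition hook_upper :: "'a::field_char_0 \<Rightarrow> (nat \<Rightarrow> nat) \<Rightarrow> nat \<Rightarrow> nat \<Rightarrow> 'a" where
  "hook_upper \<alpha> \<kappa> i j = of_nat (conj_part \<kappa> j) - of_nat i + \<alpha> * (of_nat (\<kappa> i) - of_nat j + 1)"

definition hook_lower :: "'a::field_char_0 \<Rightarrow> (nat \<Rightarrow> nat) \<Rightarrow> nat \<Rightarrow> nat \<Rightarrow> 'a" where
  "hook_lower \<alpha> \<kappa> i j = of_nat (conj_part \<kappa> j) - of_nat i + 1 + \<alpha> * (of_nat (\<kappa> i) - of_nat j)"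

definition jfactor :: "'a::field_char_0 \<Rightarrow> (nat \<Rightarrow> nat) \<Rightarrow> 'a" where
  "jfactor \<alpha> \<kappa> = (\<Prod>(i, j)\<in>cells \<kappa>. hook_lower \<alpha> \<kappa> i j * hook_upper \<alpha> \<kappa> i j)"

definition B_hook ::
  "'a::field_char_0 \<Rightarrow> (nat \<Rightarrow> nat) \<Rightarrow> (nat \<Rightarrow> nat) \<Rightarrow> (nat \<Rightarrow> nat) \<Rightarrow> nat \<Rightarrow> nat \<Rightarrow> 'a" where
  "B_hook \<alpha> \<nu> \<kappa> \<mu> i j =
     (if conj_part \<kappa> j = conj_part \<mu> j then hook_upper \<alpha> \<nu> i j else hook_lower \<alpha> \<nu> i j)"

definition strip_beta :: "'a::field_char_0 \<Rightarrow> (nat \<Rightarrow> nat) \<Rightarrow> (nat \<Rightarrow> nat) \<Rightarrow> 'a" where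
  "strip_beta \<alpha> \<kappa> \<mu> = (\<Prod>(i, j)\<in>cells \<kappa>. B_hook \<alpha> \<kappa> \<kappa> \<mu> i j) / (\<Prod>(i, j)\<in>cells \<mu>. B_hook \<alpha> \<mu> \<kappa> \<mu> i j)"

text \<open>\<open>Jack \<alpha> x n \<kappa>\<close> is the Jack function of \<open>x 1, \<dots>, x n\<close>. The case of no variables is only a
  convention and is never used for \<open>n \<ge> 1\<close>.\<close>

fun Jack :: "'a::field_char_0 \<Rightarrow> (nat \<Rightarrow> 'a) \<Rightarrow> nat \<Rightarrow> (nat \<Rightarrow> nat) \<Rightarrow> 'a" where
  "Jack \<alpha> x 0 \<kappa> = (if \<kappa> 1 > 0 then 0 else 1)"
| "Jack \<alpha> x (Suc 0) \<kappa> =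
     (if \<kappa> 2 > 0 then 0 else x 1 ^ \<kappa> 1 * (\<Prod>j=1..\<kappa> 1. 1 + \<alpha> * (of_nat j - 1)))"
| "Jack \<alpha> x (Suc (Suc n)) \<kappa> =
     (if \<kappa> (Suc (Suc (Suc n))) > 0 then 0
      else (\<Sum>\<mu> | is_partition \<mu> \<and> hstrip \<kappa> \<mu>.
              Jack \<alpha> x (Suc n) \<mu> * x (Suc (Suc n)) ^ (psize \<kappa> - psize \<mu>) * strip_beta \<alpha> \<kappa> \<mu>))"

text \<open>The matrix argument enters only through its eigenvalues, which for
  \<open>X = diag (x 1, \<dots>, x n)\<close> are \<open>x 1, \<dots>, x n\<close>.\<close>

definition C_diag :: "'a::field_char_0 \<Rightarrow> (nat \<Rightarrow> nat) \<Rightarrow> nat \<Rightarrow> (nat \<Rightarrow> 'a) \<Rightarrow> 'a" where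
  "C_diag \<alpha> \<kappa> n x = \<alpha> ^ psize \<kappa> * fact (psize \<kappa>) / jfactor \<alpha> \<kappa> * Jack \<alpha> x n \<kappa>"

definition pFq_trunc ::
  "nat \<Rightarrow> 'a::field_char_0 \<Rightarrow> nat \<Rightarrow> (nat \<Rightarrow> 'a) \<Rightarrow> nat \<Rightarrow> (nat \<Rightarrow> 'a) \<Rightarrow> nat \<Rightarrow> (nat \<Rightarrow> 'a) \<Rightarrow> 'a" where
  "pFq_trunc m \<alpha> p a q b n x =
     (\<Sum>k=0..m. \<Sum>\<kappa>\<in>partitions_of k.
        (\<Prod>r=1..p. gpoch \<alpha> (a r) \<kappa>) / (fact k * (\<Prod>r=1..q. gpoch \<alpha> (b r) \<kappa>)) * C_diag \<alpha> \<kappa> n x)"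


section \<open>Computations that count arithmetic operations\<close>

text \<open>A counted value is a value together with the number of operations \<open>+, -, *, /\<close> that were
  executed to obtain it, on numbers as well as on partition indices and parts. Comparisons,
  assignments, array accesses and loop counters are free. \<open>charge\<close> books operations that are
  executed outside the operators below.\<close>

type_synonym 'v counted = "'v \<times> nat"

definition cret :: "'v \<Rightarrow> 'v counted" where
  "cret v = (v, 0)"

definition charge :: "nat \<Rightarrow> 'v counted \<Rightarrow> 'v counted" where
  "charge k c = (fst c, snd c + k)"

definition cbind :: "'v counted \<Rightarrow> ('v \<Rightarrow> 'w counted) \<Rightarrow> 'w counted"  (infixr "\<then>" 54) where
  "c \<then> f = charge (snd c) (f (fst c))"

definition cop :: "('u \<Rightarrow> 'v \<Rightarrow> 'w) \<Rightarrow> 'u counted \<Rightarrow> 'v counted \<Rightarrow> 'w counted" where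
  "cop f c d = (f (fst c) (fst d), snd c + snd d + 1)"

abbreviation cplus :: "'v::plus counted \<Rightarrow> 'v counted \<Rightarrow> 'v counted"  (infixl "+\<^sub>c" 65) where
  "c +\<^sub>c d \<equiv> cop (+) c d"

abbreviation cminus :: "'v::minus counted \<Rightarrow> 'v counted \<Rightarrow> 'v counted"  (infixl "-\<^sub>c" 65) where
  "c -\<^sub>c d \<equiv> cop (-) c d"

abbreviation ctimes :: "'v::times counted \<Rightarrow> 'v counted \<Rightarrow> 'v counted"  (infixl "*\<^sub>c" 70) where
  "c *\<^sub>c d \<equiv> cop (*) c d"

abbreviation cdivide :: "'v::divide counted \<Rightarrow> 'v counted \<Rightarrow> 'v counted"  (infixl "'/\<^sub>c" 70) where
  "c /\<^sub>c d \<equiv> cop divide c d"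

abbreviation num :: "nat \<Rightarrow> 'v::semiring_1 counted" where
  "num k \<equiv> cret (of_nat k)"

primrec cfor :: "'i list \<Rightarrow> ('i \<Rightarrow> 's \<Rightarrow> 's counted) \<Rightarrow> 's \<Rightarrow> 's counted" where
  "cfor [] body s = cret s"
| "cfor (i # is) body s = (body i s \<then> (\<lambda>s. cfor is body s))"

definition cprod :: "'i list \<Rightarrow> ('i \<Rightarrow> 'v::comm_semiring_1 counted) \<Rightarrow> 'v counted" where
  "cprod is f = cfor is (\<lambda>i v. cret v *\<^sub>c f i) 1"


section \<open>Algorithm HG\<close>

text \<open>The table \<open>pt k i\<close> of the numbers of partitions of \<open>i\<close> with exactly \<open>k\<close> parts, and its sum
  over \<open>k \<le> n\<close> and \<open>i \<le> m\<close>.\<close>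

definition compute_P :: "nat \<Rightarrow> nat \<Rightarrow> nat counted" where
  "compute_P m n =
     (cfor [1..<Suc n] (\<lambda>k. cfor [1..<Suc m] (\<lambda>i pt.
        (cret (pt (k - 1) (i - 1)) +\<^sub>c cret (if k \<le> i then pt k (i - k) else 0)) \<then>
        (\<lambda>v. cret (pt(k := (pt k)(i := v))))))
      (\<lambda>k i. if k = 0 \<and> i = 0 then 1 else 0)) \<then> (\<lambda>pt.
      cfor [0..<Suc n] (\<lambda>k. cfor [0..<Suc m] (\<lambda>i s. cret s +\<^sub>c cret (pt k i))) 0)"

text \<open>The factor \<open>T\<close> with \<open>Q \<kappa> = Q \<kappa>\<^sub>(\<^sub>i\<^sub>) * T\<close>, where \<open>\<kappa>\<close> is the partition after the increase.\<close>

definition Q_factor ::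
  "'a::field_char_0 \<Rightarrow> nat \<Rightarrow> (nat \<Rightarrow> 'a) \<Rightarrow> nat \<Rightarrow> (nat \<Rightarrow> 'a) \<Rightarrow> (nat \<Rightarrow> nat) \<Rightarrow> nat \<Rightarrow> 'a counted" where
  "Q_factor \<alpha> p a q b \<kappa> i =
     (num (\<kappa> i) -\<^sub>c (num i -\<^sub>c num 1) /\<^sub>c cret \<alpha> -\<^sub>c num 1) \<then> (\<lambda>c.
     (num (\<kappa> i) *\<^sub>c cret \<alpha> -\<^sub>c num i) \<then> (\<lambda>d.
     cprod [1..<Suc p] (\<lambda>j. cret (a j) +\<^sub>c cret c) /\<^sub>c cprod [1..<Suc q] (\<lambda>j. cret (b j) +\<^sub>c cret c)
     *\<^sub>c cprod [1..<\<kappa> i] (\<lambda>j.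
          (cret d -\<^sub>c num j *\<^sub>c cret \<alpha> +\<^sub>c num (conj_part \<kappa> j)) \<then> (\<lambda>e.
          (cret e +\<^sub>c num 1) \<then> (\<lambda>g.
          (cret g -\<^sub>c cret \<alpha>) *\<^sub>c cret e /\<^sub>c (cret g *\<^sub>c (cret e +\<^sub>c cret \<alpha>)))))
     *\<^sub>c cprod [1..<i] (\<lambda>j.
          (num (\<kappa> j) *\<^sub>c cret \<alpha> -\<^sub>c num j -\<^sub>c cret d) \<then> (\<lambda>f.
          (cret f +\<^sub>c cret \<alpha>) \<then> (\<lambda>h.
          (cret h *\<^sub>c cret f) \<then> (\<lambda>l.
          (cret l -\<^sub>c cret f) /\<^sub>c (cret l +\<^sub>c cret h)))))))"

text \<open>The factor of \<open>\<beta>\<close> when \<open>\<mu> k\<close> is decreased by 1; \<open>\<mu>\<close> is the partition before the decrease.\<close>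

definition beta_factor :: "'a::field_char_0 \<Rightarrow> (nat \<Rightarrow> nat) \<Rightarrow> (nat \<Rightarrow> nat) \<Rightarrow> nat \<Rightarrow> 'a" where
  "beta_factor \<alpha> \<kappa> \<mu> k =
     (let \<tau> = of_nat k - \<alpha> * of_nat (\<mu> k);
          u = (\<lambda>r. \<tau> + 1 - of_nat r + \<alpha> * of_nat (\<kappa> r));
          v = (\<lambda>r. \<tau> - of_nat r + \<alpha> * of_nat (\<mu> r));
          w = (\<lambda>r. of_nat (conj_part \<mu> r) - \<tau> - \<alpha> * of_nat r)
      in \<alpha> * (\<Prod>r=1..k. u r / (u r + \<alpha> - 1)) * (\<Prod>r=1..<k. (v r + \<alpha>) / v r)
           * (\<Prod>r=1..<\<mu> k. (w r + \<alpha>) / w r))"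

text \<open>The evaluation of \<open>\<beta> * beta_factor \<alpha> \<kappa> \<mu> k\<close>. Along the columns \<open>r\<close> of a common length \<open>s\<close>, that is
  \<open>\<mu> (Suc s) < r \<le> \<mu> s\<close>, one has \<open>w (r + 1) + \<alpha> = w r\<close>, so that the product of \<open>(w r + \<alpha>) / w r\<close> over
  them is the numerator of the first column divided by the denominator of the last one. The last
  product is evaluated in this way, with one quotient for each \<open>s\<close>; the value is unchanged, see
  \<open>beta_update_value\<close>, and the number of operations is proportional to the number of parts. If
  instead the quotients for all \<open>r < \<mu> k\<close> were multiplied one by one, then for \<open>n = 2\<close> the algorithm
  would execute at least \<open>c * m ^ 5\<close> operations, whereas \<open>(Pmn m 2)\<^sup>2\<close> is of order \<open>m ^ 4\<close>.\<close>

definition beta_update ::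
  "'a::field_char_0 \<Rightarrow> (nat \<Rightarrow> nat) \<Rightarrow> (nat \<Rightarrow> nat) \<Rightarrow> nat \<Rightarrow> 'a \<Rightarrow> 'a counted" where
  "beta_update \<alpha> \<kappa> \<mu> k \<beta> =
     (num k -\<^sub>c cret \<alpha> *\<^sub>c num (\<mu> k)) \<then> (\<lambda>\<tau>.
     cret \<beta> *\<^sub>c (cret \<alpha>
     *\<^sub>c cprod [1..<Suc k] (\<lambda>r.
          (cret \<tau> +\<^sub>c num 1 -\<^sub>c num r +\<^sub>c cret \<alpha> *\<^sub>c num (\<kappa> r)) \<then> (\<lambda>u.
          cret u /\<^sub>c (cret u +\<^sub>c cret \<alpha> -\<^sub>c num 1)))
     *\<^sub>c cprod [1..<k] (\<lambda>r.
          (cret \<tau> -\<^sub>c num r +\<^sub>c cret \<alpha> *\<^sub>c num (\<mu> r)) \<then> (\<lambda>v.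
          (cret v +\<^sub>c cret \<alpha>) /\<^sub>c cret v))
     *\<^sub>c cprod [k..<Suc (conj_part \<mu> 1)] (\<lambda>s.
          (num s -\<^sub>c cret \<tau> -\<^sub>c cret \<alpha> *\<^sub>c num (\<mu> (Suc s)))
          /\<^sub>c (num s -\<^sub>c cret \<tau> -\<^sub>c cret \<alpha> *\<^sub>c (if s = k then num (\<mu> k) -\<^sub>c num 1 else num (\<mu> s))))))"

lemma fst_counted: "fst (cret v) = v" "fst (c \<then> f) = fst (f (fst c))" "fst (cop g c d) = g (fst c) (fst d)"
  by (auto simp: cret_def cbind_def charge_def cop_def)

lemma fst_cprod: "distinct is \<Longrightarrow> fst (cprod is f) = (\<Prod>i\<in>set is. fst (f i))"
proof -
  have "distinct is \<Longrightarrow> fst (cfor is (\<lambda>i v. cret v *\<^sub>c f i) v) = v * (\<Prod>i\<in>set is. fst (f i))" for v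
    by (induction "is" arbitrary: v) (auto simp: fst_counted mult_ac)
  then show "distinct is \<Longrightarrow> ?thesis" by (simp add: cprod_def)
qed

lemma partition_mono:
  assumes "is_partition \<mu>" "1 \<le> i" "i \<le> j" shows "\<mu> j \<le> \<mu> i"
  using assms(3) by (induction j rule: dec_induct)
    (use assms in \<open>auto simp: is_partition_def intro: order_trans\<close>)

lemma conj_part_eq:
  assumes "is_partition \<mu>" "r \<le> \<mu> s" "\<mu> (Suc s) < r" "1 \<le> s"
  shows "conj_part \<mu> r = s"
proof -
  have "i \<le> s" if "r \<le> \<mu> i" for i
    using partition_mono[OF assms(1), of "Suc s" i] assms that by linarith
  moreover have "r \<le> \<mu> i" if "1 \<le> i" "i \<le> s" for i
    using partition_mono[OF assms(1) that] assms by linarith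
  ultimately have "{i. 1 \<le> i \<and> r \<le> \<mu> i} = {1..s}" by auto
  then show ?thesis by (simp add: conj_part_def)
qed

lemma partition_zero:
  assumes "is_partition \<mu>" shows "\<mu> (Suc (conj_part \<mu> 1)) = 0"
proof (rule ccontr)
  assume *: "\<mu> (Suc (conj_part \<mu> 1)) \<noteq> 0"
  have fin: "finite {i. 1 \<le> i \<and> 1 \<le> \<mu> i}"
    by (rule finite_subset[of _ "{i. \<mu> i \<noteq> 0}"]) (use assms in \<open>auto simp: is_partition_def\<close>)
  have "{1..Suc (conj_part \<mu> 1)} \<subseteq> {i. 1 \<le> i \<and> 1 \<le> \<mu> i}"
    using partition_mono[OF assms, of _ "Suc (conj_part \<mu> 1)"] * by fastforce
  from card_mono[OF fin this] show False by (simp add: conj_part_def)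
qed

lemma conj_part_1_ge:
  assumes "is_partition \<mu>" "1 \<le> k" "0 < \<mu> k" shows "k \<le> conj_part \<mu> 1"
  using partition_mono[OF assms(1), of "Suc (conj_part \<mu> 1)" k] partition_zero[OF assms(1)] assms
  by (metis Suc_le_eq le_add1 le_zero_eq not_less_eq_eq not_gr_zero plus_1_eq_Suc)

lemma prod_telescope_nat:
  fixes f :: "nat \<Rightarrow> 'a::field"
  assumes "a \<le> b" "\<And>r. a \<le> r \<Longrightarrow> r \<le> b \<Longrightarrow> f r \<noteq> 0"
  shows "(\<Prod>r\<in>{a<..b}. f (r - 1) / f r) = f a / f b"
  using assms
proof (induction b rule: dec_induct)
  case (step b)
  have "{a<..Suc b} = insert (Suc b) {a<..b}" using step by auto
  then show ?case using step by auto
qed auto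

lemma beta_update_value:
  assumes mu: "is_partition \<mu>" and k: "1 \<le> k" "\<mu> (Suc k) < \<mu> k" and pos: "\<alpha> > 0"
  shows "fst (beta_update (complex_of_real \<alpha>) \<kappa> \<mu> k \<beta>) = \<beta> * beta_factor (complex_of_real \<alpha>) \<kappa> \<mu> k"
proof -
  let ?a = "complex_of_real \<alpha>"
  define \<tau> where "\<tau> = of_nat k - ?a * of_nat (\<mu> k)"
  define L where "L = conj_part \<mu> 1"
  define e where "e s = (if s = k then \<mu> k - 1 else \<mu> s)" for s
  define w where "w s r = of_nat s - \<tau> - ?a * of_nat r" for s r :: nat
  have e: "\<mu> (Suc s) \<le> e s" if "k \<le> s" for s
    using that k mu by (auto simp: e_def is_partition_def)
  have eS: "e (Suc s) = \<mu> (Suc s)" if "k \<le> s" for s using that by (auto simp: e_def)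
  have e_less: "e s < \<mu> k" if "k \<le> s" for s
    using that k partition_mono[OF mu, of "Suc k" s] by (cases "s = k") (auto simp: e_def)
  have w0: "w s r \<noteq> 0" if "k \<le> s" "r < \<mu> k" for s r
  proof -
    have "w s r = complex_of_real (real (s - k) + \<alpha> * real (\<mu> k - r))"
      using that by (simp add: w_def \<tau>_def of_nat_diff algebra_simps)
    moreover have "real (s - k) + \<alpha> * real (\<mu> k - r) > 0"
      using pos that by (intro add_nonneg_pos) auto
    ultimately show ?thesis by (metis less_irrefl of_real_eq_0_iff)
  qed
  have kL: "k \<le> L" using conj_part_1_ge[OF mu k(1)] k(2) by (simp add: L_def)
  have main: "(\<Prod>s=t..L. w s (\<mu> (Suc s)) / w s (e s))
      = (\<Prod>r=1..e t. (w (conj_part \<mu> r) r + ?a) / w (conj_part \<mu> r) r)"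
    if "k \<le> t" "t \<le> Suc L" for t
    using that(2,1)
  proof (induction t rule: inc_induct)
    case base
    have "e (Suc L) = 0" using kL partition_zero[OF mu] by (simp add: e_def L_def)
    then show ?case by simp
  next
    case (step t)
    have "(\<Prod>r\<in>{\<mu> (Suc t)<..e t}. (w (conj_part \<mu> r) r + ?a) / w (conj_part \<mu> r) r)
        = (\<Prod>r\<in>{\<mu> (Suc t)<..e t}. w t (r - 1) / w t r)"
    proof (rule prod.cong[OF refl])
      fix r assume r: "r \<in> {\<mu> (Suc t)<..e t}"
      have "e t \<le> \<mu> t" by (auto simp: e_def)
      then have "conj_part \<mu> r = t" using r step k by (intro conj_part_eq[OF mu]) auto
      moreover have "w t r + ?a = w t (r - 1)"
        using r by (simp add: w_def of_nat_diff algebra_simps)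
      ultimately show "(w (conj_part \<mu> r) r + ?a) / w (conj_part \<mu> r) r = w t (r - 1) / w t r" by simp
    qed
    also have "\<dots> = w t (\<mu> (Suc t)) / w t (e t)"
    proof (rule prod_telescope_nat)
      fix r assume "r \<le> e t"
      then show "w t r \<noteq> 0" using e_less[of t] step by (intro w0) auto
    qed (use e step in auto)
    finally have *: "w t (\<mu> (Suc t)) / w t (e t)
        = (\<Prod>r\<in>{\<mu> (Suc t)<..e t}. (w (conj_part \<mu> r) r + ?a) / w (conj_part \<mu> r) r)" by simp
    have "{t..L} = insert t {Suc t..L}" using step by auto
    moreover have "{1..e t} = {1..\<mu> (Suc t)} \<union> {\<mu> (Suc t)<..e t}" using e[of t] step by auto
    ultimately show ?case using step eS[of t] *
      by (simp add: prod.union_disjoint ivl_disj_int)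
  qed
  have W: "(\<Prod>s=k..L. (of_nat s - \<tau> - ?a * of_nat (\<mu> (Suc s)))
          / (of_nat s - \<tau> - ?a * (if s = k then of_nat (\<mu> k) - 1 else of_nat (\<mu> s))))
      = (\<Prod>r=1..<\<mu> k. (of_nat (conj_part \<mu> r) - \<tau> - ?a * of_nat r + ?a)
          / (of_nat (conj_part \<mu> r) - \<tau> - ?a * of_nat r))"
  proof -
    have "(if s = k then of_nat (\<mu> k) - 1 else of_nat (\<mu> s)) = (of_nat (e s) :: complex)" for s
      using k by (simp add: e_def of_nat_diff)
    moreover have "{1..<\<mu> k} = {1..e k}" by (auto simp: e_def)
    ultimately show ?thesis using main[of k] kL by (simp add: w_def)
  qed
  have L': "{k..<Suc (conj_part \<mu> 1)} = {k..L}" "{1..<Suc k} = {1..k}" by (auto simp: L_def)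
  show ?thesis
    unfolding beta_update_def beta_factor_def Let_def \<tau>_def[symmetric]
    by (simp add: fst_counted fst_cprod if_distrib[of fst] \<tau>_def[symmetric] L' W del: One_nat_def upt_Suc cong: if_cong)
qed

definition index_of :: "(nat \<Rightarrow> nat) \<Rightarrow> (nat \<Rightarrow> nat) \<Rightarrow> nat counted" where
  "index_of D \<mu> = cfor [2..<Suc (conj_part \<mu> 1)] (\<lambda>s N. cret (D N) +\<^sub>c cret (\<mu> s) -\<^sub>c cret 1) (\<mu> 1)"

lemma conj_part_dec: "0 < \<mu> i - 1 \<Longrightarrow> conj_part (\<mu>(i := \<mu> i - 1)) 1 = conj_part \<mu> 1"
  unfolding conj_part_def by (rule arg_cong[where f = card]) (auto split: if_splits)

lemma jack_measure:
  assumes "0 < (\<mu> :: nat \<Rightarrow> nat) i - 1" "i \<le> conj_part \<mu> 1"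
  shows "(\<Sum>s\<le>conj_part (\<mu>(i := \<mu> i - 1)) 1. (\<mu>(i := \<mu> i - 1)) s) < (\<Sum>s\<le>conj_part \<mu> 1. \<mu> s)"
  unfolding conj_part_dec[of \<mu>, OF assms(1)]
  by (rule sum_strict_mono_ex1) (use assms in \<open>auto intro!: bexI[of _ i]\<close>)

text \<open>\<open>jack\<close> and its loop. \<open>JJ N t\<close> is the array entry, \<open>N\<kappa>\<close> and \<open>N\<close> are the indices of \<open>\<kappa>\<close> and \<open>\<mu>\<close>, and
  \<open>acc\<close> is the current value of the entry \<open>JJ N\<kappa> t\<close>, which is returned with the additions made.
  The power \<open>pw = x t ^ c\<close> is handed down in place of its exponent \<open>c\<close>. Since the
  arguments are passed by value, \<open>\<mu>\<close>, \<open>N\<close>, \<open>\<beta>\<close> need not be restored. Two operations are charged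
  for a unit change of a part and of the corresponding part of the conjugate partition.\<close>

function (sequential)
  jack :: "'a::field_char_0 \<Rightarrow> (nat \<Rightarrow> 'a) \<Rightarrow> (nat \<Rightarrow> nat) \<Rightarrow> nat \<Rightarrow> (nat \<Rightarrow> nat) \<Rightarrow> (nat \<Rightarrow> nat \<Rightarrow> 'a) \<Rightarrow> nat \<Rightarrow>
    nat \<Rightarrow> (nat \<Rightarrow> nat) \<Rightarrow> nat \<Rightarrow> 'a \<Rightarrow> 'a \<Rightarrow> 'a \<Rightarrow> 'a counted" and
  jack_loop :: "'a \<Rightarrow> (nat \<Rightarrow> 'a) \<Rightarrow> (nat \<Rightarrow> nat) \<Rightarrow> nat \<Rightarrow> (nat \<Rightarrow> nat) \<Rightarrow> (nat \<Rightarrow> nat \<Rightarrow> 'a) \<Rightarrow> nat \<Rightarrow>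
    nat \<Rightarrow> (nat \<Rightarrow> nat) \<Rightarrow> nat \<Rightarrow> 'a \<Rightarrow> 'a \<Rightarrow> 'a \<Rightarrow> 'a counted"
where
  "jack \<alpha> x \<kappa> N\<kappa> D JJ t k \<mu> N \<beta> pw acc =
     (jack_loop \<alpha> x \<kappa> N\<kappa> D JJ t k \<mu> N \<beta> pw acc \<then> (\<lambda>acc.
      if k = 0 then cret acc +\<^sub>c cret (JJ N\<kappa> (t - 1))
      else cret acc +\<^sub>c cret \<beta> *\<^sub>c cret (JJ N (t - 1)) *\<^sub>c cret pw))"
| "jack_loop \<alpha> x \<kappa> N\<kappa> D JJ t i \<mu> N \<beta> pw acc =
     (if conj_part \<mu> 1 < i then cret acc
      else
        (if 0 < i \<and> \<mu> (Suc i) < \<mu> i then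
           charge 2 (index_of D (\<mu>(i := \<mu> i - 1)) \<then> (\<lambda>N'.
           beta_update \<alpha> \<kappa> \<mu> i \<beta> \<then> (\<lambda>\<beta>'.
           (cret pw *\<^sub>c cret (x t)) \<then> (\<lambda>pw'.
           if 0 < \<mu> i - 1 then jack \<alpha> x \<kappa> N\<kappa> D JJ t i (\<mu>(i := \<mu> i - 1)) N' \<beta>' pw' acc
           else cret acc +\<^sub>c cret \<beta>' *\<^sub>c cret (JJ N' (t - 1)) *\<^sub>c cret pw'))))
         else cret acc) \<then> (\<lambda>acc.
        jack_loop \<alpha> x \<kappa> N\<kappa> D JJ t (Suc i) \<mu> N \<beta> pw acc))"
  by pat_completeness auto

termination
  by (relation "measures
    [\<lambda>v. case v of Inl (\<alpha>, x, \<kappa>, N\<kappa>, D, JJ, t, k, \<mu>, _) \<Rightarrow> (\<Sum>i\<le>conj_part \<mu> 1. \<mu> i)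
                 | Inr (\<alpha>, x, \<kappa>, N\<kappa>, D, JJ, t, k, \<mu>, _) \<Rightarrow> (\<Sum>i\<le>conj_part \<mu> 1. \<mu> i),
     \<lambda>v. case v of Inl (\<alpha>, x, \<kappa>, N\<kappa>, D, JJ, t, k, \<mu>, _) \<Rightarrow> Suc (Suc (conj_part \<mu> 1) - k)
                 | Inr (\<alpha>, x, \<kappa>, N\<kappa>, D, JJ, t, k, \<mu>, _) \<Rightarrow> Suc (conj_part \<mu> 1) - k]")
     (auto simp: jack_measure[simplified])

record 'a hg_state =
  next_index :: nat
  D_array :: "nat \<Rightarrow> nat"
  J_array :: "nat \<Rightarrow> nat \<Rightarrow> 'a"
  partial_sum :: 'a

text \<open>One pass through the body of the loop of \<open>summation\<close>, without the recursive call. Here \<open>\<kappa>\<close> already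
  has its new part \<open>\<kappa> i\<close>, \<open>N\<^sub>0\<close> is the index of \<open>(\<kappa> 1, \<dots>, \<kappa> (i - 1))\<close>, and \<open>N\<close> is the index of the
  partition of the preceding pass. The result consists of the new \<open>z\<close>, the index of \<open>\<kappa>\<close> and the
  new state.\<close>

definition visit ::
  "'a::field_char_0 \<Rightarrow> nat \<Rightarrow> (nat \<Rightarrow> 'a) \<Rightarrow> nat \<Rightarrow> (nat \<Rightarrow> 'a) \<Rightarrow> nat \<Rightarrow> (nat \<Rightarrow> 'a) \<Rightarrow>
   nat \<Rightarrow> 'a \<Rightarrow> nat \<Rightarrow> (nat \<Rightarrow> nat) \<Rightarrow> nat \<Rightarrow> nat \<Rightarrow> 'a hg_state \<Rightarrow> ('a \<times> nat \<times> 'a hg_state) counted" where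
  "visit \<alpha> p a q b n x i z r \<kappa> N\<^sub>0 N st =
     charge 2
     ((if \<kappa> i = 1 \<and> 1 < i then
         (cret (next_index st) +\<^sub>c cret r) \<then> (\<lambda>H.
         cret (next_index st,
               st\<lparr>next_index := H, D_array := (D_array st)(N\<^sub>0 := next_index st)\<rparr>))
       else (cret N +\<^sub>c cret 1) \<then> (\<lambda>N. cret (N, st))) \<then> (\<lambda>(N, st).
      (cret z *\<^sub>c Q_factor \<alpha> p a q b \<kappa> i) \<then> (\<lambda>z.
      (if conj_part \<kappa> 1 = 1 then
         (cret (x 1) *\<^sub>c (num 1 +\<^sub>c cret \<alpha> *\<^sub>c (num (\<kappa> 1) -\<^sub>c num 1)) *\<^sub>c cret (J_array st (N - 1) 1)) \<then> (\<lambda>v.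
         cret ((J_array st)(N := (J_array st N)(1 := v))))
       else cret (J_array st)) \<then> (\<lambda>JJ.
      cfor [2..<Suc n] (\<lambda>t JJ.
         jack \<alpha> x \<kappa> N (D_array st) JJ t 0 \<kappa> N 1 1 (JJ N t) \<then> (\<lambda>v.
         cret (JJ(N := (JJ N)(t := v))))) JJ \<then> (\<lambda>JJ.
      (cret (partial_sum st) +\<^sub>c cret z *\<^sub>c cret (JJ N n)) \<then> (\<lambda>s.
      cret (z, N, st\<lparr>J_array := JJ, partial_sum := s\<rparr>)))))))"

text \<open>\<open>summation\<close> and its loop over \<open>\<kappa> i = l, \<dots>, r\<close>. Again \<open>\<kappa>\<close> is passed by value and need not be
  reset.\<close>

function (sequential)
  summation :: "'a::field_char_0 \<Rightarrow> nat \<Rightarrow> (nat \<Rightarrow> 'a) \<Rightarrow> nat \<Rightarrow> (nat \<Rightarrow> 'a) \<Rightarrow> nat \<Rightarrow> (nat \<Rightarrow> 'a) \<Rightarrow>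
    nat \<Rightarrow> 'a \<Rightarrow> nat \<Rightarrow> (nat \<Rightarrow> nat) \<Rightarrow> nat \<Rightarrow> 'a hg_state \<Rightarrow> 'a hg_state counted" and
  summation_loop :: "'a \<Rightarrow> nat \<Rightarrow> (nat \<Rightarrow> 'a) \<Rightarrow> nat \<Rightarrow> (nat \<Rightarrow> 'a) \<Rightarrow> nat \<Rightarrow> (nat \<Rightarrow> 'a) \<Rightarrow>
    nat \<Rightarrow> 'a \<Rightarrow> nat \<Rightarrow> nat \<Rightarrow> nat \<Rightarrow> (nat \<Rightarrow> nat) \<Rightarrow> nat \<Rightarrow> nat \<Rightarrow> 'a hg_state \<Rightarrow> 'a hg_state counted"
where
  "summation \<alpha> p a q b n x i z j \<kappa> N st =
     summation_loop \<alpha> p a q b n x i z j (if i = 1 then j else min (\<kappa> (i - 1)) j) 1 \<kappa> N N st"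
| "summation_loop \<alpha> p a q b n x i z j r l \<kappa> N\<^sub>0 N st =
     (if \<not> (1 \<le> l \<and> l \<le> r) then cret st
      else
        visit \<alpha> p a q b n x i z r (\<kappa>(i := l)) N\<^sub>0 N st \<then> (\<lambda>(z, N, st).
        (if l < j \<and> i < n
         then charge 2 (summation \<alpha> p a q b n x (i + 1) z (j - l) (\<kappa>(i := l)) N st)
         else cret st) \<then> (\<lambda>st.
        summation_loop \<alpha> p a q b n x i z j r (l + 1) \<kappa> N\<^sub>0 N st)))"
  by pat_completeness auto

termination
  by (relation "measures
    [\<lambda>v. case v of Inl (\<alpha>, p, a, q, b, n, x, i, z, j, _) \<Rightarrow> j
                 | Inr (\<alpha>, p, a, q, b, n, x, i, z, j, _) \<Rightarrow> j,
     \<lambda>v. case v of Inl _ \<Rightarrow> 1 | Inr _ \<Rightarrow> 0,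
     \<lambda>v. case v of Inl _ \<Rightarrow> 0 | Inr (\<alpha>, p, a, q, b, n, x, i, z, j, r, l, _) \<Rightarrow> Suc r - l]")
     auto

text \<open>The number of partitions is the number of rows of the array \<open>J_array\<close>; its value has no
  influence on the result, since arrays are modelled as functions.\<close>

definition hg ::
  "nat \<Rightarrow> 'a::field_char_0 \<Rightarrow> nat \<Rightarrow> (nat \<Rightarrow> 'a) \<Rightarrow> nat \<Rightarrow> (nat \<Rightarrow> 'a) \<Rightarrow> nat \<Rightarrow> (nat \<Rightarrow> 'a) \<Rightarrow> 'a counted" where
  "hg m \<alpha> p a q b n x =
     compute_P m n \<then> (\<lambda>_.
     (cret m +\<^sub>c cret 1) \<then> (\<lambda>H.
     summation \<alpha> p a q b n x 1 1 m (\<lambda>_. 0) 0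
       \<lparr>next_index = H, D_array = (\<lambda>_. 0), J_array = (\<lambda>N t. if N = 0 then 1 else 0),
        partial_sum = 1\<rparr> \<then> (\<lambda>st.
     cret (partial_sum st))))"

definition hg_value ::
  "nat \<Rightarrow> 'a::field_char_0 \<Rightarrow> nat \<Rightarrow> (nat \<Rightarrow> 'a) \<Rightarrow> nat \<Rightarrow> (nat \<Rightarrow> 'a) \<Rightarrow> nat \<Rightarrow> (nat \<Rightarrow> 'a) \<Rightarrow> 'a" where
  "hg_value m \<alpha> p a q b n x = fst (hg m \<alpha> p a q b n x)"

definition hg_cost ::
  "nat \<Rightarrow> 'a::field_char_0 \<Rightarrow> nat \<Rightarrow> (nat \<Rightarrow> 'a) \<Rightarrow> nat \<Rightarrow> (nat \<Rightarrow> 'a) \<Rightarrow> nat \<Rightarrow> (nat \<Rightarrow> 'a) \<Rightarrow> nat" where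
  "hg_cost m \<alpha> p a q b n x = snd (hg m \<alpha> p a q b n x)"

definition subexponential :: "(nat \<Rightarrow> real) \<Rightarrow> bool" where
  "subexponential g \<longleftrightarrow> (\<forall>\<epsilon>>0. g \<in> o(\<lambda>m. exp (\<epsilon> * real m)))"

end

theory Submission
  imports Defs "HOL-Real_Asymp.Real_Asymp"
begin

text \<open>Correctness. \<open>summation\<close> is a depth-first search in the tree of partitions whose edges append a last
  part, so it visits the partitions with at most \<open>n\<close> parts and size at most \<open>m\<close> in dictionary order,
  each once. This order extends inclusion; hence at a visit of \<open>\<kappa>\<close> all smaller partitions contained in
  \<open>\<kappa>\<close> already have their final array entries. \<open>jack\<close> removes cells from the ends of the rows, going
  down the rows, and in this way reaches each \<open>\<mu>\<close> with \<open>\<kappa>/\<mu>\<close> a horizontal strip exactly once. Removing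
  a corner cell changes hook lengths only in its own row and column, and comparing them gives the two
  update formulas (\<open>Q_coeff_corner\<close>, \<open>strip_beta_corner\<close>). So \<open>jack\<close> evaluates the recurrence of the
  Jack function (\<open>jack_value\<close>), and the invariant of the search (\<open>summation_correct\<close>) says that the
  entries of the visited partitions are Jack functions and that indices do not collide.

  Cost. A visit of \<open>\<kappa>\<close> with \<open>l\<close> parts makes \<open>n - 1\<close> calls of \<open>jack\<close>, each of which executes \<open>O(l)\<close>
  operations for each horizontal strip (\<open>jack_cost\<close>). Since there are \<open>Pmn m n\<close> visits at most, the bound
  follows if \<open>l\<close> times the number of strips is \<open>O(Pmn m n)\<close> for every single \<open>\<kappa>\<close>
  (\<open>length_times_strips_le\<close>). The strips correspond to the points of a box: if \<open>\<kappa>\<close> has \<open>d s\<close> columns of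
  length \<open>s\<close>, then \<open>\<mu>\<close> is described by multiplicities \<open>c s \<le> d s\<close>. By reflecting the box, at least half
  of its points give partitions of size at most \<open>m / 2\<close>. For each of these, the remaining \<open>m / 2\<close> cells
  leave room for \<open>d s + 1\<close> more columns of length \<open>s\<close>, for at least about \<open>l / 4\<close> different \<open>s\<close>; all
  the partitions obtained are different, because the multiplicity that exceeds its bound
  reveals \<open>s\<close>.

  Growth. For \<open>0 < y < 1\<close> the number of partitions of size at most \<open>m\<close> is at most
  \<open>y powr (- m)\<close> times the generating product of \<open>1 / (1 - y ^ k)\<close>; with \<open>y = exp (- s)\<close> this is at most
  \<open>exp (m * s + pi\<^sup>2 / (6 * s))\<close>, and the minimum over \<open>s\<close> is the asserted bound.\<close>


section \<open>Partitions and their column multiplicities\<close>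

lemma partition_support:
  assumes "is_partition \<kappa>" "\<kappa> (Suc n) = 0" "n < i"
  shows "\<kappa> i = 0"
  using partition_mono[OF assms(1), of "Suc n" i] assms by auto

lemma psize_eq:
  assumes "is_partition \<kappa>" "\<kappa> (Suc n) = 0"
  shows "psize \<kappa> = (\<Sum>i=1..n. \<kappa> i)"
  unfolding psize_def
proof (rule sum.mono_neutral_left)
  show "{i. \<kappa> i \<noteq> 0} \<subseteq> {1..n}"
  proof
    fix i assume i: "i \<in> {i. \<kappa> i \<noteq> 0}"
    then have "i \<noteq> 0" using assms(1) unfolding is_partition_def by (metis mem_Collect_eq)
    moreover have "i \<le> n" using partition_support[OF assms, of i] i by (cases "n < i") auto
    ultimately show "i \<in> {1..n}" by simp
  qed
qed auto

lemma partition_part_le: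
  assumes "is_partition \<kappa>" shows "\<kappa> i \<le> psize \<kappa>"
proof (cases "\<kappa> i = 0")
  case False
  then show ?thesis unfolding psize_def
    using assms by (intro member_le_sum) (auto simp: is_partition_def)
qed auto

lemma partition_conj_part_zero:
  assumes "is_partition \<kappa>" "conj_part \<kappa> 1 < i"
  shows "\<kappa> i = 0"
  using partition_support[OF assms(1) partition_zero[OF assms(1)] assms(2)] .

lemma conj_part_1_pos:
  assumes "is_partition \<kappa>" "1 \<le> i" "i \<le> conj_part \<kappa> 1"
  shows "0 < \<kappa> i"
proof (rule ccontr)
  assume "\<not> 0 < \<kappa> i"
  then have "\<kappa> (Suc (i - 1)) = 0" using assms by simp
  then have "{j. 1 \<le> j \<and> 1 \<le> \<kappa> j} \<subseteq> {1..i - 1}"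
    using partition_support[OF assms(1), of "i - 1"] by (auto simp: not_less[symmetric])
  from card_mono[OF _ this] show False using assms by (simp add: conj_part_def)
qed

lemma conj_part_1_eqI:
  assumes "is_partition \<kappa>" "\<kappa> (Suc i) = 0" "1 \<le> i \<Longrightarrow> 0 < \<kappa> i"
  shows "conj_part \<kappa> 1 = i"
proof (cases "i = 0")
  case True
  then show ?thesis using conj_part_1_pos[OF assms(1), of 1] assms by (cases "conj_part \<kappa> 1") auto
next
  case False
  then show ?thesis using assms conj_part_eq[OF assms(1), of 1 i] by auto
qed

lemma partition_length_le:
  assumes "is_partition \<kappa>" shows "conj_part \<kappa> 1 \<le> psize \<kappa>"
proof -
  have "(\<Sum>i=1..conj_part \<kappa> 1. 1) \<le> (\<Sum>i=1..conj_part \<kappa> 1. \<kappa> i)"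
    by (rule sum_mono) (use conj_part_1_pos[OF assms] in fastforce)
  also have "\<dots> = psize \<kappa>" by (rule psize_eq[OF assms partition_zero[OF assms], symmetric])
  finally show ?thesis by simp
qed

lemma partition_size_zero:
  assumes "is_partition \<kappa>" "psize \<kappa> \<le> m" shows "\<kappa> (Suc m) = 0"
  using partition_length_le[OF assms(1)] partition_conj_part_zero[OF assms(1)] assms(2) by simp

lemma psize_mono:
  assumes "is_partition \<kappa>" "is_partition \<mu>" "\<And>i. 1 \<le> i \<Longrightarrow> \<mu> i \<le> \<kappa> i"
  shows "psize \<mu> \<le> psize \<kappa>"
proof -
  let ?l = "conj_part \<kappa> 1"
  have z: "\<kappa> (Suc ?l) = 0" by (rule partition_zero[OF assms(1)])
  have "psize \<mu> = (\<Sum>i=1..?l. \<mu> i)"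
    using assms(3)[of "Suc ?l"] z by (intro psize_eq[OF assms(2)]) auto
  also have "\<dots> \<le> (\<Sum>i=1..?l. \<kappa> i)" by (intro sum_mono assms(3)) auto
  also have "\<dots> = psize \<kappa>" by (rule psize_eq[OF assms(1) z, symmetric])
  finally show ?thesis .
qed

lemma sum_parts_le:
  assumes "is_partition \<kappa>" shows "(\<Sum>i=1..k. \<kappa> i) \<le> psize \<kappa>"
proof -
  let ?l = "conj_part \<kappa> 1 + k"
  have "\<kappa> (Suc ?l) = 0" by (rule partition_conj_part_zero[OF assms]) simp
  then have "psize \<kappa> = (\<Sum>i=1..?l. \<kappa> i)" by (rule psize_eq[OF assms])
  moreover have "(\<Sum>i=1..k. \<kappa> i) \<le> (\<Sum>i=1..?l. \<kappa> i)" by (rule sum_mono2) auto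
  ultimately show ?thesis by simp
qed

text \<open>The multiplicities \<open>c s\<close> of the columns of length \<open>s\<close> are free coordinates for the partitions with
  at most \<open>n\<close> parts, and the size is linear in them.\<close>

definition with_columns :: "nat \<Rightarrow> (nat \<Rightarrow> nat) \<Rightarrow> nat \<Rightarrow> nat" where
  "with_columns n c i = (if i = 0 then 0 else \<Sum>s=i..n. c s)"

lemma with_columns_Suc:
  "1 \<le> i \<Longrightarrow> i \<le> n \<Longrightarrow> with_columns n c i = c i + with_columns n c (Suc i)"
  by (simp add: with_columns_def sum.atLeast_Suc_atMost)

lemma with_columns_zero: "n < i \<Longrightarrow> with_columns n c i = 0"
  by (simp add: with_columns_def)

lemma is_partition_with_columns: "is_partition (with_columns n c)"
proof -
  have "{i. with_columns n c i \<noteq> 0} \<subseteq> {..n}"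
    using with_columns_zero[of n] by (auto simp: not_less[symmetric])
  then have "finite {i. with_columns n c i \<noteq> 0}" by (rule finite_subset) simp
  moreover have "with_columns n c (Suc i) \<le> with_columns n c i" if "1 \<le> i" for i
    using with_columns_Suc[of i n c] with_columns_zero[of n "Suc i" c] that by (cases "i \<le> n") auto
  ultimately show ?thesis by (auto simp: is_partition_def with_columns_def)
qed

lemma psize_with_columns: "psize (with_columns n c) = (\<Sum>s=1..n. s * c s)"
proof -
  have "(\<Sum>i=1..n. with_columns n c i) = (\<Sum>s=1..n. s * c s)"
  proof (induction n)
    case (Suc n)
    have "(\<Sum>i=1..Suc n. with_columns (Suc n) c i) = (\<Sum>i=1..Suc n. with_columns n c i + c (Suc n))"
      by (rule sum.cong) (auto simp: with_columns_def)
    then show ?case using Suc by (simp add: sum.distrib with_columns_zero)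
  qed simp
  then show ?thesis
    using psize_eq[OF is_partition_with_columns with_columns_zero[of n "Suc n" c]] by simp
qed

lemma with_columns_inj:
  assumes "with_columns n c = with_columns n c'" "c \<in> extensional {1..n}" "c' \<in> extensional {1..n}"
  shows "c = c'"
proof (rule extensionalityI[OF assms(2,3)])
  fix i assume "i \<in> {1..n}"
  then show "c i = c' i"
    using with_columns_Suc[of i n c] with_columns_Suc[of i n c'] assms(1) by auto
qed

lemma partition_with_columns:
  assumes "is_partition \<kappa>" "\<kappa> (Suc n) = 0"
  shows "with_columns n (\<lambda>s. \<kappa> s - \<kappa> (Suc s)) = \<kappa>"
proof
  fix i
  show "with_columns n (\<lambda>s. \<kappa> s - \<kappa> (Suc s)) i = \<kappa> i"
  proof (cases "1 \<le> i \<and> i \<le> n")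
    case True
    then have "i \<le> Suc n" "1 \<le> i" by auto
    then show ?thesis
    proof (induction i rule: inc_induct)
      case base then show ?case using assms by (simp add: with_columns_zero)
    next
      case (step i)
      then show ?case using with_columns_Suc[of i n] assms(1) by (simp add: is_partition_def)
    qed
  next
    case False
    then show ?thesis
      using partition_support[OF assms, of i] assms(1)
      by (cases "i = 0") (auto simp: with_columns_zero is_partition_def with_columns_def)
  qed
qed

lemma psize_columns:
  assumes "is_partition \<kappa>" "\<kappa> (Suc n) = 0"
  shows "psize \<kappa> = (\<Sum>s=1..n. s * (\<kappa> s - \<kappa> (Suc s)))"
  using psize_with_columns[of n "\<lambda>s. \<kappa> s - \<kappa> (Suc s)"] by (simp only: partition_with_columns[OF assms])

lemma columns_inj:
  assumes "is_partition \<kappa>" "\<kappa> (Suc n) = 0" "is_partition \<kappa>'" "\<kappa>' (Suc n) = 0"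
    and "\<And>s. s \<in> {1..n} \<Longrightarrow> \<kappa> s - \<kappa> (Suc s) = \<kappa>' s - \<kappa>' (Suc s)"
  shows "\<kappa> = \<kappa>'"
proof -
  have "with_columns n (\<lambda>s. \<kappa> s - \<kappa> (Suc s)) = with_columns n (\<lambda>s. \<kappa>' s - \<kappa>' (Suc s))"
    by (rule ext) (auto simp: with_columns_def intro!: sum.cong assms(5))
  then show ?thesis
    by (simp only: partition_with_columns[OF assms(1,2)] partition_with_columns[OF assms(3,4)])
qed

lemma finite_bounded_partitions: "finite (bounded_partitions m n)"
proof (rule finite_imageD)
  let ?f = "\<lambda>\<kappa>::nat \<Rightarrow> nat. restrict \<kappa> {1..n}"
  have "?f ` bounded_partitions m n \<subseteq> {1..n} \<rightarrow>\<^sub>E {..m}"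
    using partition_part_le by (fastforce simp: bounded_partitions_def intro: order_trans)
  then show "finite (?f ` bounded_partitions m n)"
    by (rule finite_subset) (auto intro: finite_PiE)
  show "inj_on ?f (bounded_partitions m n)"
  proof (rule inj_onI, rule ext)
    fix \<kappa> \<mu> i assume A: "\<kappa> \<in> bounded_partitions m n" "\<mu> \<in> bounded_partitions m n" "?f \<kappa> = ?f \<mu>"
    show "\<kappa> i = \<mu> i"
    proof (cases "i \<in> {1..n}")
      case True then show ?thesis using fun_cong[OF A(3), of i] by simp
    next
      case False
      then show ?thesis using A partition_support[of \<kappa> n i] partition_support[of \<mu> n i]
        by (cases "i = 0") (auto simp: bounded_partitions_def is_partition_def)
    qed
  qed
qed

lemma partitions_of_eq: "partitions_of k = {\<kappa> \<in> bounded_partitions k k. psize \<kappa> = k}"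
  using partition_size_zero by (auto simp: partitions_of_def bounded_partitions_def)

lemma finite_partitions_of: "finite (partitions_of k)"
  using finite_bounded_partitions by (simp add: partitions_of_eq)

lemma sum_num_partitions: "(\<Sum>i=0..m. num_partitions i) = Pmn m m"
proof -
  have "bounded_partitions m m = (\<Union>i\<in>{0..m}. partitions_of i)"
    using partition_size_zero by (auto simp: partitions_of_def bounded_partitions_def)
  moreover have "card (\<Union>i\<in>{0..m}. partitions_of i) = (\<Sum>i=0..m. card (partitions_of i))"
    by (rule card_UN_disjoint) (auto simp: finite_partitions_of, auto simp: partitions_of_def)
  ultimately show ?thesis by (simp add: Pmn_def num_partitions_def)
qed

lemma Pmn_le: "Pmn m n \<le> Pmn m m"
  unfolding Pmn_def using partition_size_zero
  by (intro card_mono finite_bounded_partitions) (auto simp: bounded_partitions_def)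

text \<open>The partitions with at most one part already number \<open>m + 1\<close>.\<close>

lemma Pmn_ge: assumes "1 \<le> n" shows "Suc m \<le> Pmn m n"
proof -
  let ?f = "\<lambda>l. with_columns 1 (\<lambda>_. l)"
  have "inj_on ?f {..m}" by (rule inj_onI, drule fun_cong[of _ _ 1]) (simp add: with_columns_def)
  moreover have "?f ` {..m} \<subseteq> bounded_partitions m n"
    using assms by (auto simp: bounded_partitions_def is_partition_with_columns psize_with_columns with_columns_zero)
  ultimately show ?thesis unfolding Pmn_def
    using card_inj_on_le[of ?f "{..m}", OF _ _ finite_bounded_partitions] by simp
qed


section \<open>The growth of the number of partitions\<close>

text \<open>In the generating function of all partitions, each partition of size at most \<open>m\<close> contributes at
  least \<open>y ^ m\<close>; grouping by column multiplicities turns the sum into a product of geometric sums.\<close>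

lemma Pmn_generating:
  fixes y :: real
  assumes "0 < y" "y < 1"
  shows "real (Pmn m m) * y ^ m \<le> (\<Prod>k=1..m. 1 / (1 - y ^ k))"
proof -
  let ?B = "bounded_partitions m m"
  define f where "f \<kappa> = restrict (\<lambda>k. \<kappa> k - \<kappa> (Suc k)) {1..m}" for \<kappa> :: "nat \<Rightarrow> nat"
  have "real (Pmn m m) * y ^ m = (\<Sum>\<kappa>\<in>?B. y ^ m)"
    by (simp add: Pmn_def)
  also have "\<dots> \<le> (\<Sum>\<kappa>\<in>?B. y ^ psize \<kappa>)"
    using assms by (intro sum_mono power_decreasing) (auto simp: bounded_partitions_def)
  also have "\<dots> = (\<Sum>\<kappa>\<in>?B. \<Prod>k=1..m. (y ^ k) ^ f \<kappa> k)"
  proof (rule sum.cong[OF refl])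
    fix \<kappa> assume "\<kappa> \<in> ?B"
    then have "psize \<kappa> = (\<Sum>s=1..m. s * (\<kappa> s - \<kappa> (Suc s)))"
      by (intro psize_columns) (auto simp: bounded_partitions_def)
    then show "y ^ psize \<kappa> = (\<Prod>k=1..m. (y ^ k) ^ f \<kappa> k)"
      by (simp add: f_def power_sum power_mult)
  qed
  also have "\<dots> = (\<Sum>c\<in>f ` ?B. \<Prod>k=1..m. (y ^ k) ^ c k)"
  proof -
    have "inj_on f ?B"
    proof (rule inj_onI)
      fix \<kappa> \<mu> assume *: "\<kappa> \<in> ?B" "\<mu> \<in> ?B" "f \<kappa> = f \<mu>"
      have "\<kappa> s - \<kappa> (Suc s) = \<mu> s - \<mu> (Suc s)" if "s \<in> {1..m}" for s
        using fun_cong[OF *(3), of s] that by (simp add: f_def)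
      then show "\<kappa> = \<mu>" using * by (intro columns_inj[of \<kappa> m \<mu>]) (auto simp: bounded_partitions_def)
    qed
    then show ?thesis by (simp add: sum.reindex)
  qed
  also have "\<dots> \<le> (\<Sum>c\<in>{1..m} \<rightarrow>\<^sub>E {..m}. \<Prod>k=1..m. (y ^ k) ^ c k)"
  proof (rule sum_mono2)
    show "f ` ?B \<subseteq> {1..m} \<rightarrow>\<^sub>E {..m}"
      using partition_part_le
      by (fastforce simp: f_def bounded_partitions_def intro: order_trans[OF diff_le_self] order_trans)
  qed (use assms in \<open>auto intro: finite_PiE prod_nonneg\<close>)
  also have "\<dots> = (\<Prod>k=1..m. \<Sum>c\<le>m. (y ^ k) ^ c)"
    by (rule prod_sum_PiE[symmetric]) auto
  also have "\<dots> \<le> (\<Prod>k=1..m. 1 / (1 - y ^ k))"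
  proof (rule prod_mono, intro conjI)
    fix k assume "k \<in> {1..m}"
    then have *: "y ^ k < 1" "0 < y ^ k" using assms by (auto intro: power_Suc_less_one simp: power_less_one_iff)
    show "0 \<le> (\<Sum>c\<le>m. (y ^ k) ^ c)" using assms by (intro sum_nonneg) auto
    have "(\<Sum>c\<le>m. (y ^ k) ^ c) = (1 - (y ^ k) ^ Suc m) / (1 - y ^ k)"
      using * by (simp add: sum_gp0)
    also have "\<dots> \<le> 1 / (1 - y ^ k)" using * by (intro divide_right_mono) auto
    finally show "(\<Sum>c\<le>m. (y ^ k) ^ c) \<le> 1 / (1 - y ^ k)" .
  qed
  finally show ?thesis .
qed

lemma ln_one_minus_sums:
  fixes y :: real
  assumes "0 < y" "y < 1"
  shows "(\<lambda>j. y ^ Suc j / real (Suc j)) sums (- ln (1 - y))"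
proof -
  have "(\<lambda>j. - ((- (- y)) ^ j) / real j) sums ln (1 + - y)"
    using assms by (intro ln_series') auto
  from sums_minus[OF this] have "(\<lambda>j. y ^ j / real j) sums (- ln (1 - y))" by simp
  then show ?thesis using sums_Suc_iff[of "\<lambda>j. y ^ j / real j" "- ln (1 - y)"] by (simp del: power_Suc)
qed

text \<open>After expanding the logarithms and exchanging the sums, the \<open>j\<close>-th term is \<open>1 / j\<close> times a
  geometric sum in \<open>exp (- s * j)\<close>, which is at most \<open>1 / (s * j)\<close>; what remains is \<open>\<Sum>j. 1 / j\<^sup>2\<close>.\<close>

lemma ln_generating_le:
  fixes s :: real
  assumes s: "s > 0"
  shows "(\<Sum>k=1..m. - ln (1 - exp (- s) ^ k)) \<le> pi\<^sup>2 / (6 * s)"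
proof -
  have A: "(\<lambda>j. \<Sum>k=1..m. (exp (- s) ^ k) ^ Suc j / real (Suc j)) sums (\<Sum>k=1..m. - ln (1 - exp (- s) ^ k))"
    using s by (intro sums_sum ln_one_minus_sums) (auto simp: power_less_one_iff)
  have B: "(\<lambda>j. 1 / s * (1 / (real (Suc j))\<^sup>2)) sums (1 / s * (pi\<^sup>2 / 6))"
    using inverse_squares_sums by (intro sums_mult) (simp add: add_ac)
  have C: "(\<Sum>k=1..m. (exp (- s) ^ k) ^ Suc j / real (Suc j)) \<le> 1 / s * (1 / (real (Suc j))\<^sup>2)" for j
  proof -
    define v where "v = exp (- s * real (Suc j))"
    have v: "0 < v" "v < 1" using s by (auto simp: v_def)
    have "(exp (- s) ^ k) ^ Suc j = v ^ k" for k
      by (simp add: v_def exp_of_nat_mult[symmetric] exp_of_nat2_mult[symmetric] power_mult[symmetric] algebra_simps del: power_Suc)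
    then have eq: "(\<Sum>k=1..m. (exp (- s) ^ k) ^ Suc j / real (Suc j)) = (\<Sum>k=1..m. v ^ k) / real (Suc j)"
      by (simp add: sum_divide_distrib)
    have "(\<Sum>k=1..m. v ^ k) \<le> v / (1 - v)"
    proof -
      have "(\<Sum>k=1..m. v ^ k) = v * (\<Sum>k<m. v ^ k)"
        by (simp add: sum_distrib_left sum.atLeast1_atMost_eq)
      also have "(\<Sum>k<m. v ^ k) = (1 - v ^ m) / (1 - v)" using v by (simp add: sum_gp_strict)
      also have "\<dots> \<le> 1 / (1 - v)" using v by (intro divide_right_mono) auto
      finally show ?thesis using v by (simp add: mult_left_mono)
    qed
    also have "v / (1 - v) \<le> 1 / (s * real (Suc j))"
    proof -
      define u where "u = s * real (Suc j)"
      have u: "u > 0" "v = exp (- u)" using s by (auto simp: u_def v_def)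
      have "v * (1 + u) \<le> v * exp u"
        using v by (intro mult_left_mono exp_ge_add_one_self) auto
      also have "\<dots> = 1" by (simp add: u flip: exp_add)
      finally show ?thesis using v u(1) unfolding u_def[symmetric] by (simp add: field_simps)
    qed
    finally have "(\<Sum>k=1..m. v ^ k) / real (Suc j) \<le> 1 / (s * real (Suc j)) / real (Suc j)"
      by (rule divide_right_mono) simp
    also have "1 / (s * J) / J = 1 / s * (1 / J\<^sup>2)" for J :: real
      by (simp add: power2_eq_square)
    finally show ?thesis unfolding eq .
  qed
  from sums_le[OF C A B] show ?thesis by (simp add: field_simps)
qed

lemma Pmn_le_exp: "real (Pmn m m) \<le> exp (pi * sqrt (2 * real m / 3))"
proof (cases "m = 0")
  case True
  have "bounded_partitions 0 0 \<subseteq> {\<lambda>_. 0}"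
    using partition_part_le by (fastforce simp: bounded_partitions_def)
  from card_mono[OF _ this] show ?thesis using True by (simp add: Pmn_def)
next
  case False
  \<comment> \<open>the minimum of \<open>m * s + pi\<^sup>2 / (6 * s)\<close>\<close>
  define s where "s = pi / sqrt (6 * real m)"
  have s: "s > 0" using False by (simp add: s_def)
  have y: "0 < exp (- s)" "exp (- s) < 1" using s by auto
  have "(\<Prod>k=1..m. 1 / (1 - exp (- s) ^ k)) = exp (\<Sum>k=1..m. - ln (1 - exp (- s) ^ k))"
    unfolding exp_sum[OF finite_atLeastAtMost]
  proof (rule prod.cong[OF refl])
    fix k assume "k \<in> {1..m}"
    then have "exp (- s) ^ k < 1" using y by (simp add: power_less_one_iff)
    then show "1 / (1 - exp (- s) ^ k) = exp (- ln (1 - exp (- s) ^ k))"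
      by (simp add: exp_minus inverse_eq_divide)
  qed
  also have "\<dots> \<le> exp (pi\<^sup>2 / (6 * s))" using ln_generating_le[OF s] by simp
  finally have "real (Pmn m m) * exp (- s) ^ m \<le> exp (pi\<^sup>2 / (6 * s))"
    using Pmn_generating[OF y, of m] by linarith
  then have "real (Pmn m m) \<le> exp (pi\<^sup>2 / (6 * s)) * exp (real m * s)"
    by (simp add: exp_of_nat_mult[symmetric] exp_minus field_simps)
  also have "\<dots> = exp (pi\<^sup>2 / (6 * s) + real m * s)" by (simp add: exp_add)
  also have "pi\<^sup>2 / (6 * s) + real m * s = pi * sqrt (2 * real m / 3)"
  proof -
    define r where "r = sqrt (6 * real m)"
    have r: "r > 0" "r * r = 6 * real m" using False by (auto simp: r_def)
    have "2 * real m / 3 = (r / 3)\<^sup>2" using r by (simp add: power2_eq_square field_simps)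
    then have sq: "sqrt (2 * real m / 3) = r / 3" using r by (simp add: real_sqrt_unique)
    have sr: "s = pi / r" by (simp add: s_def r_def)
    then have "pi\<^sup>2 / (6 * s) = pi * r / 6" using r by (simp add: sr power2_eq_square field_simps)
    moreover have "real m * s = pi * r / 6" using r by (simp add: sr field_simps)
    ultimately show ?thesis unfolding sq by simp
  qed
  finally show ?thesis .
qed


section \<open>The number of horizontal strips\<close>

definition strips :: "(nat \<Rightarrow> nat) \<Rightarrow> (nat \<Rightarrow> nat) set" where
  "strips \<kappa> = {\<mu>. is_partition \<mu> \<and> hstrip \<kappa> \<mu>}"

lemma strip_zero:
  assumes "\<mu> \<in> strips \<kappa>" "\<kappa> i = 0" "1 \<le> i" shows "\<mu> i = 0"
  using assms by (auto simp: strips_def hstrip_def)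

lemma strip_psize_le: "is_partition \<kappa> \<Longrightarrow> \<mu> \<in> strips \<kappa> \<Longrightarrow> psize \<mu> \<le> psize \<kappa>"
  by (rule psize_mono) (auto simp: strips_def hstrip_def)

lemma strips_subset_bounded:
  assumes "\<kappa> \<in> bounded_partitions m n" shows "strips \<kappa> \<subseteq> bounded_partitions m n"
proof
  fix \<mu> assume "\<mu> \<in> strips \<kappa>"
  then show "\<mu> \<in> bounded_partitions m n"
    using assms strip_psize_le[of \<kappa> \<mu>] strip_zero[of \<mu> \<kappa> "Suc n"]
    by (auto simp: bounded_partitions_def strips_def)
qed

lemma finite_strips: assumes "is_partition \<kappa>" shows "finite (strips \<kappa>)"
proof -
  have "\<kappa> \<in> bounded_partitions (psize \<kappa>) (conj_part \<kappa> 1)"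
    using assms partition_zero[OF assms] by (auto simp: bounded_partitions_def)
  from finite_subset[OF strips_subset_bounded[OF this] finite_bounded_partitions] show ?thesis .
qed

lemma card_strips_le:
  fixes \<kappa> :: "nat \<Rightarrow> nat"
  defines "l \<equiv> conj_part \<kappa> 1"
  assumes "is_partition \<kappa>"
  shows "card (strips \<kappa>) \<le> card (PiE {1..l} (\<lambda>s. {..\<kappa> s - \<kappa> (Suc s)}))"
proof (rule card_inj_on_le)
  let ?f = "\<lambda>\<mu>. restrict (\<lambda>s. \<mu> s - \<kappa> (Suc s)) {1..l}"
  have z: "\<kappa> (Suc l) = 0" unfolding l_def by (rule partition_zero[OF assms(2)])
  show "inj_on ?f (strips \<kappa>)"
  proof (rule inj_onI, rule ext)
    fix \<mu> \<nu> i assume *: "\<mu> \<in> strips \<kappa>" "\<nu> \<in> strips \<kappa>" "?f \<mu> = ?f \<nu>"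
    consider "i = 0" | "i \<in> {1..l}" | "l < i" by fastforce
    then show "\<mu> i = \<nu> i"
    proof cases
      case 1 then show ?thesis using * by (auto simp: strips_def is_partition_def)
    next
      case 2
      then have "\<kappa> (Suc i) \<le> \<mu> i" "\<kappa> (Suc i) \<le> \<nu> i" using * by (auto simp: strips_def hstrip_def)
      then show ?thesis using fun_cong[OF *(3), of i] 2 by simp
    next
      case 3
      then have "\<kappa> i = 0" using partition_support[OF assms(2) z] by simp
      then show ?thesis using strip_zero[OF *(1), of i] strip_zero[OF *(2), of i] 3 by simp
    qed
  qed
  show "?f ` strips \<kappa> \<subseteq> PiE {1..l} (\<lambda>s. {..\<kappa> s - \<kappa> (Suc s)})"
    by (auto simp: strips_def hstrip_def diff_le_mono)
qed (auto intro: finite_PiE)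

text \<open>In the box of all multiplicities \<open>c s \<le> d s\<close>, the reflection \<open>c \<mapsto> d - c\<close> maps the elements of
  weight more than \<open>m / 2\<close> to elements of weight at most \<open>m / 2\<close>, so the latter are at least half
  of the box.\<close>

lemma card_box_le_half:
  fixes d :: "nat \<Rightarrow> nat"
  assumes "(\<Sum>s=1..l. s * d s) \<le> m"
  defines "B \<equiv> PiE {1..l} (\<lambda>s. {..d s})"
  shows "card B \<le> 2 * card {c \<in> B. 2 * (\<Sum>s=1..l. s * c s) \<le> m}" (is "_ \<le> 2 * card ?H")
proof -
  let ?r = "\<lambda>c. restrict (\<lambda>s. d s - c s) {1..l}"
  have fin: "finite B" unfolding B_def by (auto intro: finite_PiE)
  have "B \<subseteq> ?H \<union> ?r ` ?H"
  proof
    fix c assume c: "c \<in> B"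
    have le: "c s \<le> d s" if "s \<in> {1..l}" for s using c that by (auto simp: B_def PiE_iff)
    show "c \<in> ?H \<union> ?r ` ?H"
    proof (cases "2 * (\<Sum>s=1..l. s * c s) \<le> m")
      case False
      have "(\<Sum>s=1..l. s * ?r c s) + (\<Sum>s=1..l. s * c s) = (\<Sum>s=1..l. s * d s)"
        unfolding sum.distrib[symmetric]
        by (rule sum.cong) (use le in \<open>auto simp flip: distrib_left\<close>)
      then have "2 * (\<Sum>s=1..l. s * ?r c s) \<le> m" using assms(1) False by linarith
      then have "?r c \<in> ?H" by (auto simp: B_def)
      moreover have "c = ?r (?r c)"
        by (rule extensionalityI[of _ "{1..l}"]) (use c le in \<open>auto simp: B_def PiE_iff\<close>)
      ultimately have "c \<in> ?r ` ?H" by (intro image_eqI[where x = "?r c"])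
      then show ?thesis by (rule UnI2)
    qed (use c in auto)
  qed
  then have "card B \<le> card (?H \<union> ?r ` ?H)" using fin by (intro card_mono) auto
  also have "\<dots> \<le> card ?H + card (?r ` ?H)" by (rule card_Un_le)
  also have "card (?r ` ?H) \<le> card ?H" using fin by (intro card_image_le) auto
  finally show ?thesis by simp
qed

text \<open>At most three \<open>s\<close> can have \<open>4 * s * d s > m\<close>, as the sum of all \<open>s * d s\<close> is at most \<open>m\<close>; every other
  \<open>s \<le> l / 4 \<le> m / 4\<close> satisfies the condition.\<close>

lemma length_le_card_room:
  fixes d :: "nat \<Rightarrow> nat"
  assumes "(\<Sum>s=1..l. s * d s) \<le> m" and "l \<le> m"
  shows "l \<le> 4 * card {s \<in> {1..l}. 2 * (s * (d s + 1)) \<le> m} + 15" (is "_ \<le> 4 * card ?G + 15")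
proof -
  define X where "X = {s \<in> {1..l}. m < 4 * (s * d s)}"
  have "(m + 1) * card X = (\<Sum>s\<in>X. m + 1)" by simp
  also have "\<dots> \<le> (\<Sum>s\<in>X. 4 * (s * d s))" by (rule sum_mono) (auto simp: X_def)
  also have "\<dots> \<le> (\<Sum>s=1..l. 4 * (s * d s))" by (rule sum_mono2) (auto simp: X_def)
  also have "\<dots> \<le> 4 * m" using assms(1) by (simp flip: sum_distrib_left)
  also have "\<dots> < (m + 1) * 4" by simp
  finally have X: "card X < 4" by (simp only: mult_less_cancel1)
  have "{1..l div 4} \<subseteq> ?G \<union> X"
  proof
    fix s assume s: "s \<in> {1..l div 4}"
    then have "4 * s \<le> m" "s \<in> {1..l}" using assms(2) by auto
    then show "s \<in> ?G \<union> X" by (auto simp: X_def)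
  qed
  then have "l div 4 \<le> card (?G \<union> X)" using card_mono[of "?G \<union> X" "{1..l div 4}"] by (simp add: X_def)
  also have "\<dots> \<le> card ?G + card X" by (rule card_Un_le)
  finally show ?thesis using X by linarith
qed

text \<open>A light element \<open>c\<close> of the box and a column length \<open>s\<close> of which \<open>d s + 1\<close> further columns
  fit into the remaining \<open>m / 2\<close> cells determine a partition of size at most \<open>m\<close>. Conversely, this
  partition determines \<open>s\<close>, as the only length whose multiplicity exceeds \<open>d s\<close>, and hence \<open>c\<close>.\<close>

lemma card_light_mult_le:
  fixes d :: "nat \<Rightarrow> nat" and l m n :: nat
  assumes "l \<le> n"
  defines "H \<equiv> {c \<in> PiE {1..l} (\<lambda>s. {..d s}). 2 * (\<Sum>s=1..l. s * c s) \<le> m}"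
    and "G \<equiv> {s \<in> {1..l}. 2 * (s * (d s + 1)) \<le> m}"
  shows "card H * card G \<le> Pmn m n" and "card H \<le> Pmn m n"
proof -
  have bd: "with_columns l c \<in> bounded_partitions m n" if "(\<Sum>s=1..l. s * c s) \<le> m" for c
    using that assms(1)
    by (auto simp: bounded_partitions_def is_partition_with_columns psize_with_columns with_columns_zero)
  have ext: "c \<in> extensional {1..l}" "c s \<le> d s \<or> s \<notin> {1..l}" if "c \<in> H" for c s
    using that by (auto simp: H_def PiE_iff)
  show "card H \<le> Pmn m n" unfolding Pmn_def
  proof (rule card_inj_on_le[OF _ _ finite_bounded_partitions])
    show "inj_on (with_columns l) H" by (rule inj_onI, rule with_columns_inj[of l]) (auto dest: ext)
    show "with_columns l ` H \<subseteq> bounded_partitions m n" using bd by (force simp: H_def)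
  qed
  define f where "f = (\<lambda>(c :: nat \<Rightarrow> nat, s). c(s := c s + (d s + 1)))"
  have "card (H \<times> G) \<le> Pmn m n" unfolding Pmn_def
  proof (rule card_inj_on_le[OF _ _ finite_bounded_partitions])
    show "inj_on (\<lambda>v. with_columns l (f v)) (H \<times> G)"
    proof (rule inj_onI, clarify)
      fix c s c' s' assume *: "c \<in> H" "s \<in> G" "c' \<in> H" "s' \<in> G"
        "with_columns l (f (c, s)) = with_columns l (f (c', s'))"
      have eq: "f (c, s) = f (c', s')"
        using * ext by (intro with_columns_inj[OF *(5)]) (auto simp: f_def G_def extensional_def)
      have "s = s'"
      proof (rule ccontr)
        assume "s \<noteq> s'"
        then have "c s + (d s + 1) = c' s" using fun_cong[OF eq, of s] by (simp add: f_def)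
        then show False using ext(2)[OF *(3), of s] *(2) by (simp add: G_def)
      qed
      moreover have "c t = c' t" for t
        using fun_cong[OF eq, of t] \<open>s = s'\<close> by (simp add: f_def split: if_splits)
      ultimately show "c = c' \<and> s = s'" by auto
    qed
    show "(\<lambda>v. with_columns l (f v)) ` (H \<times> G) \<subseteq> bounded_partitions m n"
    proof clarify
      fix c s assume *: "c \<in> H" "s \<in> G"
      have s: "s \<in> {1..l}" using * by (simp add: G_def)
      have "(\<Sum>t=1..l. t * f (c, s) t) = (\<Sum>t=1..l. t * c t + (if t = s then s * (d s + 1) else 0))"
        by (rule sum.cong) (auto simp: f_def algebra_simps)
      also have "\<dots> = (\<Sum>t=1..l. t * c t) + s * (d s + 1)" using s by (simp add: sum.distrib)
      also have "\<dots> \<le> m" using * unfolding H_def G_def by simp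
      finally show "with_columns l (f (c, s)) \<in> bounded_partitions m n" by (rule bd)
    qed
  qed
  then show "card H * card G \<le> Pmn m n" by (simp add: card_cartesian_product)
qed

text \<open>The pointwise estimate behind the quadratic bound: the factor \<open>l\<close>, the cost of one strip, is
  absorbed by the partitions obtained from a strip by adding columns.\<close>

lemma length_times_strips_le:
  assumes "\<kappa> \<in> bounded_partitions m n"
  shows "conj_part \<kappa> 1 * card (strips \<kappa>) \<le> 38 * Pmn m n"
proof -
  define l where "l = conj_part \<kappa> 1"
  define d where "d s = \<kappa> s - \<kappa> (Suc s)" for s
  have \<kappa>: "is_partition \<kappa>" "psize \<kappa> \<le> m" "\<kappa> (Suc n) = 0" using assms by (auto simp: bounded_partitions_def)
  have z: "\<kappa> (Suc l) = 0" unfolding l_def by (rule partition_zero[OF \<kappa>(1)])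
  have sz: "(\<Sum>s=1..l. s * d s) \<le> m" using psize_columns[OF \<kappa>(1) z] \<kappa>(2) by (simp add: d_def)
  have lm: "l \<le> m" using partition_length_le[OF \<kappa>(1)] \<kappa>(2) by (simp add: l_def)
  have ln: "l \<le> n" using conj_part_1_pos[OF \<kappa>(1), of "Suc n"] \<kappa>(3) by (fastforce simp: l_def)
  define H where "H = {c \<in> PiE {1..l} (\<lambda>s. {..d s}). 2 * (\<Sum>s=1..l. s * c s) \<le> m}"
  define G where "G = {s \<in> {1..l}. 2 * (s * (d s + 1)) \<le> m}"
  have "card (strips \<kappa>) \<le> 2 * card H"
    using order_trans[OF card_strips_le[OF \<kappa>(1), folded l_def d_def] card_box_le_half[OF sz]]
    unfolding H_def .
  then have "l * card (strips \<kappa>) \<le> (4 * card G + 15) * (2 * card H)"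
    using length_le_card_room[OF sz lm] unfolding G_def by (intro mult_mono) auto
  also have "\<dots> = 8 * (card H * card G) + 30 * card H" by (simp add: algebra_simps)
  also have "\<dots> \<le> 8 * Pmn m n + 30 * Pmn m n"
    using card_light_mult_le[OF ln, of d m] unfolding H_def[symmetric] G_def[symmetric] by linarith
  finally show ?thesis by (simp add: l_def)
qed


section \<open>Removing one cell\<close>

lemma finite_parts_ge:
  assumes "is_partition \<nu>" "1 \<le> j" shows "finite {i. 1 \<le> i \<and> j \<le> \<nu> i}"
  by (rule finite_subset[of _ "{i. \<nu> i \<noteq> 0}"]) (use assms in \<open>auto simp: is_partition_def\<close>)

lemma conj_part_ge:
  assumes "is_partition \<nu>" "(r, j) \<in> cells \<nu>" shows "r \<le> conj_part \<nu> j"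
proof -
  have "{1..r} \<subseteq> {i. 1 \<le> i \<and> j \<le> \<nu> i}"
    using partition_mono[OF assms(1), of _ r] assms(2) by (fastforce simp: cells_def)
  from card_mono[OF finite_parts_ge[OF assms(1)] this] show ?thesis
    using assms(2) by (simp add: conj_part_def cells_def)
qed

lemma finite_cells: assumes "is_partition \<nu>" shows "finite (cells \<nu>)"
proof (rule finite_subset)
  show "cells \<nu> \<subseteq> {..conj_part \<nu> 1} \<times> {..psize \<nu>}"
    using partition_conj_part_zero[OF assms] partition_part_le[OF assms]
    by (fastforce simp: cells_def not_less[symmetric] intro: order_trans)
qed simp

text \<open>For positive \<open>\<alpha>\<close> the hook lengths are positive real numbers; all cancellations rest on this.\<close>

lemma hook_nonzero:
  assumes "is_partition \<nu>" "(r, j) \<in> cells \<nu>" "\<alpha> > 0"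
  shows "hook_lower (complex_of_real \<alpha>) \<nu> r j \<noteq> 0" "hook_upper (complex_of_real \<alpha>) \<nu> r j \<noteq> 0"
proof -
  have le: "r \<le> conj_part \<nu> j" "j \<le> \<nu> r" using conj_part_ge[OF assms(1,2)] assms(2) by (auto simp: cells_def)
  have "hook_lower (complex_of_real \<alpha>) \<nu> r j
      = complex_of_real (real (conj_part \<nu> j - r) + \<alpha> * real (\<nu> r - j) + 1)"
    using le by (simp add: hook_lower_def of_nat_diff algebra_simps)
  moreover have "real (conj_part \<nu> j - r) + \<alpha> * real (\<nu> r - j) + 1 > 0"
    using assms(3) by (intro add_nonneg_pos add_nonneg_nonneg) auto
  ultimately show "hook_lower (complex_of_real \<alpha>) \<nu> r j \<noteq> 0" by (metis less_irrefl of_real_eq_0_iff)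
  have "hook_upper (complex_of_real \<alpha>) \<nu> r j
      = complex_of_real (real (conj_part \<nu> j - r) + \<alpha> * real (\<nu> r - j) + \<alpha>)"
    using le by (simp add: hook_upper_def of_nat_diff algebra_simps)
  moreover have "real (conj_part \<nu> j - r) + \<alpha> * real (\<nu> r - j) + \<alpha> > 0"
    using assms(3) by (intro add_nonneg_pos add_nonneg_nonneg) auto
  ultimately show "hook_upper (complex_of_real \<alpha>) \<nu> r j \<noteq> 0" by (metis less_irrefl of_real_eq_0_iff)
qed

text \<open>Both update formulas compare a partition \<open>\<nu>\<close> with the partition \<open>\<nu>'\<close> that lacks the corner
  \<open>(k, \<nu> k)\<close>: \<open>Q\<close> is updated when a corner is added, \<open>\<beta>\<close> when one is removed.\<close>

locale corner =
  fixes \<nu> \<nu>' :: "nat \<Rightarrow> nat" and k :: nat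
  assumes part: "is_partition \<nu>" and k: "1 \<le> k" and corner: "\<nu> (Suc k) < \<nu> k"
    and nu': "\<nu>' = \<nu>(k := \<nu> k - 1)"
begin

lemma partition': "is_partition \<nu>'"
proof -
  have "\<nu>' (Suc i) \<le> \<nu>' i" if "1 \<le> i" for i
  proof -
    have "\<nu> (Suc i) \<le> \<nu> i" using part that by (auto simp: is_partition_def)
    then show ?thesis using corner by (auto simp: nu')
  qed
  moreover have "finite {i. \<nu>' i \<noteq> 0}"
    by (rule finite_subset[of _ "{i. \<nu> i \<noteq> 0}"]) (use part nu' in \<open>auto simp: is_partition_def split: if_splits\<close>)
  ultimately show ?thesis using part k by (auto simp: is_partition_def nu')
qed

lemma conj': "conj_part \<nu>' j = conj_part \<nu> j" if "j \<noteq> \<nu> k"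
  unfolding conj_part_def nu'
  by (rule arg_cong[where f = card]) (use that in auto)

lemma conj_corner: "conj_part \<nu> (\<nu> k) = k"
  by (rule conj_part_eq[OF part]) (use k corner in auto)

lemma conj_corner': "conj_part \<nu>' (\<nu> k) = k - 1"
proof -
  have "{i. 1 \<le> i \<and> \<nu> k \<le> \<nu>' i} = {i. 1 \<le> i \<and> \<nu> k \<le> \<nu> i} - {k}" using corner by (auto simp: nu')
  then have "conj_part \<nu>' (\<nu> k) = card ({i. 1 \<le> i \<and> \<nu> k \<le> \<nu> i} - {k})" by (simp add: conj_part_def)
  also have "\<dots> = conj_part \<nu> (\<nu> k) - 1"
    unfolding conj_part_def using k corner
    by (subst card_Diff_singleton) auto
  finally show ?thesis by (simp add: conj_corner)
qed

lemma cells_eq: "cells \<nu> = insert (k, \<nu> k) (cells \<nu>')" and corner_notin: "(k, \<nu> k) \<notin> cells \<nu>'"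
  using k corner by (auto simp: cells_def nu' split: if_splits)

definition rest :: "(nat \<times> nat) set" where
  "rest = {(r, j) \<in> cells \<nu>'. r \<noteq> k \<and> j \<noteq> \<nu> k}"

lemma column_cells: "r \<in> {1..<k} \<Longrightarrow> (r, \<nu> k) \<in> cells \<nu>'" "r \<in> {1..<k} \<Longrightarrow> (r, \<nu> k) \<in> cells \<nu>"
  and row_cells: "j \<in> {1..<\<nu> k} \<Longrightarrow> (k, j) \<in> cells \<nu>'" "j \<in> {1..<\<nu> k} \<Longrightarrow> (k, j) \<in> cells \<nu>"
  using partition_mono[OF part, of r k] k corner by (auto simp: cells_def nu')

text \<open>Removing the corner changes the hook lengths only in its row and in its column, so these are
  separated from the cells in \<open>rest\<close>, which cancel in all quotients.\<close>

lemma prod_cells':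
  "(\<Prod>(r, j)\<in>cells \<nu>'. f r j)
    = (\<Prod>(r, j)\<in>rest. f r j) * (\<Prod>r=1..<k. f r (\<nu> k)) * (\<Prod>j=1..<\<nu> k. f k j :: 'a :: comm_monoid_mult)"
proof -
  let ?C = "(\<lambda>r. (r, \<nu> k)) ` {1..<k}" and ?R = "(\<lambda>j. (k, j)) ` {1..<\<nu> k}"
  have col: "r < k" if "(r, \<nu> k) \<in> cells \<nu>'" for r
  proof (rule ccontr)
    assume "\<not> r < k"
    then have "\<nu>' r < \<nu> k"
      using partition_mono[OF part, of "Suc k" r] corner by (cases "r = k") (auto simp: nu')
    then show False using that by (simp add: cells_def)
  qed
  have eq: "cells \<nu>' = rest \<union> ?C \<union> ?R"
  proof (rule set_eqI, clarify)
    fix r j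
    have "1 \<le> r" "1 \<le> j" if "(r, j) \<in> cells \<nu>'" using that by (auto simp: cells_def)
    moreover have "j < \<nu> k" if "(k, j) \<in> cells \<nu>'" using that by (auto simp: cells_def nu')
    moreover have "(r, j) \<in> ?C \<longleftrightarrow> j = \<nu> k \<and> 1 \<le> r \<and> r < k" "(r, j) \<in> ?R \<longleftrightarrow> r = k \<and> 1 \<le> j \<and> j < \<nu> k"
      "(r, j) \<in> rest \<longleftrightarrow> (r, j) \<in> cells \<nu>' \<and> r \<noteq> k \<and> j \<noteq> \<nu> k"
      by (auto simp: rest_def)
    moreover have "1 \<le> r \<and> r < k \<Longrightarrow> (r, \<nu> k) \<in> cells \<nu>'" "1 \<le> j \<and> j < \<nu> k \<Longrightarrow> (k, j) \<in> cells \<nu>'"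
      using column_cells(1)[of r] row_cells(1)[of j] by simp_all
    ultimately show "(r, j) \<in> cells \<nu>' \<longleftrightarrow> (r, j) \<in> rest \<union> ?C \<union> ?R"
      using col[of r] unfolding Un_iff by metis
  qed
  have fin: "finite rest" by (rule finite_subset[OF _ finite_cells[OF partition']]) (auto simp: rest_def)
  have "(\<Prod>(r, j)\<in>cells \<nu>'. f r j) = (\<Prod>(r, j)\<in>rest. f r j) * (\<Prod>(r, j)\<in>?C. f r j) * (\<Prod>(r, j)\<in>?R. f r j)"
    unfolding eq using fin
    by (subst prod.union_disjoint, (auto simp: rest_def)[3], subst prod.union_disjoint)
       (auto simp: rest_def)
  also have "(\<Prod>(r, j)\<in>?C. f r j) = (\<Prod>r=1..<k. f r (\<nu> k))"
    by (subst prod.reindex) (auto simp: inj_on_def)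
  also have "(\<Prod>(r, j)\<in>?R. f r j) = (\<Prod>j=1..<\<nu> k. f k j)"
    by (subst prod.reindex) (auto simp: inj_on_def)
  finally show ?thesis .
qed

lemma prod_cells:
  "(\<Prod>(r, j)\<in>cells \<nu>. f r j)
    = f k (\<nu> k) * (\<Prod>(r, j)\<in>rest. f r j) * (\<Prod>r=1..<k. f r (\<nu> k)) * (\<Prod>j=1..<\<nu> k. f k j :: 'a :: comm_monoid_mult)"
  unfolding cells_eq
  using corner_notin finite_cells[OF partition'] prod_cells'[of f] by (simp add: mult_ac)

lemma hook_rest:
  assumes "(r, j) \<in> rest"
  shows "hook_lower \<alpha> \<nu>' r j = hook_lower \<alpha> \<nu> r j" "hook_upper \<alpha> \<nu>' r j = hook_upper \<alpha> \<nu> r j"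
  using assms by (auto simp: rest_def hook_lower_def hook_upper_def conj', auto simp: nu')

lemma psize_corner: "psize \<nu> = Suc (psize \<nu>')"
proof -
  have z: "\<nu> (Suc (conj_part \<nu> 1)) = 0" by (rule partition_zero[OF part])
  have kl: "k \<in> {1..conj_part \<nu> 1}" using k conj_part_1_ge[OF part k] corner by auto
  have z': "\<nu>' (Suc (conj_part \<nu> 1)) = 0" using z kl by (simp add: nu')
  have "psize \<nu> = \<nu> k + (\<Sum>i\<in>{1..conj_part \<nu> 1} - {k}. \<nu> i)"
    unfolding psize_eq[OF part z] using kl by (subst sum.remove[of _ k]) auto
  moreover have "psize \<nu>' = \<nu>' k + (\<Sum>i\<in>{1..conj_part \<nu> 1} - {k}. \<nu>' i)"
    unfolding psize_eq[OF partition' z'] using kl by (subst sum.remove[of _ k]) auto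
  ultimately show ?thesis using corner by (simp add: nu')
qed

end

section \<open>The coefficients of the series\<close>

definition Q_coeff ::
  "complex \<Rightarrow> nat \<Rightarrow> (nat \<Rightarrow> complex) \<Rightarrow> nat \<Rightarrow> (nat \<Rightarrow> complex) \<Rightarrow> (nat \<Rightarrow> nat) \<Rightarrow> complex" where
  "Q_coeff \<alpha> p a q b \<kappa> =
     \<alpha> ^ psize \<kappa> * (\<Prod>r=1..p. gpoch \<alpha> (a r) \<kappa>) / (jfactor \<alpha> \<kappa> * (\<Prod>r=1..q. gpoch \<alpha> (b r) \<kappa>))"

context corner
begin

lemma gpoch_corner:
  "gpoch \<alpha> a \<nu> = gpoch \<alpha> a \<nu>' * (a + (of_nat (\<nu> k) - (of_nat k - 1) / \<alpha> - 1))"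
  unfolding gpoch_def cells_eq
  using corner_notin finite_cells[OF partition'] by (simp add: algebra_simps)

lemma Q_factor_value:
  assumes pos: "\<alpha> > 0"
  defines "A \<equiv> complex_of_real \<alpha>"
  defines "h \<equiv> \<lambda>\<kappa> r j. hook_lower A \<kappa> r j * hook_upper A \<kappa> r j"
  shows "fst (Q_factor A p a q b \<nu> k) =
    (\<Prod>r=1..p. a r + (of_nat (\<nu> k) - (of_nat k - 1) / A - 1))
    / (\<Prod>r=1..q. b r + (of_nat (\<nu> k) - (of_nat k - 1) / A - 1))
    * (\<Prod>j=1..<\<nu> k. h \<nu>' k j / h \<nu> k j) * (\<Prod>r=1..<k. h \<nu>' r (\<nu> k) / h \<nu> r (\<nu> k))"
proof -
  define d where "d = of_nat (\<nu> k) * A - of_nat k"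
  have row: "(d - of_nat j * A + of_nat (conj_part \<nu> j) + 1 - A) * (d - of_nat j * A + of_nat (conj_part \<nu> j)) /
      ((d - of_nat j * A + of_nat (conj_part \<nu> j) + 1) * (d - of_nat j * A + of_nat (conj_part \<nu> j) + A))
    = h \<nu>' k j / h \<nu> k j" if j: "j \<in> {1..<\<nu> k}" for j
  proof -
    define e where "e = d - of_nat j * A + of_nat (conj_part \<nu> j)"
    have "hook_lower A \<nu> k j = e + 1" "hook_upper A \<nu> k j = e + A"
      "hook_lower A \<nu>' k j = e + 1 - A" "hook_upper A \<nu>' k j = e"
      using j by (auto simp: hook_lower_def hook_upper_def e_def d_def conj')
        (auto simp: nu' of_nat_diff algebra_simps)
    then show ?thesis by (simp add: h_def flip: e_def)
  qed
  have col: "((of_nat (\<nu> r) * A - of_nat r - d + A) * (of_nat (\<nu> r) * A - of_nat r - d) - (of_nat (\<nu> r) * A - of_nat r - d)) /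
      ((of_nat (\<nu> r) * A - of_nat r - d + A) * (of_nat (\<nu> r) * A - of_nat r - d) + (of_nat (\<nu> r) * A - of_nat r - d + A))
    = h \<nu>' r (\<nu> k) / h \<nu> r (\<nu> k)" if r: "r \<in> {1..<k}" for r
  proof -
    define f where "f = of_nat (\<nu> r) * A - of_nat r - d"
    have "hook_lower A \<nu> r (\<nu> k) = f + 1" "hook_upper A \<nu> r (\<nu> k) = f + A"
      "hook_lower A \<nu>' r (\<nu> k) = f" "hook_upper A \<nu>' r (\<nu> k) = f + A - 1"
      using r by (auto simp: hook_lower_def hook_upper_def f_def d_def conj_corner conj_corner')
        (auto simp: nu' of_nat_diff algebra_simps)
    moreover have "(f + A) * f - f = f * (f + A - 1)" "(f + A) * f + (f + A) = (f + 1) * (f + A)"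
      by (auto simp: algebra_simps)
    ultimately show ?thesis by (simp add: h_def flip: f_def)
  qed
  have "{1..<Suc p} = {1..p}" "{1..<Suc q} = {1..q}" by auto
  then show ?thesis
    unfolding Q_factor_def
    by (simp add: fst_counted fst_cprod row col d_def[symmetric] del: One_nat_def upt_Suc)
qed

text \<open>The update of \<open>Q\<close>: apart from the Pochhammer symbols, the quotient consists of the hook
  lengths in the row and in the column of the corner; the corner itself contributes \<open>\<alpha>\<close> to
  \<open>jfactor\<close>, which is the new factor of \<open>\<alpha> ^ psize\<close>.\<close>

lemma Q_coeff_corner:
  assumes pos: "\<alpha> > 0"
  shows "Q_coeff (of_real \<alpha>) p a q b \<nu> = Q_coeff (of_real \<alpha>) p a q b \<nu>' * fst (Q_factor (of_real \<alpha>) p a q b \<nu> k)"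
proof -
  define A where "A = complex_of_real \<alpha>"
  define h where "h = (\<lambda>\<kappa> r j. hook_lower A \<kappa> r j * hook_upper A \<kappa> r j)"
  have A0: "A \<noteq> 0" using pos by (simp add: A_def)
  define R where "R = (\<Prod>(r, j)\<in>rest. h \<nu> r j)"
  define Cn where "Cn = (\<Prod>r=1..<k. h \<nu> r (\<nu> k))"
  define Co where "Co = (\<Prod>r=1..<k. h \<nu>' r (\<nu> k))"
  define Rn where "Rn = (\<Prod>j=1..<\<nu> k. h \<nu> k j)"
  define Ro where "Ro = (\<Prod>j=1..<\<nu> k. h \<nu>' k j)"
  have nz: "Co \<noteq> 0" "Ro \<noteq> 0"
    unfolding Co_def Ro_def A_def h_def
    using hook_nonzero[OF partition' column_cells(1) pos] hook_nonzero[OF partition' row_cells(1) pos]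
    by auto
  have "h \<nu> k (\<nu> k) = A" by (simp add: h_def hook_lower_def hook_upper_def conj_corner)
  then have Jn: "jfactor A \<nu> = A * R * Cn * Rn"
    unfolding jfactor_def R_def Cn_def Rn_def using prod_cells[of "h \<nu>"] by (simp add: h_def)
  have "(\<Prod>(r, j)\<in>rest. h \<nu>' r j) = R"
    unfolding R_def h_def by (rule prod.cong) (auto simp: hook_rest)
  then have Jo: "jfactor A \<nu>' = R * Co * Ro"
    unfolding jfactor_def Co_def Ro_def using prod_cells'[of "h \<nu>'"] by (simp add: h_def)
  have T: "fst (Q_factor A p a q b \<nu> k) =
    (\<Prod>r=1..p. a r + (of_nat (\<nu> k) - (of_nat k - 1) / A - 1))
    / (\<Prod>r=1..q. b r + (of_nat (\<nu> k) - (of_nat k - 1) / A - 1)) * (Ro / Rn) * (Co / Cn)"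
    using Q_factor_value[OF pos, of p a q b]
    unfolding Ro_def Rn_def Co_def Cn_def prod_dividef[symmetric] A_def h_def .
  show ?thesis
    unfolding A_def[symmetric] Q_coeff_def T Jn Jo gpoch_corner prod.distrib psize_corner
    using A0 nz by (simp add: field_simps)
qed

end

lemma cells_empty: "cells (\<lambda>_. 0) = {}"
  by (auto simp: cells_def)

lemma psize_empty: "psize (\<lambda>_. 0) = 0"
  by (simp add: psize_def)

lemma Q_coeff_empty: "Q_coeff \<alpha> p a q b (\<lambda>_. 0) = 1"
  by (simp add: Q_coeff_def gpoch_def jfactor_def cells_empty psize_empty)


section \<open>The coefficients of a horizontal strip\<close>

lemma strip_beta_refl:
  assumes "is_partition \<kappa>" "\<alpha> > 0" shows "strip_beta (complex_of_real \<alpha>) \<kappa> \<kappa> = 1"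
proof -
  have "(\<Prod>(i, j)\<in>cells \<kappa>. B_hook (complex_of_real \<alpha>) \<kappa> \<kappa> \<kappa> i j) \<noteq> 0"
    using hook_nonzero(2)[OF assms(1) _ assms(2)] finite_cells[OF assms(1)]
    by (auto simp: B_hook_def)
  then show ?thesis by (simp add: strip_beta_def)
qed

text \<open>In the column of the corner and to the left of it, \<open>\<kappa>\<close> and \<open>\<mu>\<close> have the same column lengths,
  because they agree below row \<open>k\<close> and both extend that far in the rows up to \<open>k\<close>. So the removal of the corner turns the hooks of \<open>\<kappa>\<close> in the column of
  the corner from upper to lower ones, and in row \<open>k\<close> of \<open>\<mu>\<close> only upper hooks occur.\<close>

lemma strip_beta_corner:
  assumes \<kappa>: "is_partition \<kappa>" and \<mu>: "\<mu> \<in> strips \<kappa>" and tail: "\<forall>r>k. \<mu> r = \<kappa> r"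
    and "corner \<mu> \<mu>' k" and pos: "\<alpha> > 0"
  shows "strip_beta (complex_of_real \<alpha>) \<kappa> \<mu>' = strip_beta (of_real \<alpha>) \<kappa> \<mu> * beta_factor (of_real \<alpha>) \<kappa> \<mu> k"
proof -
  interpret corner \<mu> \<mu>' k by fact
  define A where "A = complex_of_real \<alpha>"
  have A0: "A \<noteq> 0" using pos by (simp add: A_def)
  define c where "c = \<mu> k"
  define \<tau> where "\<tau> = of_nat k - A * of_nat (\<mu> k)"
  have le: "\<mu> i \<le> \<kappa> i" if "1 \<le> i" for i using \<mu> that by (auto simp: strips_def hstrip_def)
  have conj_eq: "conj_part \<kappa> j = conj_part \<mu> j" if j: "j \<le> c" "1 \<le> j" for j
  proof -
    have "j \<le> \<kappa> i \<longleftrightarrow> j \<le> \<mu> i" if "1 \<le> i" for i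
    proof (cases "i \<le> k")
      case True
      then have "c \<le> \<mu> i" using partition_mono[OF part that True] by (simp add: c_def)
      then show ?thesis using le[OF that] j by linarith
    qed (use tail in auto)
    then show ?thesis unfolding conj_part_def by (intro arg_cong[where f = card]) auto
  qed
  have c1: "1 \<le> c" using corner by (simp add: c_def)
  have k\<kappa>: "conj_part \<kappa> c = k" using conj_eq[of c] conj_corner c1 by (simp add: c_def)
  \<comment> \<open>only in column \<open>c\<close> the kind of the hooks changes, so it is separated from the other columns\<close>
  let ?M = "{(r, j) \<in> cells \<kappa>. j \<noteq> c}" and ?C = "(\<lambda>r. (r, c)) ` {1..k}"
  have colk: "(r, c) \<in> cells \<kappa>" if "r \<in> {1..k}" for r
    using le[of r] partition_mono[OF part, of r k] c1 that by (auto simp: cells_def c_def)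
  have col: "r \<in> {1..k}" if "(r, c) \<in> cells \<kappa>" for r
    using conj_part_ge[OF \<kappa> that] k\<kappa> that by (simp add: cells_def)
  have mem: "(r, j) \<in> cells \<kappa> \<longleftrightarrow> (r, j) \<in> ?M \<union> ?C" for r j
  proof -
    have "(r, j) \<in> ?C \<longleftrightarrow> j = c \<and> r \<in> {1..k}" by blast
    then have "(r, j) \<in> ?M \<union> ?C \<longleftrightarrow> (r, j) \<in> cells \<kappa> \<and> j \<noteq> c \<or> j = c \<and> r \<in> {1..k}"
      unfolding Un_iff by simp
    moreover have "(r, c) \<in> cells \<kappa> \<longleftrightarrow> r \<in> {1..k}" using col colk by blast
    ultimately show ?thesis by (cases "j = c") simp_all
  qed
  have eq: "cells \<kappa> = ?M \<union> ?C"
  proof (rule set_eqI)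
    fix v show "v \<in> cells \<kappa> \<longleftrightarrow> v \<in> ?M \<union> ?C" using mem[of "fst v" "snd v"] unfolding prod.collapse .
  qed
  have split: "(\<Prod>(r, j)\<in>cells \<kappa>. f r j) = (\<Prod>(r, j)\<in>?M. f r j) * (\<Prod>r=1..k. f r c)" for f :: "nat \<Rightarrow> nat \<Rightarrow> complex"
  proof -
    have "finite ?M" by (rule finite_subset[OF _ finite_cells[OF \<kappa>]]) auto
    then have "(\<Prod>(r, j)\<in>?M \<union> ?C. f r j) = (\<Prod>(r, j)\<in>?M. f r j) * (\<Prod>(r, j)\<in>?C. f r j)"
      by (intro prod.union_disjoint) auto
    also have "(\<Prod>(r, j)\<in>?C. f r j) = (\<Prod>r=1..k. f r c)"
      by (subst prod.reindex) (auto simp: inj_on_def)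
    finally show ?thesis using eq by simp
  qed
  define u where "u r = \<tau> + 1 - of_nat r + A * of_nat (\<kappa> r)" for r
  define v where "v r = \<tau> - of_nat r + A * of_nat (\<mu> r)" for r
  define w where "w r = of_nat (conj_part \<mu> r) - \<tau> - A * of_nat r" for r
  define M where "M = (\<Prod>(r, j)\<in>?M. B_hook A \<kappa> \<kappa> \<mu> r j)"
  define R where "R = (\<Prod>(r, j)\<in>rest. B_hook A \<mu> \<kappa> \<mu> r j)"
  have N: "(\<Prod>(r, j)\<in>cells \<kappa>. B_hook A \<kappa> \<kappa> \<mu> r j) = M * (\<Prod>r=1..k. u r + A - 1)"
  proof -
    have "(\<Prod>r=1..k. B_hook A \<kappa> \<kappa> \<mu> r c) = (\<Prod>r=1..k. u r + A - 1)"
      using conj_eq[of c] c1 k\<kappa>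
      by (intro prod.cong) (auto simp: B_hook_def hook_upper_def u_def \<tau>_def algebra_simps c_def)
    then show ?thesis by (simp only: split M_def)
  qed
  have N': "(\<Prod>(r, j)\<in>cells \<kappa>. B_hook A \<kappa> \<kappa> \<mu>' r j) = M * (\<Prod>r=1..k. u r)"
  proof -
    have "(\<Prod>r=1..k. B_hook A \<kappa> \<kappa> \<mu>' r c) = (\<Prod>r=1..k. u r)"
      using k\<kappa> conj_corner' k
      by (intro prod.cong) (auto simp: B_hook_def hook_lower_def u_def \<tau>_def algebra_simps c_def)
    moreover have "(\<Prod>(r, j)\<in>?M. B_hook A \<kappa> \<kappa> \<mu>' r j) = M"
      unfolding M_def by (rule prod.cong) (auto simp: B_hook_def conj' c_def)
    ultimately show ?thesis by (simp only: split)
  qed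
  have D: "(\<Prod>(r, j)\<in>cells \<mu>. B_hook A \<mu> \<kappa> \<mu> r j) = A * R * (\<Prod>r=1..<k. v r + A) * (\<Prod>j=1..<c. w j + A)"
  proof -
    have 1: "B_hook A \<mu> \<kappa> \<mu> k c = A"
      using conj_eq[of c] c1 k\<kappa> by (auto simp: B_hook_def hook_upper_def c_def)
    have 2: "(\<Prod>r=1..<k. B_hook A \<mu> \<kappa> \<mu> r c) = (\<Prod>r=1..<k. v r + A)"
      using conj_eq[of c] c1 k\<kappa>
      by (intro prod.cong) (auto simp: B_hook_def hook_upper_def v_def \<tau>_def algebra_simps c_def)
    have 3: "(\<Prod>j=1..<c. B_hook A \<mu> \<kappa> \<mu> k j) = (\<Prod>j=1..<c. w j + A)"
      using conj_eq
      by (intro prod.cong) (auto simp: B_hook_def hook_upper_def w_def \<tau>_def algebra_simps c_def)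
    show ?thesis
      using prod_cells[of "B_hook A \<mu> \<kappa> \<mu>"] unfolding c_def[symmetric] 1 2 3 R_def .
  qed
  have D': "(\<Prod>(r, j)\<in>cells \<mu>'. B_hook A \<mu>' \<kappa> \<mu>' r j) = R * (\<Prod>r=1..<k. v r) * (\<Prod>j=1..<c. w j)"
  proof -
    have 1: "(\<Prod>(r, j)\<in>rest. B_hook A \<mu>' \<kappa> \<mu>' r j) = R"
      unfolding R_def by (rule prod.cong) (auto simp: B_hook_def hook_rest, auto simp: rest_def conj')
    have 2: "(\<Prod>r=1..<k. B_hook A \<mu>' \<kappa> \<mu>' r c) = (\<Prod>r=1..<k. v r)"
      using k\<kappa> conj_corner' k
      by (intro prod.cong)
         (auto simp: B_hook_def hook_lower_def v_def \<tau>_def algebra_simps c_def nu' of_nat_diff)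
    have 3: "(\<Prod>j=1..<c. B_hook A \<mu>' \<kappa> \<mu>' k j) = (\<Prod>j=1..<c. w j)"
    proof (rule prod.cong[OF refl])
      fix j assume j: "j \<in> {1..<c}"
      then have "conj_part \<mu>' j = conj_part \<mu> j" by (intro conj') (auto simp: c_def)
      moreover have "conj_part \<kappa> j = conj_part \<mu> j" using conj_eq j by auto
      moreover have "of_nat (\<mu>' k) = (of_nat c - 1 :: complex)" using c1 by (simp add: nu' c_def of_nat_diff)
      ultimately show "B_hook A \<mu>' \<kappa> \<mu>' k j = w j"
        by (simp add: B_hook_def hook_upper_def w_def \<tau>_def algebra_simps c_def)
    qed
    show ?thesis
      using prod_cells'[of "B_hook A \<mu>' \<kappa> \<mu>'"] unfolding c_def[symmetric] 1 2 3 .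
  qed
  have U0: "(\<Prod>r=1..k. u r + A - 1) \<noteq> 0"
  proof -
    have "u r + A - 1 = hook_upper A \<kappa> r c" for r
      using k\<kappa> by (simp add: hook_upper_def u_def \<tau>_def algebra_simps c_def)
    then show ?thesis using hook_nonzero(2)[OF \<kappa> colk pos] by (auto simp: A_def)
  qed
  have V0: "(\<Prod>r=1..<k. v r + A) \<noteq> 0"
  proof -
    have "v r + A = hook_upper A \<mu> r c" for r
      using conj_corner by (simp add: hook_upper_def v_def \<tau>_def algebra_simps c_def)
    then show ?thesis using hook_nonzero(2)[OF part column_cells(2) pos] by (auto simp: A_def c_def)
  qed
  have W0: "(\<Prod>j=1..<c. w j + A) \<noteq> 0"
  proof -
    have "w j + A = hook_upper A \<mu> k j" for j
      by (simp add: hook_upper_def w_def \<tau>_def algebra_simps c_def)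
    then show ?thesis using hook_nonzero(2)[OF part row_cells(2) pos] by (auto simp: A_def c_def)
  qed
  have b: "beta_factor A \<kappa> \<mu> k = A * ((\<Prod>r=1..k. u r) / (\<Prod>r=1..k. u r + A - 1))
      * ((\<Prod>r=1..<k. v r + A) / (\<Prod>r=1..<k. v r)) * ((\<Prod>j=1..<c. w j + A) / (\<Prod>j=1..<c. w j))"
    unfolding beta_factor_def Let_def u_def v_def w_def c_def \<tau>_def prod_dividef by simp
  show ?thesis
    unfolding A_def[symmetric] strip_beta_def N N' D D' b using A0 U0 V0 W0 by (simp add: field_simps)
qed

section \<open>Jack functions as sums over horizontal strips\<close>

lemma Jack_zero: "1 \<le> n \<Longrightarrow> 0 < \<kappa> (Suc n) \<Longrightarrow> Jack \<alpha> x n \<kappa> = 0"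
  by (cases "(\<alpha>, x, n, \<kappa>)" rule: Jack.cases) (auto simp: numeral_2_eq_2)

lemma Jack_strips:
  assumes "1 \<le> n"
  shows "Jack \<alpha> x (Suc n) \<kappa>
    = (\<Sum>\<mu>\<in>strips \<kappa>. Jack \<alpha> x n \<mu> * x (Suc n) ^ (psize \<kappa> - psize \<mu>) * strip_beta \<alpha> \<kappa> \<mu>)"
proof (cases "0 < \<kappa> (Suc (Suc n))")
  case True
  have "Jack \<alpha> x n \<mu> = 0" if "\<mu> \<in> strips \<kappa>" for \<mu>
  proof -
    have "\<kappa> (Suc (Suc n)) \<le> \<mu> (Suc n)" using that by (auto simp: strips_def hstrip_def)
    then show ?thesis using True assms by (intro Jack_zero) auto
  qed
  then show ?thesis using Jack_zero[of "Suc n" \<kappa> \<alpha> x] True by simp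
next
  case False
  obtain n' where "n = Suc n'" using assms by (cases n) auto
  then show ?thesis using False by (simp add: strips_def)
qed

lemma strips_empty: "strips (\<lambda>_. 0) = {\<lambda>_. 0}"
proof -
  have "\<mu> = (\<lambda>_. 0)" if "\<mu> \<in> strips (\<lambda>_. 0)" for \<mu>
  proof
    fix i show "\<mu> i = 0"
      using that strip_zero[OF that, of i] by (cases "i = 0") (auto simp: strips_def is_partition_def)
  qed
  then show ?thesis by (auto simp: strips_def hstrip_def is_partition_def)
qed

lemma Jack_empty: "1 \<le> n \<Longrightarrow> Jack \<alpha> x n (\<lambda>_. 0) = 1"
proof (induction n rule: dec_induct)
  case (step n)
  then show ?case
    by (simp add: Jack_strips strips_empty strip_beta_def cells_empty)
qed simp


section \<open>The horizontal strips reached by jack\<close>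

declare jack.simps [simp del] jack_loop.simps [simp del]

lemma snd_counted:
  "snd (cret v) = 0" "snd (c \<then> f) = snd (f (fst c)) + snd c" "snd (cop g c d) = snd c + snd d + 1"
  "fst (charge k c) = fst c" "snd (charge k c) = snd c + k"
  by (auto simp: cret_def cbind_def charge_def cop_def)

lemma snd_cfor_le:
  "(\<And>i v. i \<in> set is \<Longrightarrow> snd (f i v) \<le> B) \<Longrightarrow> snd (cfor is f v) \<le> length is * B"
proof (induction "is" arbitrary: v)
  case (Cons i "is")
  have "snd (f i v) \<le> B" "snd (cfor is f (fst (f i v))) \<le> length is * B"
    using Cons by auto
  then show ?case by (simp add: snd_counted)
qed (simp add: snd_counted)

lemma snd_cprod_le:
  assumes "\<And>i. i \<in> set is \<Longrightarrow> snd (f i) \<le> B" shows "snd (cprod is f) \<le> length is * Suc B"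
  unfolding cprod_def using assms by (intro snd_cfor_le) (simp add: snd_counted)

lemma snd_index_of_le: "snd (index_of D \<mu>) \<le> 2 * conj_part \<mu> 1"
proof -
  have "snd (index_of D \<mu>) \<le> length [2..<Suc (conj_part \<mu> 1)] * 2"
    unfolding index_of_def by (rule snd_cfor_le) (simp add: snd_counted)
  then show ?thesis by (simp del: upt_Suc)
qed

lemma snd_beta_update_le:
  assumes "k \<le> conj_part \<mu> 1"
  shows "snd (beta_update \<alpha> \<kappa> \<mu> k \<beta>) \<le> 23 * conj_part \<mu> 1 + 15"
proof -
  let ?l = "conj_part \<mu> 1"
  define P1 where "P1 \<tau> = cprod [1..<Suc k] (\<lambda>r.
          (cret \<tau> +\<^sub>c num 1 -\<^sub>c num r +\<^sub>c cret \<alpha> *\<^sub>c num (\<kappa> r)) \<then> (\<lambda>u.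
          cret u /\<^sub>c (cret u +\<^sub>c cret \<alpha> -\<^sub>c num 1)))" for \<tau>
  define P2 where "P2 \<tau> = cprod [1..<k] (\<lambda>r.
          (cret \<tau> -\<^sub>c num r +\<^sub>c cret \<alpha> *\<^sub>c num (\<mu> r)) \<then> (\<lambda>v.
          (cret v +\<^sub>c cret \<alpha>) /\<^sub>c cret v))" for \<tau>
  define P3 where "P3 \<tau> = cprod [k..<Suc ?l] (\<lambda>s.
          (num s -\<^sub>c cret \<tau> -\<^sub>c cret \<alpha> *\<^sub>c num (\<mu> (Suc s)))
          /\<^sub>c (num s -\<^sub>c cret \<tau> -\<^sub>c cret \<alpha> *\<^sub>c (if s = k then num (\<mu> k) -\<^sub>c num 1 else num (\<mu> s))))" for \<tau>
  have "snd (P1 \<tau>) \<le> length [1..<Suc k] * Suc 7" for \<tau>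
    unfolding P1_def by (rule snd_cprod_le) (simp add: snd_counted)
  moreover have "snd (P2 \<tau>) \<le> length [1..<k] * Suc 5" for \<tau>
    unfolding P2_def by (rule snd_cprod_le) (simp add: snd_counted)
  moreover have "snd (P3 \<tau>) \<le> length [k..<Suc ?l] * Suc 8" for \<tau>
    unfolding P3_def by (rule snd_cprod_le) (simp add: snd_counted)
  ultimately have "snd (P1 \<tau>) + snd (P2 \<tau>) + snd (P3 \<tau>)
      \<le> length [1..<Suc k] * Suc 7 + length [1..<k] * Suc 5 + length [k..<Suc ?l] * Suc 8" for \<tau>
    by (intro add_mono)
  also have "\<dots> \<le> 23 * ?l + 9" using assms by (simp del: upt_Suc)
  finally have "snd (P1 \<tau>) + snd (P2 \<tau>) + snd (P3 \<tau>) \<le> 23 * ?l + 9" for \<tau> .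
  note this[of "of_nat k - \<alpha> * of_nat (\<mu> k)"]
  moreover have "snd (beta_update \<alpha> \<kappa> \<mu> k \<beta>) = snd (P1 (of_nat k - \<alpha> * of_nat (\<mu> k)))
      + snd (P2 (of_nat k - \<alpha> * of_nat (\<mu> k))) + snd (P3 (of_nat k - \<alpha> * of_nat (\<mu> k))) + 6"
    unfolding beta_update_def P1_def P2_def P3_def
    by (simp only: snd_counted fst_counted)
  ultimately show ?thesis by simp
qed

text \<open>The strips that the loop of \<open>jack\<close> reaches from \<open>\<mu>\<close> by removing cells in the rows
  \<open>i, i + 1, \<dots>\<close>, at least one cell.\<close>

definition strips_from :: "(nat \<Rightarrow> nat) \<Rightarrow> nat \<Rightarrow> (nat \<Rightarrow> nat) \<Rightarrow> (nat \<Rightarrow> nat) set" where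
  "strips_from \<kappa> i \<mu> = {\<nu> \<in> strips \<kappa>. (\<forall>r<i. \<nu> r = \<mu> r) \<and> \<nu> i \<le> \<mu> i \<and> \<nu> \<noteq> \<mu>}"

lemma strip_eqI:
  assumes "\<nu> \<in> strips \<kappa>" "\<mu> \<in> strips \<kappa>" "1 \<le> i" "\<And>r. r < i \<Longrightarrow> \<nu> r = \<mu> r" "\<nu> i = 0" "\<mu> i = 0"
  shows "\<nu> = \<mu>"
proof
  fix r
  have "\<nu> r = \<mu> r" if "\<not> r < i"
    using partition_mono[of \<nu> i r] partition_mono[of \<mu> i r] assms that by (simp add: strips_def)
  then show "\<nu> r = \<mu> r" using assms(4) by blast
qed

lemma strips_from_zero:
  assumes "\<mu> \<in> strips \<kappa>" "1 \<le> i" "\<mu> i = 0"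
  shows "strips_from \<kappa> i \<mu> = {}"
  using strip_eqI[OF _ assms(1,2)] assms(3) by (auto simp: strips_from_def)

locale strip_state =
  fixes \<kappa> \<mu> :: "nat \<Rightarrow> nat" and i :: nat
  assumes part: "is_partition \<kappa>" and strip: "\<mu> \<in> strips \<kappa>" and tail: "\<forall>r>i. \<mu> r = \<kappa> r"
begin

lemma part_\<mu>: "is_partition \<mu>" using strip by (simp add: strips_def)

lemma strips_from_done: "conj_part \<mu> 1 < i \<Longrightarrow> strips_from \<kappa> i \<mu> = {}"
  using partition_conj_part_zero[OF part_\<mu>, of i] by (intro strips_from_zero[OF strip]) auto

lemma le_Suc: "\<nu> \<in> strips \<kappa> \<Longrightarrow> \<nu> (Suc i) \<le> \<mu> (Suc i)"
  using tail by (simp add: strips_def hstrip_def)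

lemma strips_from_skip:
  assumes "\<not> (0 < i \<and> \<mu> (Suc i) < \<mu> i)"
  shows "strips_from \<kappa> i \<mu> = strips_from \<kappa> (Suc i) \<mu>"
proof -
  have "\<nu> i = \<mu> i" if "\<nu> \<in> strips \<kappa>" "\<nu> i \<le> \<mu> i" for \<nu>
  proof (cases "i = 0")
    case True
    then show ?thesis using that(1) part_\<mu> by (simp add: strips_def is_partition_def)
  next
    case False
    then have "\<mu> i \<le> \<kappa> (Suc i)" using assms tail by simp
    also have "\<dots> \<le> \<nu> i" using that(1) False by (simp add: strips_def hstrip_def)
    finally show ?thesis using that(2) by simp
  qed
  then show ?thesis using le_Suc by (auto simp: strips_from_def less_Suc_eq)
qed

context
  fixes \<mu>'
  assumes step: "0 < i" "\<mu> (Suc i) < \<mu> i" and \<mu>': "\<mu>' = \<mu>(i := \<mu> i - 1)"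
begin

lemma is_corner: "corner \<mu> \<mu>' i"
  using step \<mu>' part_\<mu> by unfold_locales auto

lemma strip_state': "strip_state \<kappa> \<mu>' i"
proof
  have "\<kappa> (Suc i) \<le> \<mu> i - 1" using tail step by simp
  then show "\<mu>' \<in> strips \<kappa>"
    using strip corner.partition'[OF is_corner] by (auto simp: strips_def hstrip_def \<mu>')
qed (use part tail \<mu>' in auto)

lemma strips_from_step:
  "strips_from \<kappa> i \<mu> = insert \<mu>' (strips_from \<kappa> i \<mu>') \<union> strips_from \<kappa> (Suc i) \<mu>"
  "insert \<mu>' (strips_from \<kappa> i \<mu>') \<inter> strips_from \<kappa> (Suc i) \<mu> = {}"
  "\<mu>' \<notin> strips_from \<kappa> i \<mu>'"
proof -
  have \<mu>'_strip: "\<mu>' \<in> strips \<kappa>" using strip_state' by (simp add: strip_state_def)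
  have ne: "\<nu> \<noteq> \<mu>" if "\<nu> i \<le> \<mu> i - 1" for \<nu> using step that by auto
  show "strips_from \<kappa> i \<mu> = insert \<mu>' (strips_from \<kappa> i \<mu>') \<union> strips_from \<kappa> (Suc i) \<mu>"
  proof (rule set_eqI)
    fix \<nu>
    show "\<nu> \<in> strips_from \<kappa> i \<mu> \<longleftrightarrow> \<nu> \<in> insert \<mu>' (strips_from \<kappa> i \<mu>') \<union> strips_from \<kappa> (Suc i) \<mu>"
    proof (cases "\<nu> i \<le> \<mu> i - 1")
      case True
      then have "\<nu> i \<noteq> \<mu> i" "\<nu> i \<le> \<mu> i" using step by auto
      then show ?thesis using True ne[of \<nu>] \<mu>'_strip
        by (auto simp: strips_from_def \<mu>' less_Suc_eq)
    next
      case False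
      then have "\<nu> \<noteq> \<mu>'" using step by (auto simp: \<mu>')
      then show ?thesis using False le_Suc[of \<nu>] by (auto simp: strips_from_def \<mu>' less_Suc_eq)
    qed
  qed
  show "insert \<mu>' (strips_from \<kappa> i \<mu>') \<inter> strips_from \<kappa> (Suc i) \<mu> = {}"
    using step by (auto simp: strips_from_def \<mu>' less_Suc_eq)
  show "\<mu>' \<notin> strips_from \<kappa> i \<mu>'" by (simp add: strips_from_def)
qed

end

lemma strip_state_Suc: "strip_state \<kappa> \<mu> (Suc i)"
  using part strip tail by unfold_locales auto

lemma length_le: "conj_part \<mu> 1 \<le> conj_part \<kappa> 1"
  unfolding conj_part_def
  by (rule card_mono[OF finite_parts_ge[OF part]])
     (use strip in \<open>auto simp: strips_def hstrip_def intro: order_trans\<close>)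

lemma finite_strips_from: "finite (strips_from \<kappa> i \<mu>)"
  by (rule finite_subset[OF _ finite_strips[OF part]]) (auto simp: strips_from_def)

end

lemma jack_loop_unfold:
  assumes "\<not> conj_part \<mu> 1 < i"
  shows "\<not> (0 < i \<and> \<mu> (Suc i) < \<mu> i) \<Longrightarrow> jack_loop \<alpha> x \<kappa> N\<kappa> D JJ t i \<mu> N \<beta> pw acc
      = (cret acc \<then> (\<lambda>acc. jack_loop \<alpha> x \<kappa> N\<kappa> D JJ t (Suc i) \<mu> N \<beta> pw acc))" (is "_ \<Longrightarrow> ?A = ?B1")
    and "0 < i \<and> \<mu> (Suc i) < \<mu> i \<Longrightarrow> jack_loop \<alpha> x \<kappa> N\<kappa> D JJ t i \<mu> N \<beta> pw acc
      = (charge 2 (index_of D (\<mu>(i := \<mu> i - 1)) \<then> (\<lambda>N'.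
           beta_update \<alpha> \<kappa> \<mu> i \<beta> \<then> (\<lambda>\<beta>'.
           (cret pw *\<^sub>c cret (x t)) \<then> (\<lambda>pw'.
           if 0 < \<mu> i - 1 then jack \<alpha> x \<kappa> N\<kappa> D JJ t i (\<mu>(i := \<mu> i - 1)) N' \<beta>' pw' acc
           else cret acc +\<^sub>c cret \<beta>' *\<^sub>c cret (JJ N' (t - 1)) *\<^sub>c cret pw')))) \<then> (\<lambda>acc.
        jack_loop \<alpha> x \<kappa> N\<kappa> D JJ t (Suc i) \<mu> N \<beta> pw acc))" (is "_ \<Longrightarrow> _ = ?B2")
proof -
  note eq = jack_loop.simps[of \<alpha> x \<kappa> N\<kappa> D JJ t i \<mu> N \<beta> pw acc, unfolded if_not_P[OF assms]]
  show "\<not> (0 < i \<and> \<mu> (Suc i) < \<mu> i) \<Longrightarrow> ?A = ?B1" by (subst eq, subst if_not_P) auto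
  show "0 < i \<and> \<mu> (Suc i) < \<mu> i \<Longrightarrow> ?A = ?B2" by (subst eq, subst if_P) auto
qed

text \<open>The decomposition \<open>strips_from_step\<close> is disjoint, so every strip is reached only once; the cost of
  reaching it is that of one index and one update of \<open>\<beta>\<close>, both linear in the number of parts.\<close>

lemma jack_cost:
  "strip_state \<kappa> \<mu> k \<Longrightarrow> snd (jack \<alpha> x \<kappa> N\<kappa> D JJ t k \<mu> N \<beta> pw acc)
    \<le> (25 * conj_part \<kappa> 1 + 21) * card (strips_from \<kappa> k \<mu>) + 3"
  "strip_state \<kappa> \<mu> i \<Longrightarrow> snd (jack_loop \<alpha> x \<kappa> N\<kappa> D JJ t i \<mu> N \<beta> pw acc)
    \<le> (25 * conj_part \<kappa> 1 + 21) * card (strips_from \<kappa> i \<mu>)"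
proof (induction \<alpha> x \<kappa> N\<kappa> D JJ t k \<mu> N \<beta> pw acc and \<alpha> x \<kappa> N\<kappa> D JJ t i \<mu> N \<beta> pw acc
    rule: jack_jack_loop.induct)
  case (1 \<alpha> x \<kappa> N\<kappa> D JJ t k \<mu> N \<beta> pw acc)
  from "1.IH"[OF "1.prems"] show ?case
    by (subst jack.simps) (cases "k = 0"; simp add: snd_counted fst_counted)
next
  case (2 \<alpha> x \<kappa> N\<kappa> D JJ t i \<mu> N \<beta> pw acc)
  interpret strip_state \<kappa> \<mu> i by fact
  let ?K = "25 * conj_part \<kappa> 1 + 21"
  show ?case
  proof (cases "conj_part \<mu> 1 < i")
    case True
    then show ?thesis by (subst jack_loop.simps) (simp add: snd_counted)
  next
    case F: False
    have IH2: "snd (jack_loop \<alpha> x \<kappa> N\<kappa> D JJ t (Suc i) \<mu> N \<beta> pw acc') \<le> ?K * card (strips_from \<kappa> (Suc i) \<mu>)" for acc'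
      using "2.IH"(2)[OF F strip_state_Suc] .
    show ?thesis
    proof (cases "0 < i \<and> \<mu> (Suc i) < \<mu> i")
      case False
      show ?thesis
        unfolding jack_loop_unfold(1)[OF F False] snd_counted fst_counted strips_from_skip[OF False]
        using IH2[of acc] by simp
    next
      case True
      define \<mu>' where "\<mu>' = \<mu>(i := \<mu> i - 1)"
      note st = strip_state'[OF _ _ \<mu>'_def] and fs = strips_from_step[OF _ _ \<mu>'_def]
      let ?c = "card (strips_from \<kappa> i \<mu>')"
      have cards: "card (strips_from \<kappa> i \<mu>) = Suc ?c + card (strips_from \<kappa> (Suc i) \<mu>)"
        using True fs strip_state.finite_strips_from[OF st] strip_state.finite_strips_from[OF strip_state_Suc]
        by (simp add: card_Un_disjoint)
      define J where "J N' \<beta>' pw' = (if 0 < \<mu> i - 1 then jack \<alpha> x \<kappa> N\<kappa> D JJ t i \<mu>' N' \<beta>' pw' acc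
           else cret acc +\<^sub>c cret \<beta>' *\<^sub>c cret (JJ N' (t - 1)) *\<^sub>c cret pw')" for N' \<beta>' pw'
      have J: "snd (J N' \<beta>' pw') \<le> ?K * ?c + 3" for N' \<beta>' pw'
      proof (cases "0 < \<mu> i - 1")
        case p: True
        have "strip_state \<kappa> \<mu>' i" using st True by simp
        then show ?thesis
          unfolding J_def if_P[OF p] by (rule "2.IH"(1)[OF F True p, folded \<mu>'_def])
      qed (simp add: J_def snd_counted)
      have "snd (index_of D \<mu>') \<le> 2 * conj_part \<kappa> 1"
        using snd_index_of_le[of D \<mu>'] strip_state.length_le[OF st] True by simp
      moreover have "snd (beta_update \<alpha> \<kappa> \<mu> i \<beta>) \<le> 23 * conj_part \<kappa> 1 + 15"
        using snd_beta_update_le[of i \<mu> \<alpha> \<kappa> \<beta>] F length_le by simp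
      ultimately have "snd (jack_loop \<alpha> x \<kappa> N\<kappa> D JJ t i \<mu> N \<beta> pw acc)
          \<le> ?K * card (strips_from \<kappa> (Suc i) \<mu>) + (?K * ?c + 3) + 2 * conj_part \<kappa> 1 + (23 * conj_part \<kappa> 1 + 15) + 3"
        using IH2[of "fst (J (fst (index_of D \<mu>')) (fst (beta_update \<alpha> \<kappa> \<mu> i \<beta>)) (pw * x t))"]
          J[of "fst (index_of D \<mu>')" "fst (beta_update \<alpha> \<kappa> \<mu> i \<beta>)" "pw * x t"]
        unfolding jack_loop_unfold(2)[OF F True, folded \<mu>'_def] snd_counted fst_counted J_def by linarith
      also have "\<dots> \<le> ?K * card (strips_from \<kappa> i \<mu>)"
        unfolding cards by (simp add: algebra_simps)
      finally show ?thesis .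
    qed
  qed
qed

text \<open>At each stage \<open>N\<close>, \<open>\<beta>\<close> and \<open>pw\<close> are the index, the coefficient and the power that belong to the current
  \<open>\<mu>\<close>, and the rows below \<open>i\<close> are still those of \<open>\<kappa>\<close>, as the update of \<open>\<beta>\<close> requires. For \<open>k = 0\<close> the
  call has \<open>\<mu> = \<kappa>\<close>, where the coefficient and the power are 1.\<close>

lemma jack_value:
  fixes \<alpha> :: real
  assumes pos: "\<alpha> > 0"
  defines "term x \<kappa> D JJ t \<nu> \<equiv> JJ (fst (index_of D \<nu>)) (t - 1) * x t ^ (psize \<kappa> - psize \<nu>) * strip_beta (complex_of_real \<alpha>) \<kappa> \<nu>"
  shows "strip_state \<kappa> \<mu> k \<Longrightarrow> A = of_real \<alpha> \<Longrightarrow> N = fst (index_of D \<mu>) \<Longrightarrow> \<beta> = strip_beta A \<kappa> \<mu> \<Longrightarrow>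
    pw = x t ^ (psize \<kappa> - psize \<mu>) \<Longrightarrow> (k = 0 \<Longrightarrow> N\<kappa> = N) \<Longrightarrow>
    fst (jack A x \<kappa> N\<kappa> D JJ t k \<mu> N \<beta> pw acc)
      = acc + term x \<kappa> D JJ t \<mu> + (\<Sum>\<nu>\<in>strips_from \<kappa> k \<mu>. term x \<kappa> D JJ t \<nu>)"
   and "strip_state \<kappa> \<mu> i \<Longrightarrow> A = of_real \<alpha> \<Longrightarrow> \<beta> = strip_beta A \<kappa> \<mu> \<Longrightarrow>
    pw = x t ^ (psize \<kappa> - psize \<mu>) \<Longrightarrow>
    fst (jack_loop A x \<kappa> N\<kappa> D JJ t i \<mu> N \<beta> pw acc)
      = acc + (\<Sum>\<nu>\<in>strips_from \<kappa> i \<mu>. term x \<kappa> D JJ t \<nu>)"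
proof (induction A x \<kappa> N\<kappa> D JJ t k \<mu> N \<beta> pw acc and A x \<kappa> N\<kappa> D JJ t i \<mu> N \<beta> pw acc
    rule: jack_jack_loop.induct)
  case (1 A x \<kappa> N\<kappa> D JJ t k \<mu> N \<beta> pw acc)
  interpret strip_state \<kappa> \<mu> k by fact
  note IH = "1.IH"[OF "1.prems"(1,2,4,5)]
  show ?case
  proof (cases "k = 0")
    case True
    have "\<mu> r = \<kappa> r" for r using tail part part_\<mu> True by (cases "r = 0") (auto simp: is_partition_def)
    then have "\<mu> = \<kappa>" by auto
    then show ?thesis using IH True 1 strip_beta_refl[OF part pos]
      by (subst jack.simps) (simp add: fst_counted term_def)
  next
    case False
    then show ?thesis using IH 1
      by (subst jack.simps) (simp add: fst_counted term_def)
  qed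
next
  case (2 A x \<kappa> N\<kappa> D JJ t i \<mu> N \<beta> pw acc)
  interpret strip_state \<kappa> \<mu> i by fact
  let ?t = "term x \<kappa> D JJ t"
  show ?case
  proof (cases "conj_part \<mu> 1 < i")
    case True
    then show ?thesis by (subst jack_loop.simps) (simp add: fst_counted strips_from_done)
  next
    case F: False
    have IH2: "fst (jack_loop A x \<kappa> N\<kappa> D JJ t (Suc i) \<mu> N \<beta> pw acc') = acc' + (\<Sum>\<nu>\<in>strips_from \<kappa> (Suc i) \<mu>. ?t \<nu>)" for acc'
      using "2.IH"(2)[OF F strip_state_Suc "2.prems"(2-4)] .
    show ?thesis
    proof (cases "0 < i \<and> \<mu> (Suc i) < \<mu> i")
      case False
      show ?thesis
        unfolding jack_loop_unfold(1)[OF F False] fst_counted strips_from_skip[OF False] by (rule IH2)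
    next
      case True
      define \<mu>' where "\<mu>' = \<mu>(i := \<mu> i - 1)"
      have st: "strip_state \<kappa> \<mu>' i" using strip_state'[OF _ _ \<mu>'_def] True by simp
      have corner: "corner \<mu> \<mu>' i" using is_corner[OF _ _ \<mu>'_def] True by simp
      note fs = strips_from_step[OF _ _ \<mu>'_def]
      have sum: "(\<Sum>\<nu>\<in>strips_from \<kappa> i \<mu>. ?t \<nu>)
          = ?t \<mu>' + (\<Sum>\<nu>\<in>strips_from \<kappa> i \<mu>'. ?t \<nu>) + (\<Sum>\<nu>\<in>strips_from \<kappa> (Suc i) \<mu>. ?t \<nu>)"
        using True fs strip_state.finite_strips_from[OF st] strip_state.finite_strips_from[OF strip_state_Suc]
        by (simp add: sum.union_disjoint)
      define \<beta>' where "\<beta>' = fst (beta_update A \<kappa> \<mu> i \<beta>)"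
      have \<beta>': "\<beta>' = strip_beta A \<kappa> \<mu>'"
        unfolding \<beta>'_def "2.prems"(2,3)
        using beta_update_value[OF part_\<mu> _ _ pos, of i \<kappa>] True
          strip_beta_corner[OF part strip tail corner pos] by simp
      have pw': "pw * x t = x t ^ (psize \<kappa> - psize \<mu>')"
      proof -
        have "psize \<kappa> - psize \<mu>' = Suc (psize \<kappa> - psize \<mu>)"
          using corner.psize_corner[OF corner] strip_psize_le[OF part strip] by simp
        then show ?thesis using "2.prems"(4) by simp
      qed
      define N' where "N' = fst (index_of D \<mu>')"
      define J where "J = (if 0 < \<mu> i - 1 then jack A x \<kappa> N\<kappa> D JJ t i \<mu>' N' \<beta>' (pw * x t) acc
           else cret acc +\<^sub>c cret \<beta>' *\<^sub>c cret (JJ N' (t - 1)) *\<^sub>c cret (pw * x t))"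
      have J: "fst J = acc + ?t \<mu>' + (\<Sum>\<nu>\<in>strips_from \<kappa> i \<mu>'. ?t \<nu>)"
      proof (cases "0 < \<mu> i - 1")
        case p: True
        then show ?thesis
          using "2.IH"(1)[OF F True p, folded \<mu>'_def, OF st "2.prems"(2) N'_def \<beta>' pw'] True
          unfolding J_def by simp
      next
        case False
        then have "strips_from \<kappa> i \<mu>' = {}"
          using st True by (intro strips_from_zero) (auto simp: \<mu>'_def strip_state_def)
        then show ?thesis using False "2.prems"(2)
          by (simp add: J_def fst_counted term_def \<beta>' pw' N'_def)
      qed
      have "fst (jack_loop A x \<kappa> N\<kappa> D JJ t i \<mu> N \<beta> pw acc)
          = fst J + (\<Sum>\<nu>\<in>strips_from \<kappa> (Suc i) \<mu>. ?t \<nu>)"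
        unfolding jack_loop_unfold(2)[OF F True, folded \<mu>'_def] J_def N'_def \<beta>'_def
        by (simp only: IH2 fst_counted snd_counted)
      then show ?thesis by (simp add: J sum)
    qed
  qed
qed

lemma strips_eq:
  assumes "is_partition \<kappa>" shows "strips \<kappa> = insert \<kappa> (strips_from \<kappa> 0 \<kappa>)" "strip_state \<kappa> \<kappa> 0"
proof -
  have "\<kappa> \<in> strips \<kappa>" using assms by (auto simp: strips_def hstrip_def is_partition_def)
  then show "strips \<kappa> = insert \<kappa> (strips_from \<kappa> 0 \<kappa>)" "strip_state \<kappa> \<kappa> 0"
    using assms by (auto simp: strips_from_def strips_def is_partition_def intro: strip_state.intro)
qed

text \<open>Started at \<open>\<kappa>\<close> itself, \<open>jack\<close> adds up the terms of all horizontal strips, which is the recurrence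
  \<open>Jack_strips\<close> of the Jack function.\<close>

lemma jack_value_top:
  fixes \<alpha> :: real and x :: "nat \<Rightarrow> complex" and JJ :: "nat \<Rightarrow> nat \<Rightarrow> complex"
  assumes "\<alpha> > 0" "is_partition \<kappa>" "2 \<le> t" "N = fst (index_of D \<kappa>)"
    and "\<And>\<nu>. \<nu> \<in> strips \<kappa> \<Longrightarrow> JJ (fst (index_of D \<nu>)) (t - 1) = Jack (of_real \<alpha>) x (t - 1) \<nu>"
  shows "fst (jack (of_real \<alpha>) x \<kappa> N D JJ t 0 \<kappa> N 1 1 0) = Jack (of_real \<alpha>) x t \<kappa>"
proof -
  let ?A = "complex_of_real \<alpha>"
  let ?t = "\<lambda>\<nu>. JJ (fst (index_of D \<nu>)) (t - 1) * x t ^ (psize \<kappa> - psize \<nu>) * strip_beta ?A \<kappa> \<nu>"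
  have "fst (jack ?A x \<kappa> N D JJ t 0 \<kappa> N 1 1 0) = 0 + ?t \<kappa> + (\<Sum>\<nu>\<in>strips_from \<kappa> 0 \<kappa>. ?t \<nu>)"
    using strips_eq(2)[OF assms(2)] strip_beta_refl[OF assms(2,1)] assms(4)
    by (intro jack_value(1)[OF assms(1)]) auto
  also have "\<dots> = (\<Sum>\<nu>\<in>strips \<kappa>. ?t \<nu>)"
    unfolding strips_eq(1)[OF assms(2)]
    using strip_state.finite_strips_from[OF strips_eq(2)[OF assms(2)]]
    by (simp add: strips_from_def)
  also have "\<dots> = (\<Sum>\<nu>\<in>strips \<kappa>. Jack ?A x (t - 1) \<nu> * x t ^ (psize \<kappa> - psize \<nu>) * strip_beta ?A \<kappa> \<nu>)"
    using assms(5) by (intro sum.cong) auto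
  also have "\<dots> = Jack ?A x t \<kappa>"
    using Jack_strips[of "t - 1" ?A x \<kappa>] assms(3) by (simp add: Suc_diff_le[symmetric])
  finally show ?thesis .
qed

lemma jack_cost_top:
  assumes "\<kappa> \<in> bounded_partitions m n"
  shows "snd (jack \<alpha> x \<kappa> N D JJ t 0 \<kappa> N' \<beta> pw acc) \<le> 974 * Pmn m n"
proof -
  have \<kappa>: "is_partition \<kappa>" using assms by (simp add: bounded_partitions_def)
  have st: "strip_state \<kappa> \<kappa> 0" by (rule strips_eq(2)[OF \<kappa>])
  have c: "card (strips \<kappa>) = Suc (card (strips_from \<kappa> 0 \<kappa>))"
    unfolding strips_eq(1)[OF \<kappa>]
    using strip_state.finite_strips_from[OF st] by (simp add: strips_from_def)
  have P: "card (strips \<kappa>) \<le> Pmn m n"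
    unfolding Pmn_def by (rule card_mono[OF finite_bounded_partitions strips_subset_bounded[OF assms]])
  have "snd (jack \<alpha> x \<kappa> N D JJ t 0 \<kappa> N' \<beta> pw acc) \<le> (25 * conj_part \<kappa> 1 + 21) * card (strips_from \<kappa> 0 \<kappa>) + 3"
    by (rule jack_cost(1)[OF st])
  also have "\<dots> \<le> (25 * conj_part \<kappa> 1 + 21) * card (strips \<kappa>) + 3 * card (strips \<kappa>)"
    using c by (intro add_mono mult_left_mono) auto
  also have "\<dots> = 25 * (conj_part \<kappa> 1 * card (strips \<kappa>)) + 24 * card (strips \<kappa>)"
    by (simp add: algebra_simps)
  also have "\<dots> \<le> 25 * (38 * Pmn m n) + 24 * Pmn m n"
    using length_times_strips_le[OF assms] P by (intro add_mono mult_left_mono) auto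
  finally show ?thesis by simp
qed


section \<open>The order of the visits\<close>

declare summation.simps [simp del] summation_loop.simps [simp del]

text \<open>\<open>summation\<close> visits the partitions in dictionary order; when it comes to the partition
  \<open>(\<kappa> 1, \<dots>, \<kappa> (i - 1), l)\<close>, the visited ones are those in \<open>before m n \<kappa> i l\<close>.\<close>

definition before :: "nat \<Rightarrow> nat \<Rightarrow> (nat \<Rightarrow> nat) \<Rightarrow> nat \<Rightarrow> nat \<Rightarrow> (nat \<Rightarrow> nat) set" where
  "before m n \<kappa> i l = {\<nu> \<in> bounded_partitions m n.
     (\<exists>r<i. \<nu> r < \<kappa> r \<and> (\<forall>s<r. \<nu> s = \<kappa> s)) \<or> (\<forall>s<i. \<nu> s = \<kappa> s) \<and> \<nu> i < l}"

lemma before_less: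
  "\<nu> \<in> bounded_partitions m n \<Longrightarrow> r < i \<Longrightarrow> \<nu> r < \<kappa> r \<Longrightarrow> (\<And>s. s < r \<Longrightarrow> \<nu> s = \<kappa> s) \<Longrightarrow> \<nu> \<in> before m n \<kappa> i l"
  by (auto simp: before_def)

lemma before_agree:
  "\<nu> \<in> bounded_partitions m n \<Longrightarrow> (\<And>s. s < i \<Longrightarrow> \<nu> s = \<kappa> s) \<Longrightarrow> \<nu> i < l \<Longrightarrow> \<nu> \<in> before m n \<kappa> i l"
  by (auto simp: before_def)

lemma before_cases [consumes 1]:
  assumes "\<nu> \<in> before m n \<kappa> i l"
  obtains (less) r where "\<nu> \<in> bounded_partitions m n" "r < i" "\<nu> r < \<kappa> r" "\<And>s. s < r \<Longrightarrow> \<nu> s = \<kappa> s"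
    | (agree) "\<nu> \<in> bounded_partitions m n" "\<And>s. s < i \<Longrightarrow> \<nu> s = \<kappa> s" "\<nu> i < l"
  using assms by (auto simp: before_def)

lemma before_subset: "before m n \<kappa> i l \<subseteq> bounded_partitions m n"
  by (auto simp: before_def)

lemma finite_before: "finite (before m n \<kappa> i l)"
  by (rule finite_subset[OF before_subset finite_bounded_partitions])

lemma bounded_partitions_mono:
  assumes "\<nu> \<in> bounded_partitions m n" "is_partition \<mu>" "\<And>s. \<mu> s \<le> \<nu> s"
  shows "\<mu> \<in> bounded_partitions m n"
  using assms psize_mono[of \<nu> \<mu>] by (auto simp: bounded_partitions_def) (metis le_zero_eq)

text \<open>Since dictionary order extends inclusion, whenever a partition is visited, all partitions
  contained in it have been visited.\<close>

lemma before_downward: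
  assumes \<nu>: "\<nu> \<in> before m n \<kappa> i l" and \<mu>: "is_partition \<mu>" "\<And>s. \<mu> s \<le> \<nu> s"
  shows "\<mu> \<in> before m n \<kappa> i l"
proof -
  have bd: "\<mu> \<in> bounded_partitions m n"
    using bounded_partitions_mono[OF _ \<mu>] \<nu> by (auto simp: before_def)
  show ?thesis
  proof (cases "\<forall>s<i. \<mu> s = \<kappa> s")
    case True
    have "\<not> (\<exists>r<i. \<nu> r < \<kappa> r)" using True \<mu>(2) by (metis not_less)
    then have "\<mu> i < l" using \<nu> \<mu>(2)[of i] by (auto simp: before_def)
    then show ?thesis using True bd by (simp add: before_def)
  next
    case False
    define r where "r = (LEAST s. s < i \<and> \<mu> s \<noteq> \<kappa> s)"
    have r: "r < i" "\<mu> r \<noteq> \<kappa> r" using LeastI_ex[of "\<lambda>s. s < i \<and> \<mu> s \<noteq> \<kappa> s"] False by (auto simp: r_def)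
    have eq: "\<mu> s = \<kappa> s" if "s < r" for s
      using not_less_Least[of s "\<lambda>s. s < i \<and> \<mu> s \<noteq> \<kappa> s"] that r by (auto simp: r_def)
    have "\<nu> r \<le> \<kappa> r" using \<nu>
    proof (cases rule: before_cases)
      case (less r')
      have "r \<le> r'" using eq[of r'] \<mu>(2)[of r'] less(3) by (cases "r' < r") auto
      then show ?thesis using less by (cases "r = r'") auto
    qed (use r in auto)
    then have "\<mu> r < \<kappa> r" using r(2) \<mu>(2)[of r] by linarith
    then show ?thesis using r(1) eq by (intro before_less[OF bd])
  qed
qed

lemma before_start: "before m n (\<lambda>_. 0) 1 1 = {\<lambda>_. 0}"
proof -
  have "\<nu> = (\<lambda>_. 0)" if "\<nu> \<in> before m n (\<lambda>_. 0) 1 1" for \<nu>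
  proof
    fix i show "\<nu> i = 0" using that partition_support[of \<nu> 0 i]
      by (cases "i = 0") (auto simp: before_def bounded_partitions_def)
  qed
  moreover have "(\<lambda>_. 0) \<in> before m n (\<lambda>_. 0) 1 1"
    by (simp add: before_def bounded_partitions_def is_partition_def psize_empty)
  ultimately show ?thesis by blast
qed

lemma before_end: "before m n (\<lambda>_. 0) 1 (Suc m) = bounded_partitions m n"
proof -
  have "\<nu> 0 = 0" "\<nu> 1 < Suc m" if "\<nu> \<in> bounded_partitions m n" for \<nu>
    using that partition_part_le[of \<nu> 1] by (auto simp: bounded_partitions_def is_partition_def)
  then show ?thesis by (auto simp: before_def)
qed

text \<open>The situation at a call of \<open>summation\<close>: row \<open>i\<close> and the rows below it are empty, and \<open>top\<close> is the
  last value that the loop will give to the part \<open>\<kappa> i\<close>.\<close>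

locale node =
  fixes m n :: nat and \<kappa> :: "nat \<Rightarrow> nat" and i :: nat
  assumes part: "is_partition \<kappa>" and i: "1 \<le> i" "i \<le> n"
    and zero: "\<And>r. i \<le> r \<Longrightarrow> \<kappa> r = 0" and size: "psize \<kappa> \<le> m"
begin

definition top :: nat where
  "top = (if i = 1 then m - psize \<kappa> else min (\<kappa> (i - 1)) (m - psize \<kappa>))"

lemma psize_sum: "psize \<kappa> = (\<Sum>s=1..i - 1. \<kappa> s)"
  using psize_eq[OF part, of "i - 1"] zero[of i] i by simp

lemma upd_zero: "\<kappa>(i := 0) = \<kappa>"
  using zero[of i] by auto

context
  fixes l assumes l: "l \<le> top"
begin

lemma part_upd: "is_partition (\<kappa>(i := l))"
proof -
  have "(\<kappa>(i := l)) (Suc s) \<le> (\<kappa>(i := l)) s" if "1 \<le> s" for s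
  proof (cases "Suc s = i")
    case True
    then show ?thesis using l that by (auto simp: top_def split: if_splits)
  next
    case False
    then show ?thesis using that part zero[of "Suc s"] by (auto simp: is_partition_def)
  qed
  moreover have "finite {s. (\<kappa>(i := l)) s \<noteq> 0}"
    by (rule finite_subset[of _ "{..i}"]) (use zero in \<open>auto simp: not_less[symmetric] split: if_splits\<close>)
  ultimately show ?thesis using part i by (auto simp: is_partition_def)
qed

lemma psize_upd: "psize (\<kappa>(i := l)) = psize \<kappa> + l"
proof -
  have "psize (\<kappa>(i := l)) = (\<Sum>s=1..i. (\<kappa>(i := l)) s)"
    by (rule psize_eq[OF part_upd]) (use zero[of "Suc i"] in simp)
  also have "\<dots> = (\<Sum>s=1..i - 1. (\<kappa>(i := l)) s) + l"
    using i by (cases i) auto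
  also have "(\<Sum>s=1..i - 1. (\<kappa>(i := l)) s) = (\<Sum>s=1..i - 1. \<kappa> s)"
    using i by (intro sum.cong) auto
  finally show ?thesis unfolding psize_sum .
qed

lemma upd_bounded: "\<kappa>(i := l) \<in> bounded_partitions m n"
  using part_upd psize_upd l size zero[of "Suc n"] i
  by (auto simp: bounded_partitions_def top_def split: if_splits)

lemma node_child: "i < n \<Longrightarrow> node m n (\<kappa>(i := l)) (Suc i)"
  using part_upd upd_bounded zero by unfold_locales (auto simp: bounded_partitions_def)

lemma before_visit: "before m n (\<kappa>(i := l)) (Suc i) 1 = insert (\<kappa>(i := l)) (before m n \<kappa> i l)"
proof -
  have *: "\<nu> = \<kappa>(i := l)" if "\<nu> \<in> bounded_partitions m n" "\<forall>s<Suc i. \<nu> s = (\<kappa>(i := l)) s" "\<nu> (Suc i) = 0" for \<nu>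
  proof
    fix s
    show "\<nu> s = (\<kappa>(i := l)) s"
      using that zero[of s] partition_support[of \<nu> i s]
      by (cases "s < Suc i") (auto simp: bounded_partitions_def)
  qed
  show ?thesis
  proof (intro equalityI subsetI)
    fix \<nu> assume "\<nu> \<in> before m n (\<kappa>(i := l)) (Suc i) 1"
    then show "\<nu> \<in> insert (\<kappa>(i := l)) (before m n \<kappa> i l)"
    proof (cases rule: before_cases)
      case (less r)
      show ?thesis
      proof (cases "r = i")
        case True
        then show ?thesis using less by (intro insertI2 before_agree) auto
      next
        case False
        then show ?thesis using less by (intro insertI2 before_less[of _ _ _ r]) auto
      qed
    next
      case agree
      then show ?thesis using *[of \<nu>] by auto
    qed
  next
    fix \<nu> assume "\<nu> \<in> insert (\<kappa>(i := l)) (before m n \<kappa> i l)"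
    then consider "\<nu> = \<kappa>(i := l)" | "\<nu> \<in> before m n \<kappa> i l" by blast
    then show "\<nu> \<in> before m n (\<kappa>(i := l)) (Suc i) 1"
    proof cases
      case 1
      then show ?thesis using upd_bounded zero[of "Suc i"] by (intro before_agree) auto
    next
      case 2
      then show ?thesis
      proof (cases rule: before_cases)
        case (less r)
        then show ?thesis by (intro before_less[of _ _ _ r]) auto
      next
        case agree
        then show ?thesis by (intro before_less[of _ _ _ i]) auto
      qed
    qed
  qed
qed

lemma upd_notin_before: "\<kappa>(i := l) \<notin> before m n \<kappa> i l"
  by (auto simp: before_def)

text \<open>After \<open>(\<kappa> 1, \<dots>, \<kappa> (i - 1), l)\<close> and all its extensions comes \<open>(\<kappa> 1, \<dots>, \<kappa> (i - 1), l + 1)\<close>.\<close>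

lemma before_next:
  assumes t: "\<And>\<nu>. \<nu> \<in> bounded_partitions m n \<Longrightarrow> \<forall>s<Suc i. \<nu> s = (\<kappa>(i := l)) s \<Longrightarrow> \<nu> (Suc i) \<le> t"
  shows "before m n (\<kappa>(i := l)) (Suc i) (Suc t) = before m n \<kappa> i (Suc l)"
proof (intro equalityI subsetI)
  fix \<nu> assume "\<nu> \<in> before m n (\<kappa>(i := l)) (Suc i) (Suc t)"
  then show "\<nu> \<in> before m n \<kappa> i (Suc l)"
  proof (cases rule: before_cases)
    case (less r)
    show ?thesis
    proof (cases "r = i")
      case True
      then show ?thesis using less by (intro before_agree) auto
    next
      case False
      then show ?thesis using less by (intro before_less[of _ _ _ r]) auto
    qed
  next
    case agree
    have "\<nu> s = \<kappa> s" if "s < i" for s using agree(2)[of s] that by simp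
    moreover have "\<nu> i = l" using agree(2)[of i] by simp
    ultimately show ?thesis using agree(1) by (intro before_agree) auto
  qed
next
  fix \<nu> assume "\<nu> \<in> before m n \<kappa> i (Suc l)"
  then show "\<nu> \<in> before m n (\<kappa>(i := l)) (Suc i) (Suc t)"
  proof (cases rule: before_cases)
    case (less r)
    then show ?thesis by (intro before_less[of _ _ _ r]) auto
  next
    case agree
    show ?thesis
    proof (cases "\<nu> i = l")
      case True
      then have "\<forall>s<Suc i. \<nu> s = (\<kappa>(i := l)) s" using agree(2) by (auto simp: less_Suc_eq)
      then show ?thesis using t[OF agree(1)] agree(1) by (intro before_agree) auto
    next
      case False
      then show ?thesis using agree by (intro before_less[of _ _ _ i]) auto
    qed
  qed
qed

lemma extension_le:
  assumes "\<nu> \<in> bounded_partitions m n" "\<forall>s<Suc i. \<nu> s = (\<kappa>(i := l)) s"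
  shows "\<nu> (Suc i) \<le> l" "\<nu> (Suc i) \<le> m - psize \<kappa> - l"
proof -
  have \<nu>: "is_partition \<nu>" "psize \<nu> \<le> m" using assms(1) by (auto simp: bounded_partitions_def)
  have "\<nu> i = l" using assms(2) by auto
  then show "\<nu> (Suc i) \<le> l" using \<nu>(1) i by (auto simp: is_partition_def)
  have "(\<Sum>s=1..Suc i. \<nu> s) \<le> m" using sum_parts_le[OF \<nu>(1), of "Suc i"] \<nu>(2) by simp
  moreover have "(\<Sum>s=1..Suc i. \<nu> s) = (\<Sum>s=1..i. (\<kappa>(i := l)) s) + \<nu> (Suc i)"
    using assms(2) by (auto intro!: sum.cong)
  moreover have "(\<Sum>s=1..i. (\<kappa>(i := l)) s) = psize \<kappa> + l"
    using psize_eq[OF part_upd, of i] zero[of "Suc i"] psize_upd by simp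
  ultimately show "\<nu> (Suc i) \<le> m - psize \<kappa> - l" by simp
qed

lemma before_leaf:
  assumes "\<not> (l < m - psize \<kappa> \<and> i < n)"
  shows "before m n (\<kappa>(i := l)) (Suc i) 1 = before m n \<kappa> i (Suc l)"
proof -
  have "before m n (\<kappa>(i := l)) (Suc i) (Suc 0) = before m n \<kappa> i (Suc l)"
  proof (rule before_next)
    fix \<nu> assume *: "\<nu> \<in> bounded_partitions m n" "\<forall>s<Suc i. \<nu> s = (\<kappa>(i := l)) s"
    show "\<nu> (Suc i) \<le> 0"
    proof (cases "l < m - psize \<kappa>")
      case True
      then have "i = n" using assms i by simp
      then show ?thesis using *(1) by (simp add: bounded_partitions_def)
    next
      case False
      then show ?thesis using extension_le[OF *] by simp
    qed
  qed
  then show ?thesis by simp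
qed

end

lemma before_child:
  assumes "l \<le> top" "i < n"
  shows "before m n (\<kappa>(i := l)) (Suc i) (Suc (node.top m (\<kappa>(i := l)) (Suc i))) = before m n \<kappa> i (Suc l)"
proof (rule before_next[OF assms(1)])
  fix \<nu> assume *: "\<nu> \<in> bounded_partitions m n" "\<forall>s<Suc i. \<nu> s = (\<kappa>(i := l)) s"
  show "\<nu> (Suc i) \<le> node.top m (\<kappa>(i := l)) (Suc i)"
    using extension_le[OF assms(1) *] i psize_upd[OF assms(1)]
    by (simp add: node.top_def[OF node_child[OF assms]])
qed

end

section \<open>The number of operations\<close>

lemma snd_Q_factor_le:
  "snd (Q_factor \<alpha> p a q b \<kappa> i) \<le> 2 * p + 2 * q + 10 * \<kappa> i + 9 * i + 9"
proof -
  define P1 where "P1 c = cprod [1..<Suc p] (\<lambda>j. cret (a j) +\<^sub>c cret c)" for c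
  define P2 where "P2 c = cprod [1..<Suc q] (\<lambda>j. cret (b j) +\<^sub>c cret c)" for c
  define P3 where "P3 d = cprod [1..<\<kappa> i] (\<lambda>j.
          (cret d -\<^sub>c num j *\<^sub>c cret \<alpha> +\<^sub>c num (conj_part \<kappa> j)) \<then> (\<lambda>e.
          (cret e +\<^sub>c num 1) \<then> (\<lambda>g.
          (cret g -\<^sub>c cret \<alpha>) *\<^sub>c cret e /\<^sub>c (cret g *\<^sub>c (cret e +\<^sub>c cret \<alpha>)))))" for d
  define P4 where "P4 d = cprod [1..<i] (\<lambda>j.
          (num (\<kappa> j) *\<^sub>c cret \<alpha> -\<^sub>c num j -\<^sub>c cret d) \<then> (\<lambda>f.
          (cret f +\<^sub>c cret \<alpha>) \<then> (\<lambda>h.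
          (cret h *\<^sub>c cret f) \<then> (\<lambda>l.
          (cret l -\<^sub>c cret f) /\<^sub>c (cret l +\<^sub>c cret h)))))" for d
  define c where "c = of_nat (\<kappa> i) - (of_nat i - 1) / \<alpha> - 1"
  define d where "d = of_nat (\<kappa> i) * \<alpha> - of_nat i"
  have "snd (P1 c) \<le> length [1..<Suc p] * Suc 1"
    unfolding P1_def by (rule snd_cprod_le) (simp add: snd_counted)
  moreover have "snd (P2 c) \<le> length [1..<Suc q] * Suc 1"
    unfolding P2_def by (rule snd_cprod_le) (simp add: snd_counted)
  moreover have "snd (P3 d) \<le> length [1..<\<kappa> i] * Suc 9"
    unfolding P3_def by (rule snd_cprod_le) (simp add: snd_counted)
  moreover have "snd (P4 d) \<le> length [1..<i] * Suc 8"
    unfolding P4_def by (rule snd_cprod_le) (simp add: snd_counted)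
  moreover have "snd (Q_factor \<alpha> p a q b \<kappa> i) = snd (P1 c) + snd (P2 c) + snd (P3 d) + snd (P4 d) + 9"
    unfolding Q_factor_def P1_def P2_def P3_def P4_def c_def d_def
    by (simp only: snd_counted fst_counted) simp
  ultimately show ?thesis by (simp del: upt_Suc)
qed

lemma snd_visit_le:
  assumes bd: "\<kappa> \<in> bounded_partitions m n" and i: "1 \<le> i" "0 < \<kappa> i" and n: "1 \<le> n"
  shows "snd (visit \<alpha> p a q b n x i z r \<kappa> N\<^sub>0 N st) + 2 \<le> (2 * p + 2 * q + 1015) * (n * Pmn m n)"
proof -
  have \<kappa>: "is_partition \<kappa>" "psize \<kappa> \<le> m" using bd by (auto simp: bounded_partitions_def)
  define P where "P = Pmn m n"
  have P: "m < P" using Pmn_ge[OF n, of m] by (simp add: P_def)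
  have im: "i \<le> m" "\<kappa> i \<le> m"
    using conj_part_1_ge[OF \<kappa>(1) i] partition_length_le[OF \<kappa>(1)] partition_part_le[OF \<kappa>(1), of i] \<kappa>(2) by auto
  define phase1 where "phase1 = (if \<kappa> i = 1 \<and> 1 < i then
         (cret (next_index st) +\<^sub>c cret r) \<then> (\<lambda>H.
         cret (next_index st,
               st\<lparr>next_index := H, D_array := (D_array st)(N\<^sub>0 := next_index st)\<rparr>))
       else (cret N +\<^sub>c cret 1) \<then> (\<lambda>N. cret (N, st)))"
  have 1: "snd phase1 \<le> 1" by (simp add: phase1_def snd_counted)
  define phase2 where "phase2 N st = (if conj_part \<kappa> 1 = 1 then
         (cret (x 1) *\<^sub>c (num 1 +\<^sub>c cret \<alpha> *\<^sub>c (num (\<kappa> 1) -\<^sub>c num 1)) *\<^sub>c cret (J_array st (N - 1) 1)) \<then> (\<lambda>v.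
         cret ((J_array st)(N := (J_array st N)(1 := v))))
       else cret (J_array st))" for N and st :: "'a hg_state"
  have 2: "snd (phase2 N st) \<le> 5" for N st by (simp add: phase2_def snd_counted)
  define phase3 where "phase3 N st JJ = cfor [2..<Suc n] (\<lambda>t JJ.
         jack \<alpha> x \<kappa> N (D_array st) JJ t 0 \<kappa> N 1 1 (JJ N t) \<then> (\<lambda>v.
         cret (JJ(N := (JJ N)(t := v))))) JJ" for N and st :: "'a hg_state" and JJ
  have "snd (phase3 N st JJ) \<le> length [2..<Suc n] * (974 * P)" for N st JJ
    unfolding phase3_def P_def
    by (rule snd_cfor_le) (simp add: snd_counted fst_counted jack_cost_top[OF bd])
  then have 3: "snd (phase3 N st JJ) \<le> (n - 1) * (974 * P)" for N st JJ by (simp del: upt_Suc)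
  have eq: "visit \<alpha> p a q b n x i z r \<kappa> N\<^sub>0 N st = charge 2 (phase1 \<then> (\<lambda>(N, st).
      (cret z *\<^sub>c Q_factor \<alpha> p a q b \<kappa> i) \<then> (\<lambda>z. phase2 N st \<then> (\<lambda>JJ. phase3 N st JJ \<then> (\<lambda>JJ.
      (cret (partial_sum st) +\<^sub>c cret z *\<^sub>c cret (JJ N n)) \<then> (\<lambda>s.
      cret (z, N, st\<lparr>J_array := JJ, partial_sum := s\<rparr>)))))))"
    by (simp only: visit_def phase1_def phase2_def phase3_def)
  define N' st' where "N' = fst (fst phase1)" and "st' = snd (fst phase1)"
  have "snd (visit \<alpha> p a q b n x i z r \<kappa> N\<^sub>0 N st)
      = 2 + snd phase1 + (1 + snd (Q_factor \<alpha> p a q b \<kappa> i)) + snd (phase2 N' st')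
        + snd (phase3 N' st' (fst (phase2 N' st'))) + 2"
    unfolding eq by (simp add: snd_counted fst_counted case_prod_beta N'_def st'_def)
  also have "\<dots> \<le> 2 + 1 + (1 + (2 * p + 2 * q + 10 * \<kappa> i + 9 * i + 9)) + 5 + (n - 1) * (974 * P) + 2"
    using 1 2 3 snd_Q_factor_le by (intro add_mono) auto
  finally have "snd (visit \<alpha> p a q b n x i z r \<kappa> N\<^sub>0 N st) + 2
      \<le> 2 * p + 2 * q + 22 + 19 * P + (n - 1) * (974 * P)"
    using im P by linarith
  also have "\<dots> \<le> (2 * p + 2 * q + 22) * P + 19 * P + (n - 1) * (974 * P)"
    using P by (intro add_mono) auto
  also have "\<dots> \<le> (2 * p + 2 * q + 22 + 19) * (n * P) + 974 * (n * P)"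
  proof -
    have "1 * P \<le> n * P" using n by (intro mult_right_mono) auto
    then have "(2 * p + 2 * q + 22 + 19) * P \<le> (2 * p + 2 * q + 22 + 19) * (n * P)" by (intro mult_left_mono) auto
    moreover have "(n - 1) * (974 * P) \<le> 974 * (n * P)" by simp
    ultimately show ?thesis by (simp add: algebra_simps)
  qed
  also have "\<dots> = (2 * p + 2 * q + 1015) * (n * P)" by (simp add: algebra_simps)
  finally show ?thesis by (simp add: P_def)
qed

lemma summation_loop_unfold:
  "1 \<le> l \<Longrightarrow> l \<le> r \<Longrightarrow> summation_loop \<alpha> p a q b n x i z j r l \<kappa> N\<^sub>0 N st =
     visit \<alpha> p a q b n x i z r (\<kappa>(i := l)) N\<^sub>0 N st \<then> (\<lambda>(z, N, st).
        (if l < j \<and> i < n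
         then charge 2 (summation \<alpha> p a q b n x (i + 1) z (j - l) (\<kappa>(i := l)) N st)
         else cret st) \<then> (\<lambda>st.
        summation_loop \<alpha> p a q b n x i z j r (l + 1) \<kappa> N\<^sub>0 N st))"
  "r < l \<Longrightarrow> summation_loop \<alpha> p a q b n x i z j r l \<kappa> N\<^sub>0 N st = cret st"
  by (subst summation_loop.simps, simp)+

text \<open>Every visit adds one element to the set \<open>before\<close>, which thereby pays for it; the number of visits
  need not be counted separately.\<close>

lemma summation_cost:
  fixes m n p q :: nat
  assumes "node m n \<kappa> i"
  defines "K \<equiv> (2 * p + 2 * q + 1015) * (n * Pmn m n)"
  shows "snd (summation \<alpha> p a q b n x i z (m - psize \<kappa>) \<kappa> N st) + K * card (before m n \<kappa> i 1)
    \<le> K * card (before m n \<kappa> i (Suc (node.top m \<kappa> i)))"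
  using assms(1)
proof (induction "n - i" arbitrary: \<kappa> i z N st rule: less_induct)
  case IH: (less i \<kappa> z N st)
  interpret node m n \<kappa> i by fact
  let ?j = "m - psize \<kappa>"
  have loop: "snd (summation_loop \<alpha> p a q b n x i z ?j top l \<kappa> N\<^sub>0 N st) + K * card (before m n \<kappa> i l)
    \<le> K * card (before m n \<kappa> i (Suc top))" if "l \<le> Suc top" "1 \<le> l" for l z N\<^sub>0 N st
    using that
  proof (induction l arbitrary: z N st rule: inc_induct)
    case base
    then show ?case by (simp add: summation_loop_unfold snd_counted)
  next
    case (step l)
    then have l: "1 \<le> l" "l \<le> top" by auto
    let ?\<kappa> = "\<kappa>(i := l)"
    define v where "v = visit \<alpha> p a q b n x i z top ?\<kappa> N\<^sub>0 N st"
    obtain z' N' st' where v': "fst v = (z', N', st')" by (cases "fst v")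
    have v: "snd v + 2 \<le> K"
      unfolding v_def K_def using l i by (intro snd_visit_le upd_bounded) auto
    define C where "C = (if l < ?j \<and> i < n
         then charge 2 (summation \<alpha> p a q b n x (i + 1) z' (?j - l) ?\<kappa> N' st') else cret st')"
    have cards: "card (before m n ?\<kappa> (Suc i) 1) = Suc (card (before m n \<kappa> i l))"
      using before_visit[OF l(2)] upd_notin_before[OF l(2)] finite_before by simp
    have C: "snd C + K * card (before m n ?\<kappa> (Suc i) 1) \<le> 2 + K * card (before m n \<kappa> i (Suc l))"
    proof (cases "l < ?j \<and> i < n")
      case True
      then have "snd (summation \<alpha> p a q b n x (Suc i) z' (m - psize ?\<kappa>) ?\<kappa> N' st') + K * card (before m n ?\<kappa> (Suc i) 1)
          \<le> K * card (before m n ?\<kappa> (Suc i) (Suc (node.top m ?\<kappa> (Suc i))))"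
        using node_child[OF l(2)] by (intro IH(1)) auto
      then show ?thesis using True before_child[OF l(2)] psize_upd[OF l(2)]
        by (simp add: C_def snd_counted)
    next
      case False
      then show ?thesis using before_leaf[OF l(2) False] by (auto simp: C_def snd_counted)
    qed
    have "summation_loop \<alpha> p a q b n x i z ?j top l \<kappa> N\<^sub>0 N st = v \<then> (\<lambda>(z, N, st).
        (if l < ?j \<and> i < n then charge 2 (summation \<alpha> p a q b n x (i + 1) z (?j - l) ?\<kappa> N st)
         else cret st) \<then> (\<lambda>st. summation_loop \<alpha> p a q b n x i z ?j top (l + 1) \<kappa> N\<^sub>0 N st))"
      unfolding v_def by (rule summation_loop_unfold(1)[OF l])
    then have "snd (summation_loop \<alpha> p a q b n x i z ?j top l \<kappa> N\<^sub>0 N st)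
        = snd v + snd C + snd (summation_loop \<alpha> p a q b n x i z' ?j top (Suc l) \<kappa> N\<^sub>0 N' (fst C))"
      by (simp add: snd_counted v' C_def)
    moreover have "K * Suc (card (before m n \<kappa> i l)) = K + K * card (before m n \<kappa> i l)" by simp
    ultimately show ?case
      using v C step.IH[of z' N' "fst C"] l unfolding cards by linarith
  qed
  have "summation \<alpha> p a q b n x i z ?j \<kappa> N st = summation_loop \<alpha> p a q b n x i z ?j top 1 \<kappa> N N st"
    by (subst summation.simps) (simp add: top_def)
  then show ?case using loop[of 1 z N N st] by simp
qed

lemma snd_compute_P_le: "snd (compute_P m n) \<le> n * m + Suc n * Suc m"
proof -
  define T where "T = cfor [1..<Suc n] (\<lambda>k. cfor [1..<Suc m] (\<lambda>i pt.
        (cret (pt (k - 1) (i - 1)) +\<^sub>c cret (if k \<le> i then pt k (i - k) else 0)) \<then>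
        (\<lambda>v. cret (pt(k := (pt k)(i := v))))))
      (\<lambda>k i. if k = 0 \<and> i = 0 then 1 else 0 :: nat)"
  have "snd T \<le> length [1..<Suc n] * (length [1..<Suc m] * 1)"
    unfolding T_def by (intro snd_cfor_le) (simp add: snd_counted)
  moreover have "snd (cfor [0..<Suc n] (\<lambda>k. cfor [0..<Suc m] (\<lambda>i s. cret s +\<^sub>c cret (pt k i))) 0)
      \<le> length [0..<Suc n] * (length [0..<Suc m] * 1)" for pt :: "nat \<Rightarrow> nat \<Rightarrow> nat"
    by (intro snd_cfor_le) (simp add: snd_counted)
  ultimately have "snd T + snd (cfor [0..<Suc n] (\<lambda>k. cfor [0..<Suc m] (\<lambda>i s. cret s +\<^sub>c cret (pt k i))) 0)
      \<le> n * m + Suc n * Suc m" for pt :: "nat \<Rightarrow> nat \<Rightarrow> nat"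
    by (fastforce simp del: upt_Suc intro: order_trans[OF add_mono])
  then show ?thesis unfolding compute_P_def T_def[symmetric] by (simp add: snd_counted add.commute del: upt_Suc)
qed

lemma node_root: "1 \<le> n \<Longrightarrow> node m n (\<lambda>_. 0) 1"
  by unfold_locales (auto simp: is_partition_def psize_empty)

lemma hg_cost_le:
  assumes n: "1 \<le> n"
  shows "hg_cost m \<alpha> p a q b n x \<le> (2 * p + 2 * q + 1020) * ((Pmn m n)\<^sup>2 * n)"
proof -
  define P where "P = Pmn m n"
  define K where "K = (2 * p + 2 * q + 1015) * (n * P)"
  have P: "Suc m \<le> P" using Pmn_ge[OF n, of m] by (simp add: P_def)
  let ?st = "\<lparr>next_index = m + 1, D_array = (\<lambda>_. 0), J_array = (\<lambda>N t. if N = 0 then 1 else 0), partial_sum = 1\<rparr>"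
  have top: "node.top m (\<lambda>_. 0) 1 = m" unfolding node.top_def[OF node_root[OF n]] by (simp add: psize_empty)
  have "snd (summation \<alpha> p a q b n x 1 1 m (\<lambda>_. 0) 0 ?st) \<le> K * P"
    using summation_cost[OF node_root[OF n], where m = m and p = p and q = q and \<alpha> = \<alpha> and a = a and b = b
        and x = x and z = 1 and N = 0 and st = ?st]
    unfolding top psize_empty before_end diff_zero K_def P_def Pmn_def by linarith
  moreover have "hg_cost m \<alpha> p a q b n x = snd (summation \<alpha> p a q b n x 1 1 m (\<lambda>_. 0) 0 ?st) + 1 + snd (compute_P m n)"
    by (simp add: hg_cost_def hg_def snd_counted fst_counted)
  ultimately have "hg_cost m \<alpha> p a q b n x \<le> K * P + 1 + (n * m + Suc n * Suc m)"
    using snd_compute_P_le[of m n] by linarith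
  also have "\<dots> \<le> K * P + n * P\<^sup>2 + (n * P\<^sup>2 + 2 * (n * P\<^sup>2))"
  proof (intro add_mono)
    have PP: "P \<le> P\<^sup>2" "1 \<le> P\<^sup>2" using P by (auto simp: power2_eq_square)
    show "1 \<le> n * P\<^sup>2" using PP n by (metis mult_le_mono nat_mult_1)
    show "n * m \<le> n * P\<^sup>2" using P PP by (intro mult_left_mono) auto
    have "Suc n * Suc m \<le> (2 * n) * P\<^sup>2" using P PP n by (intro mult_mono) auto
    then show "Suc n * Suc m \<le> 2 * (n * P\<^sup>2)" by simp
  qed simp
  also have "\<dots> \<le> (2 * p + 2 * q + 1020) * (P\<^sup>2 * n)"
    by (simp add: K_def algebra_simps power2_eq_square)
  finally show ?thesis by (simp add: P_def)
qed


section \<open>The index of a partition\<close>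

lemma fst_cfor_snoc: "fst (cfor (is @ [i]) f s) = fst (f i (fst (cfor is f s)))"
  by (induction "is" arbitrary: s) (auto simp: fst_counted)

text \<open>The value of the loop of \<open>index_of\<close> after row \<open>s\<close>, which is the index of the prefix
  \<open>(\<nu> 1, \<dots>, \<nu> s)\<close>. The value at 0 is the index of the empty partition, for which \<open>\<nu> 1 = 0\<close>.\<close>

primrec row_index :: "(nat \<Rightarrow> nat) \<Rightarrow> (nat \<Rightarrow> nat) \<Rightarrow> nat \<Rightarrow> nat" where
  "row_index D \<nu> 0 = \<nu> 1"
| "row_index D \<nu> (Suc s) = (if s = 0 then \<nu> 1 else D (row_index D \<nu> s) + \<nu> (Suc s) - 1)"

definition idx :: "(nat \<Rightarrow> nat) \<Rightarrow> (nat \<Rightarrow> nat) \<Rightarrow> nat" where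
  "idx D \<nu> = fst (index_of D \<nu>)"

lemma idx_row_index: "idx D \<nu> = row_index D \<nu> (conj_part \<nu> 1)"
proof -
  have "fst (cfor [2..<Suc l] (\<lambda>s N. cret (D N) +\<^sub>c cret (\<nu> s) -\<^sub>c cret 1) (\<nu> 1)) = row_index D \<nu> l" for l
  proof (induction l)
    case (Suc l)
    show ?case
    proof (cases "l = 0")
      case False
      then have "[2..<Suc (Suc l)] = [2..<Suc l] @ [Suc l]" by simp
      then show ?thesis using Suc False by (simp add: fst_cfor_snoc fst_counted del: upt_Suc)
    qed (simp add: fst_counted)
  qed (simp add: fst_counted)
  then show ?thesis by (simp add: idx_def index_of_def)
qed

lemma row_index_cong:
  "1 \<le> s \<Longrightarrow> (\<And>r. 1 \<le> r \<Longrightarrow> r \<le> s \<Longrightarrow> \<nu> r = \<mu> r) \<Longrightarrow> row_index D \<nu> s = row_index D \<mu> s"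
proof (induction s)
  case (Suc s)
  then show ?case by (cases "s = 0") auto
qed simp

lemma idx_one_row: "conj_part \<nu> 1 \<le> 1 \<Longrightarrow> idx D \<nu> = \<nu> 1"
  by (cases "conj_part \<nu> 1 = 0") (auto simp: idx_row_index le_Suc_eq)

lemma first_sibling:
  assumes "is_partition \<nu>" "1 \<le> conj_part \<nu> 1"
  shows "is_partition (\<nu>(conj_part \<nu> 1 := 1))" "(\<nu>(conj_part \<nu> 1 := 1)) s \<le> \<nu> s"
    "conj_part (\<nu>(conj_part \<nu> 1 := 1)) 1 = conj_part \<nu> 1"
proof -
  define l where "l = conj_part \<nu> 1"
  have pos: "0 < \<nu> s" if "1 \<le> s" "s \<le> l" for s using conj_part_1_pos[OF assms(1)] that by (simp add: l_def)
  have z: "\<nu> (Suc l) = 0" unfolding l_def by (rule partition_zero[OF assms(1)])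
  have l1: "1 \<le> l" using assms(2) by (simp add: l_def)
  have "(\<nu>(l := 1)) (Suc s) \<le> (\<nu>(l := 1)) s" if "1 \<le> s" for s
    using that pos[of s] z assms(1) by (auto simp: is_partition_def)
  moreover have "finite {s. (\<nu>(l := 1)) s \<noteq> 0}"
    by (rule finite_subset[of _ "insert l {s. \<nu> s \<noteq> 0}"]) (use assms(1) in \<open>auto simp: is_partition_def\<close>)
  ultimately show *: "is_partition (\<nu>(conj_part \<nu> 1 := 1))"
    using assms(1) l1 unfolding l_def[symmetric] by (auto simp: is_partition_def)
  show "(\<nu>(conj_part \<nu> 1 := 1)) s \<le> \<nu> s" using pos[of l] l1 unfolding l_def[symmetric] by auto
  show "conj_part (\<nu>(conj_part \<nu> 1 := 1)) 1 = conj_part \<nu> 1"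
    using conj_part_1_eqI[OF *, of l] z unfolding l_def[symmetric] by simp
qed

text \<open>When \<open>S\<close> has been visited, the partitions that have an index are those with at most one part,
  and those for which the sibling with last part 1 is in \<open>S\<close>: with the visit of
  that sibling, an index is reserved for each of its siblings.\<close>

definition reserved :: "nat \<Rightarrow> nat \<Rightarrow> (nat \<Rightarrow> nat) set \<Rightarrow> (nat \<Rightarrow> nat) set" where
  "reserved m n S = {\<nu> \<in> bounded_partitions m n. conj_part \<nu> 1 \<le> 1 \<or> \<nu>(conj_part \<nu> 1 := 1) \<in> S}"

lemma reserved_mono: "S \<subseteq> S' \<Longrightarrow> reserved m n S \<subseteq> reserved m n S'"
  by (auto simp: reserved_def)

definition downward :: "nat \<Rightarrow> nat \<Rightarrow> (nat \<Rightarrow> nat) set \<Rightarrow> bool" where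
  "downward m n S \<longleftrightarrow> S \<subseteq> bounded_partitions m n \<and>
     (\<forall>\<nu>\<in>S. \<forall>\<mu>. is_partition \<mu> \<longrightarrow> (\<forall>s. \<mu> s \<le> \<nu> s) \<longrightarrow> \<mu> \<in> S)"

lemma downward_before: "downward m n (before m n \<kappa> i l)"
  using before_subset before_downward unfolding downward_def by blast

lemma downward_reserved:
  assumes "downward m n S" shows "S \<subseteq> reserved m n S"
proof
  fix \<nu> assume \<nu>: "\<nu> \<in> S"
  then have bd: "\<nu> \<in> bounded_partitions m n" "is_partition \<nu>"
    using assms by (auto simp: downward_def bounded_partitions_def)
  have "\<nu>(conj_part \<nu> 1 := 1) \<in> S" if "1 \<le> conj_part \<nu> 1"
    using first_sibling[OF bd(2) that] assms \<nu> unfolding downward_def by blast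
  then show "\<nu> \<in> reserved m n S"
    using bd by (cases "1 \<le> conj_part \<nu> 1") (simp_all add: reserved_def)
qed

text \<open>Opening the block of the extensions of \<open>\<pi>\<close> does not change an index that is already reserved: it
  depends only on the entries of \<open>D\<close> for proper prefixes of which an extension has been visited.\<close>

lemma idx_open_block:
  assumes S: "downward m n S" and inj: "inj_on (idx D) (reserved m n S)"
    and \<pi>: "\<pi> \<in> S" "Suc (conj_part \<pi> 1) = i" "is_partition (\<pi>(i := 1))" "\<pi>(i := 1) \<notin> S"
    and \<nu>: "\<nu> \<in> reserved m n S"
  shows "idx (D(idx D \<pi> := H)) \<nu> = idx D \<nu>"
proof -
  define l where "l = conj_part \<nu> 1"
  let ?D = "D(idx D \<pi> := H)"
  have part: "is_partition \<nu>" using \<nu> by (simp add: reserved_def bounded_partitions_def)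
  have "row_index ?D \<nu> s = row_index D \<nu> s" if "s \<le> l" for s
    using that
  proof (induction s)
    case (Suc s)
    show ?case
    proof (cases "s = 0")
      case False
      define \<rho> where "\<rho> = (\<lambda>r. if r \<le> s then \<nu> r else 0)"
      have pos: "0 < \<nu> r" if "1 \<le> r" "r \<le> l" for r
        using conj_part_1_pos[OF part] that by (simp add: l_def)
      have \<rho>: "is_partition \<rho>"
        using part by (auto simp: is_partition_def \<rho>_def)
      have len: "conj_part \<rho> 1 = s"
        using pos[of s] Suc(2) by (intro conj_part_1_eqI[OF \<rho>]) (auto simp: \<rho>_def)
      have sib: "\<nu>(l := 1) \<in> S" using \<nu> Suc(2) False by (auto simp: reserved_def l_def)
      have "\<rho> \<in> S"
        using S sib \<rho> Suc(2) by (auto simp: downward_def \<rho>_def)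
      have "idx D \<rho> \<noteq> idx D \<pi>"
      proof
        assume "idx D \<rho> = idx D \<pi>"
        then have "\<rho> = \<pi>" using inj_onD[OF inj] \<open>\<rho> \<in> S\<close> \<pi>(1) downward_reserved[OF S] by blast
        then have i: "i = Suc s" using \<pi>(2) len by simp
        have "(\<pi>(i := 1)) r \<le> (\<nu>(l := 1)) r" for r
          using pos[of i] Suc(2) unfolding \<open>\<rho> = \<pi>\<close>[symmetric] i by (auto simp: \<rho>_def)
        then have "\<pi>(i := 1) \<in> S" using S sib \<pi>(3) unfolding downward_def by blast
        then show False using \<pi>(4) by simp
      qed
      moreover have "idx D \<rho> = row_index D \<nu> s"
        unfolding idx_row_index len using False by (intro row_index_cong) (auto simp: \<rho>_def)
      ultimately show ?thesis using Suc False by simp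
    qed simp
  qed simp
  then show ?thesis by (simp add: idx_row_index l_def)
qed

section \<open>The value of the sum\<close>

lemma fst_visit:
  assumes "(N', st') = (if \<kappa> i = 1 \<and> 1 < i then
       (next_index st, st\<lparr>next_index := next_index st + r, D_array := (D_array st)(N\<^sub>0 := next_index st)\<rparr>)
     else (N + 1, st))"
    and "JJ' = (if conj_part \<kappa> 1 = 1 then
       (J_array st')(N' := (J_array st' N')(1 := x 1 * (1 + \<alpha> * (of_nat (\<kappa> 1) - 1)) * J_array st' (N' - 1) 1))
     else J_array st')"
    and "JJ = fst (cfor [2..<Suc n] (\<lambda>t JJ. jack \<alpha> x \<kappa> N' (D_array st') JJ t 0 \<kappa> N' 1 1 (JJ N' t) \<then> (\<lambda>v.
         cret (JJ(N' := (JJ N')(t := v))))) JJ')"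
    and "z' = z * fst (Q_factor \<alpha> p a q b \<kappa> i)"
  shows "fst (visit \<alpha> p a q b n x i z r \<kappa> N\<^sub>0 N st)
    = (z', N', st'\<lparr>J_array := JJ, partial_sum := partial_sum st' + z' * JJ N' n\<rparr>)"
proof (cases "\<kappa> i = 1 \<and> 1 < i")
  case True
  then have *: "N' = next_index st" "st' = st\<lparr>next_index := next_index st + r, D_array := (D_array st)(N\<^sub>0 := next_index st)\<rparr>"
    using assms(1) by simp_all
  show ?thesis
    unfolding visit_def if_P[OF True] assms(3,4,2) * 
    by (simp only: fst_counted snd_counted case_prod_conv if_distrib[of fst] of_nat_1)
next
  case False
  then have *: "N' = N + 1" "st' = st" using assms(1) unfolding if_not_P[OF False] by simp_all
  show ?thesis
    unfolding visit_def if_not_P[OF False] assms(3,4,2) *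
    by (simp only: fst_counted snd_counted case_prod_conv if_distrib[of fst] of_nat_1)
qed

locale hg_run =
  fixes m n :: nat and \<alpha> :: real and p :: nat and a :: "nat \<Rightarrow> complex" and q :: nat
    and b x :: "nat \<Rightarrow> complex"
  assumes n: "1 \<le> n" and pos: "\<alpha> > 0"
begin

abbreviation A :: complex where "A \<equiv> complex_of_real \<alpha>"
abbreviation Q :: "(nat \<Rightarrow> nat) \<Rightarrow> complex" where "Q \<equiv> Q_coeff A p a q b"

text \<open>The state after the visits of the partitions in \<open>S\<close>. The rows of the array without a visited
  partition must be zero, because \<open>jack\<close> adds to the entry that it finds.\<close>

definition inv :: "(nat \<Rightarrow> nat) set \<Rightarrow> complex hg_state \<Rightarrow> bool" where
  "inv S st \<longleftrightarrow>
     inj_on (idx (D_array st)) (reserved m n S) \<and>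
     (\<forall>\<nu>\<in>reserved m n S. idx (D_array st) \<nu> < next_index st) \<and>
     (\<forall>\<nu>\<in>S. \<forall>t. 1 \<le> t \<longrightarrow> t \<le> n \<longrightarrow> J_array st (idx (D_array st) \<nu>) t = Jack A x t \<nu>) \<and>
     (\<forall>N t. N \<notin> idx (D_array st) ` S \<longrightarrow> J_array st N t = 0) \<and>
     partial_sum st = (\<Sum>\<nu>\<in>S. Q \<nu> * Jack A x n \<nu>)"

definition keeps :: "(nat \<Rightarrow> nat) set \<Rightarrow> complex hg_state \<Rightarrow> complex hg_state \<Rightarrow> bool" where
  "keeps S st st' \<longleftrightarrow> (\<forall>\<nu>\<in>reserved m n S. idx (D_array st') \<nu> = idx (D_array st) \<nu>)"

lemma keeps_trans:
  "keeps S st st' \<Longrightarrow> keeps S' st' st'' \<Longrightarrow> S \<subseteq> S' \<Longrightarrow> keeps S st st''"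
  using reserved_mono[of S S' m n] unfolding keeps_def by (metis subsetD)

text \<open>The strip \<open>\<kappa>/\<kappa>\<close> makes the entry for \<open>t\<close> variables depend on the entry for \<open>t - 1\<close> variables in the
  same row, which is therefore filled from left to right.\<close>

lemma jack_row:
  assumes \<kappa>: "is_partition \<kappa>" and N: "N = idx D \<kappa>"
    and JJ: "\<And>\<nu> t. \<nu> \<in> strips \<kappa> \<Longrightarrow> \<nu> \<noteq> \<kappa> \<Longrightarrow> 1 \<le> t \<Longrightarrow> t \<le> n \<Longrightarrow> idx D \<nu> \<noteq> N \<and> JJ (idx D \<nu>) t = Jack A x t \<nu>"
    and JJ1: "JJ N 1 = Jack A x 1 \<kappa>" and JJ0: "\<And>t. 1 < t \<Longrightarrow> JJ N t = 0"
  defines "F k \<equiv> fst (cfor [2..<Suc k] (\<lambda>t JJ. jack A x \<kappa> N D JJ t 0 \<kappa> N 1 1 (JJ N t) \<then> (\<lambda>v.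
         cret (JJ(N := (JJ N)(t := v))))) JJ)"
  shows "1 \<le> k \<Longrightarrow> k \<le> n \<Longrightarrow> (\<forall>t. 1 \<le> t \<longrightarrow> t \<le> k \<longrightarrow> F k N t = Jack A x t \<kappa>) \<and>
    (\<forall>t>k. F k N t = 0) \<and> (\<forall>N'. N' \<noteq> N \<longrightarrow> F k N' = JJ N')"
proof (induction k rule: dec_induct)
  case base
  show ?case using JJ1 JJ0 by (auto simp: F_def fst_counted le_Suc_eq)
next
  case (step k)
  let ?v = "fst (jack A x \<kappa> N D (F k) (Suc k) 0 \<kappa> N 1 1 (F k N (Suc k)))"
  have "[2..<Suc (Suc k)] = [2..<Suc k] @ [Suc k]" using step by simp
  then have F: "F (Suc k) = (F k)(N := (F k N)(Suc k := ?v))"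
    unfolding F_def by (simp only: fst_cfor_snoc fst_counted)
  have IH: "\<And>t. 1 \<le> t \<Longrightarrow> t \<le> k \<Longrightarrow> F k N t = Jack A x t \<kappa>" "\<And>t. k < t \<Longrightarrow> F k N t = 0"
    "\<And>N'. N' \<noteq> N \<Longrightarrow> F k N' = JJ N'"
    using step by auto
  have "?v = Jack A x (Suc k) \<kappa>"
    unfolding IH(2)[OF lessI]
  proof (rule jack_value_top[OF pos \<kappa>])
    fix \<nu> assume \<nu>: "\<nu> \<in> strips \<kappa>"
    show "F k (fst (index_of D \<nu>)) (Suc k - 1) = Jack A x (Suc k - 1) \<nu>"
    proof (cases "\<nu> = \<kappa>")
      case True
      then show ?thesis using IH(1)[of k] step N by (simp add: idx_def)
    next
      case False
      then show ?thesis using JJ[OF \<nu>, of k] IH(3) step by (simp add: idx_def)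
    qed
  qed (use step N in \<open>auto simp: idx_def\<close>)
  then show ?case using IH F by (auto simp: le_Suc_eq)
qed

end

lemma (in node) conj_part_upd: "1 \<le> l \<Longrightarrow> l \<le> top \<Longrightarrow> conj_part (\<kappa>(i := l)) 1 = i"
  using zero[of "Suc i"] by (intro conj_part_1_eqI part_upd) auto

lemma (in node) mem_before: "1 \<le> l \<Longrightarrow> \<kappa> \<in> before m n \<kappa> i l"
  using zero[of i] zero[of "Suc n"] i part size
  by (auto intro!: before_agree simp: bounded_partitions_def)

lemma (in node) upd_mem_before: "l \<le> top \<Longrightarrow> \<kappa>(i := l) \<in> before m n \<kappa> i (Suc l)"
  by (intro before_agree upd_bounded) auto

lemma (in node) strips_before:
  assumes "l \<le> top" "\<nu> \<in> strips (\<kappa>(i := l))" "\<nu> \<noteq> \<kappa>(i := l)"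
  shows "\<nu> \<in> before m n \<kappa> i l"
proof -
  have "\<kappa>(i := l) \<in> before m n (\<kappa>(i := l)) (Suc i) 1" using before_visit[OF assms(1)] by simp
  then have "\<nu> \<in> before m n (\<kappa>(i := l)) (Suc i) 1"
  proof (rule before_downward)
    show "is_partition \<nu>" using assms(2) by (simp add: strips_def)
    fix s show "\<nu> s \<le> (\<kappa>(i := l)) s"
      using assms(2) by (cases "s = 0") (auto simp: strips_def hstrip_def is_partition_def)
  qed
  then show ?thesis using before_visit[OF assms(1)] assms(3) by simp
qed

lemma (in node) corner_upd:
  assumes "1 \<le> l" "l \<le> top" shows "corner (\<kappa>(i := l)) (\<kappa>(i := l - 1)) i"
  using part_upd[OF assms(2)] assms i zero[of "Suc i"] by unfold_locales auto

locale hg_node = node + hg_run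
begin

text \<open>The first extension of \<open>\<kappa>\<close> opens a block of \<open>top\<close> indices beyond all those in use, one for each
  value of the part \<open>i\<close>; the further extensions take their index from this block. In row 1 the
  indices up to \<open>m\<close> play the role of the block.\<close>

lemma new_index:
  assumes l: "1 \<le> l" "l \<le> top" and inv: "inv (before m n \<kappa> i l) st"
    and N0: "N\<^sub>0 = idx (D_array st) \<kappa>" and N: "N = idx (D_array st) (\<kappa>(i := l - 1))"
    and st': "(N', st') = (if l = 1 \<and> 1 < i then
       (next_index st, st\<lparr>next_index := next_index st + top, D_array := (D_array st)(N\<^sub>0 := next_index st)\<rparr>)
     else (N + 1, st))"
  defines "S \<equiv> before m n \<kappa> i l" and "S' \<equiv> insert (\<kappa>(i := l)) (before m n \<kappa> i l)"
  shows "keeps S st st'" "inj_on (idx (D_array st')) (reserved m n S')"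
    "\<forall>\<nu>\<in>reserved m n S'. idx (D_array st') \<nu> < next_index st'"
    "N' = idx (D_array st') (\<kappa>(i := l))" "J_array st' = J_array st" "partial_sum st' = partial_sum st"
proof -
  let ?D = "D_array st" and ?H = "next_index st"
  have inj: "inj_on (idx ?D) (reserved m n S)" and lt: "\<And>\<nu>. \<nu> \<in> reserved m n S \<Longrightarrow> idx ?D \<nu> < ?H"
    using inv by (auto simp: inv_def S_def)
  have down: "downward m n S" unfolding S_def by (rule downward_before)
  have len: "conj_part \<nu> 1 = i \<and> \<nu> = \<kappa>(i := \<nu> i)" if "\<nu>(conj_part \<nu> 1 := 1) = \<kappa>(i := l)" "1 < conj_part \<nu> 1"
    "is_partition \<nu>" for \<nu>
  proof -
    have "conj_part (\<kappa>(i := l)) 1 = conj_part \<nu> 1"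
      using first_sibling(3)[OF that(3)] that(2) unfolding that(1) by simp
    then have *: "conj_part \<nu> 1 = i" unfolding conj_part_upd[OF l] ..
    have "\<nu> = (\<nu>(i := 1))(i := \<nu> i)" by simp
    also have "\<dots> = \<kappa>(i := \<nu> i)" using that(1) unfolding * by simp
    finally show ?thesis using * by simp
  qed
  show "J_array st' = J_array st" "partial_sum st' = partial_sum st"
    using st' by (auto split: if_splits)
  have "keeps S st st' \<and> inj_on (idx (D_array st')) (reserved m n S') \<and>
    (\<forall>\<nu>\<in>reserved m n S'. idx (D_array st') \<nu> < next_index st') \<and> N' = idx (D_array st') (\<kappa>(i := l))"
  proof (cases "l = 1 \<and> 1 < i")
    case True
    let ?D' = "?D(N\<^sub>0 := ?H)"
    have st: "N' = ?H" "D_array st' = ?D'" "next_index st' = ?H + top" using st' True by auto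
    have \<kappa>S: "\<kappa> \<in> S" unfolding S_def by (rule mem_before[OF l(1)])
    have "0 < \<kappa> (i - 1)" using True l by (auto simp: top_def split: if_splits)
    then have len\<kappa>: "Suc (conj_part \<kappa> 1) = i"
      using conj_part_1_eqI[OF part, of "i - 1"] zero[of i] i True by simp
    have old: "idx ?D' \<nu> = idx ?D \<nu>" if "\<nu> \<in> reserved m n S" for \<nu>
      unfolding N0
      using part_upd[OF l(2)] upd_notin_before[OF l(2)] True that
      by (intro idx_open_block[OF down inj \<kappa>S len\<kappa>]) (auto simp: S_def)
    have new: "idx ?D' (\<kappa>(i := k)) = ?H + k - 1" if k: "1 \<le> k" "k \<le> top" for k
    proof -
      have "row_index ?D' (\<kappa>(i := k)) (i - 1) = row_index ?D' \<kappa> (i - 1)"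
        using True by (intro row_index_cong) auto
      also have "\<dots> = idx ?D' \<kappa>" using len\<kappa> unfolding idx_row_index by (metis diff_Suc_1)
      also have "\<dots> = N\<^sub>0" unfolding N0 using old \<kappa>S downward_reserved[OF down] by (auto simp: N0)
      finally have *: "row_index ?D' (\<kappa>(i := k)) (i - 1) = N\<^sub>0" .
      obtain i' where i': "i = Suc i'" "i' \<noteq> 0" using True by (cases i) auto
      have "idx ?D' (\<kappa>(i := k)) = row_index ?D' (\<kappa>(i := k)) (Suc i')"
        unfolding idx_row_index trans[OF conj_part_upd[OF k] i'(1)] ..
      also have "\<dots> = ?D' (row_index ?D' (\<kappa>(i := k)) (i - 1)) + k - 1" using i' by simp
      finally show ?thesis unfolding * by simp
    qed
    have cases: "\<nu> \<in> reserved m n S \<or> (\<exists>k. 1 \<le> k \<and> k \<le> top \<and> \<nu> = \<kappa>(i := k))" if "\<nu> \<in> reserved m n S'" for \<nu>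
    proof (rule disj_imp[THEN iffD2], rule impI)
      assume "\<nu> \<notin> reserved m n S"
      then have *: "\<nu>(conj_part \<nu> 1 := 1) = \<kappa>(i := l)" "1 < conj_part \<nu> 1" "\<nu> \<in> bounded_partitions m n" "is_partition \<nu>"
        using that by (auto simp: reserved_def S'_def S_def bounded_partitions_def)
      from len[OF *(1,2,4)] have **: "conj_part \<nu> 1 = i" "\<nu> = \<kappa>(i := \<nu> i)" by auto
      have "1 \<le> \<nu> i" using conj_part_1_pos[OF *(4), of i] **(1) i by simp
      moreover have "\<nu> i \<le> \<nu> (i - 1)" using True by (intro partition_mono[OF *(4)]) auto
      moreover have "\<nu> (i - 1) = \<kappa> (i - 1)" by (subst **(2)) (use i in auto)
      moreover have "\<nu> i \<le> m - psize \<kappa>"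
      proof -
        have "(\<Sum>s=1..i. \<nu> s) \<le> m" using sum_parts_le[OF *(4), of i] *(3) by (simp add: bounded_partitions_def)
        moreover have "(\<Sum>s=1..i. \<nu> s) = (\<Sum>s=1..i - 1. \<nu> s) + \<nu> i" using i by (cases i) auto
        moreover have "(\<Sum>s=1..i - 1. \<nu> s) = (\<Sum>s=1..i - 1. \<kappa> s)"
          by (intro sum.cong refl, subst **(2)) auto
        ultimately show ?thesis by (simp add: psize_sum)
      qed
      ultimately show "\<exists>k. 1 \<le> k \<and> k \<le> top \<and> \<nu> = \<kappa>(i := k)"
        using **(2) True by (intro exI[of _ "\<nu> i"]) (auto simp: top_def)
    qed
    have "inj_on (idx ?D') (reserved m n S')"
    proof (rule inj_onI)
      fix \<mu> \<nu> assume \<mu>: "\<mu> \<in> reserved m n S'" and \<nu>: "\<nu> \<in> reserved m n S'" and eq: "idx ?D' \<mu> = idx ?D' \<nu>"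
      show "\<mu> = \<nu>"
        using cases[OF \<mu>] cases[OF \<nu>]
      proof (elim disjE exE conjE)
        assume "\<mu> \<in> reserved m n S" "\<nu> \<in> reserved m n S"
        then show ?thesis using eq old inj_onD[OF inj] by simp
      next
        fix k assume "\<mu> \<in> reserved m n S" "1 \<le> k" "k \<le> top" "\<nu> = \<kappa>(i := k)"
        then show ?thesis using eq old[of \<mu>] lt[of \<mu>] new[of k] by simp
      next
        fix k assume "\<nu> \<in> reserved m n S" "1 \<le> k" "k \<le> top" "\<mu> = \<kappa>(i := k)"
        then show ?thesis using eq old[of \<nu>] lt[of \<nu>] new[of k] by simp
      next
        fix k k' assume *: "1 \<le> k" "k \<le> top" "\<mu> = \<kappa>(i := k)" "1 \<le> k'" "k' \<le> top" "\<nu> = \<kappa>(i := k')"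
        then have "?H + k - 1 = ?H + k' - 1" using eq new[of k] new[of k'] by simp
        then have "k = k'" using * by linarith
        then show ?thesis using * by simp
      qed
    qed
    moreover have "idx ?D' \<nu> < ?H + top" if "\<nu> \<in> reserved m n S'" for \<nu>
      using cases[OF that]
    proof (elim disjE exE conjE)
      assume "\<nu> \<in> reserved m n S"
      then show ?thesis using old lt by fastforce
    next
      fix k assume "1 \<le> k" "k \<le> top" "\<nu> = \<kappa>(i := k)"
      then show ?thesis using new[of k] by simp
    qed
    ultimately show ?thesis using old new[of l] l True by (simp add: st keeps_def)
  next
    case False
    then have st: "N' = N + 1" "st' = st" using st' by auto
    have "reserved m n S' = reserved m n S"
    proof -
      have "\<nu>(conj_part \<nu> 1 := 1) \<noteq> \<kappa>(i := l)" if "1 < conj_part \<nu> 1" "is_partition \<nu>" for \<nu>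
      proof
        assume *: "\<nu>(conj_part \<nu> 1 := 1) = \<kappa>(i := l)"
        then have "conj_part \<nu> 1 = i" using len that by blast
        then show False using fun_cong[OF *, of i] that(1) False by simp
      qed
      then have "\<nu> \<in> reserved m n S' \<longleftrightarrow> \<nu> \<in> reserved m n S" for \<nu>
        by (cases "1 < conj_part \<nu> 1") (auto simp: reserved_def S'_def S_def bounded_partitions_def)
      then show ?thesis by blast
    qed
    moreover have "idx ?D (\<kappa>(i := l)) = N + 1"
    proof (cases "i = 1")
      case True
      have "conj_part (\<kappa>(i := k)) 1 \<le> 1" if "k \<le> top" for k
        using conj_part_upd[of k] conj_part_1_eqI[OF part_upd[OF that], of 0] that True
        by (cases "k = 0") (auto simp: upd_zero zero)
      from this[of l] this[of "l - 1"] show ?thesis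
        unfolding N using l True by (simp add: idx_one_row)
    next
      case i1: False
      then have l2: "2 \<le> l" using False l i by simp
      obtain i' where i': "i = Suc i'" "i' \<noteq> 0" using i i1 by (cases i) auto
      have "row_index ?D (\<kappa>(i := l)) i' = row_index ?D (\<kappa>(i := l - 1)) i'"
        using i' by (intro row_index_cong) auto
      moreover have "idx ?D (\<kappa>(i := k)) = ?D (row_index ?D (\<kappa>(i := k)) i') + k - 1" if "1 \<le> k" "k \<le> top" for k
      proof -
        have "idx ?D (\<kappa>(i := k)) = row_index ?D (\<kappa>(i := k)) (Suc i')"
          unfolding idx_row_index trans[OF conj_part_upd[OF that] i'(1)] ..
        then show ?thesis using i' by simp
      qed
      from this[of l] this[of "l - 1"] have "idx ?D (\<kappa>(i := l)) = ?D (row_index ?D (\<kappa>(i := l)) i') + l - 1"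
        "N = ?D (row_index ?D (\<kappa>(i := l - 1)) i') + (l - 1) - 1" using l l2 by (auto simp: N)
      ultimately show ?thesis using l2 by simp
    qed
    ultimately show ?thesis using inj lt by (simp add: st keeps_def)
  qed
  then show "keeps S st st'" "inj_on (idx (D_array st')) (reserved m n S')"
    "\<forall>\<nu>\<in>reserved m n S'. idx (D_array st') \<nu> < next_index st'" "N' = idx (D_array st') (\<kappa>(i := l))"
    by auto
qed

text \<open>The strips of the new partition precede it in dictionary order, so the entries that \<open>jack\<close> reads are
  final; and its row is still zero, since its index belongs to no visited partition.\<close>

lemma visit_correct:
  assumes l: "1 \<le> l" "l \<le> top" and inv: "inv (before m n \<kappa> i l) st"
    and N0: "N\<^sub>0 = idx (D_array st) \<kappa>" and N: "N = idx (D_array st) (\<kappa>(i := l - 1))"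
    and z: "z = Q (\<kappa>(i := l - 1))"
  obtains z' N' st' where
    "fst (visit A p a q b n x i z top (\<kappa>(i := l)) N\<^sub>0 N st) = (z', N', st')"
    "z' = Q (\<kappa>(i := l))" "N' = idx (D_array st') (\<kappa>(i := l))"
    "inv (insert (\<kappa>(i := l)) (before m n \<kappa> i l)) st'" "keeps (before m n \<kappa> i l) st st'"
proof -
  let ?\<kappa> = "\<kappa>(i := l)"
  define S where "S = before m n \<kappa> i l"
  define S' where "S' = insert ?\<kappa> (before m n \<kappa> i l)"
  obtain N1 st1 where st1: "(N1, st1) = (if l = 1 \<and> 1 < i then
       (next_index st, st\<lparr>next_index := next_index st + top, D_array := (D_array st)(N\<^sub>0 := next_index st)\<rparr>)
     else (N + 1, st))"
    by (metis surj_pair)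
  note new = new_index[OF l inv N0 N st1, folded S_def S'_def]
  let ?D = "D_array st1"
  have down: "downward m n S" "downward m n S'"
    unfolding S_def S'_def using downward_before before_visit[OF l(2)] by metis+
  have "?\<kappa> \<notin> S" unfolding S_def by (rule upd_notin_before[OF l(2)])
  have old: "idx ?D \<nu> = idx (D_array st) \<nu>" if "\<nu> \<in> S" for \<nu>
    using new(1) that downward_reserved[OF down(1)] by (auto simp: keeps_def)
  have ne: "idx ?D \<nu> \<noteq> N1" if "\<nu> \<in> S" for \<nu>
  proof
    assume "idx ?D \<nu> = N1"
    then have "\<nu> = ?\<kappa>"
      using inj_onD[OF new(2), of \<nu> ?\<kappa>] new(4) downward_reserved[OF down(2)] that by (auto simp: S'_def S_def)
    then show False using that \<open>?\<kappa> \<notin> S\<close> by simp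
  qed
  have J: "J_array st1 (idx ?D \<nu>) t = Jack A x t \<nu>" if "\<nu> \<in> S" "1 \<le> t" "t \<le> n" for \<nu> t
    using inv that by (simp add: new(5) inv_def old flip: S_def)
  have J0: "J_array st1 N t = 0" if "N \<notin> idx ?D ` S" for N t
  proof -
    have "idx ?D ` S = idx (D_array st) ` S" using old by (intro image_cong) auto
    then show ?thesis using inv that by (simp add: new(5) inv_def flip: S_def)
  qed
  define JJ1 where "JJ1 = (if conj_part ?\<kappa> 1 = 1 then
       (J_array st1)(N1 := (J_array st1 N1)(1 := x 1 * (1 + A * (of_nat (?\<kappa> 1) - 1)) * J_array st1 (N1 - 1) 1))
     else J_array st1)"
  have JJ1_other: "JJ1 N' = J_array st1 N'" if "N' \<noteq> N1" for N' using that by (simp add: JJ1_def)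
  have N1_notin: "N1 \<notin> idx ?D ` S" using ne by blast
  have JJ1_zero: "JJ1 N1 t = 0" if "1 < t" for t
    using J0[OF N1_notin] that by (simp add: JJ1_def)
  have JJ1_one: "JJ1 N1 1 = Jack A x 1 ?\<kappa>"
  proof (cases "i = 1")
    case True
    have "\<kappa>(i := l - 1) \<in> before m n \<kappa> i (Suc (l - 1))" using l by (intro upd_mem_before) auto
    then have mem: "\<kappa>(i := l - 1) \<in> S" using l by (simp add: S_def)
    have "conj_part (\<kappa>(i := k)) 1 \<le> 1" if "k \<le> top" for k
      using conj_part_upd[of k] conj_part_1_eqI[OF part_upd[OF that], of 0] that True
      by (cases "k = 0") (auto simp: upd_zero zero)
    from this[of l] this[of "l - 1"] have "idx ?D (\<kappa>(i := l - 1)) = l - 1" "N1 = l"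
      unfolding new(4) using l True by (simp_all add: idx_one_row)
    then have "J_array st1 (N1 - 1) 1 = Jack A x 1 (\<kappa>(i := l - 1))"
      using J[OF mem, of 1] n by simp
    moreover have "{1..l} = insert l {1..l - 1}" using l by auto
    moreover have "x 1 ^ l = x 1 * x 1 ^ (l - 1)" using l by (cases l) auto
    ultimately show ?thesis
      using conj_part_upd[OF l] True l zero[of 2] by (simp add: JJ1_def algebra_simps)
  next
    case False
    then have "0 < ?\<kappa> (Suc 1)"
      using l i conj_part_1_pos[OF part_upd[OF l(2)], of 2] conj_part_upd[OF l] by (simp add: numeral_2_eq_2)
    then have "Jack A x 1 ?\<kappa> = 0" by (intro Jack_zero) auto
    then show ?thesis using J0[OF N1_notin] False conj_part_upd[OF l] by (simp add: JJ1_def)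
  qed
  define JJ where "JJ = fst (cfor [2..<Suc n] (\<lambda>t JJ. jack A x ?\<kappa> N1 ?D JJ t 0 ?\<kappa> N1 1 1 (JJ N1 t) \<then> (\<lambda>v.
         cret (JJ(N1 := (JJ N1)(t := v))))) JJ1)"
  have "(\<forall>t. 1 \<le> t \<longrightarrow> t \<le> n \<longrightarrow> JJ N1 t = Jack A x t ?\<kappa>) \<and> (\<forall>t>n. JJ N1 t = 0) \<and>
    (\<forall>N'. N' \<noteq> N1 \<longrightarrow> JJ N' = JJ1 N')"
    unfolding JJ_def
  proof (rule jack_row)
    show "is_partition ?\<kappa>" by (rule part_upd[OF l(2)])
    show "N1 = idx ?D ?\<kappa>" by (rule new(4))
    show "JJ1 N1 1 = Jack A x 1 ?\<kappa>" by (rule JJ1_one)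
    show "JJ1 N1 t = 0" if "1 < t" for t by (rule JJ1_zero[OF that])
    show "1 \<le> n" "n \<le> n" using n by auto
    fix \<nu> t assume "\<nu> \<in> strips ?\<kappa>" "\<nu> \<noteq> ?\<kappa>" "1 \<le> t" "t \<le> n"
    moreover from this have "\<nu> \<in> S" unfolding S_def by (intro strips_before[OF l(2)])
    ultimately show "idx ?D \<nu> \<noteq> N1 \<and> JJ1 (idx ?D \<nu>) t = Jack A x t \<nu>"
      using ne[of \<nu>] JJ1_other[of "idx ?D \<nu>"] J[of \<nu> t] by simp
  qed
  then have JJ: "\<And>t. 1 \<le> t \<Longrightarrow> t \<le> n \<Longrightarrow> JJ N1 t = Jack A x t ?\<kappa>" "\<And>N'. N' \<noteq> N1 \<Longrightarrow> JJ N' = J_array st1 N'"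
    using JJ1_other by auto
  define z' where "z' = z * fst (Q_factor A p a q b ?\<kappa> i)"
  have z': "z' = Q ?\<kappa>"
    using corner.Q_coeff_corner[OF corner_upd[OF l] pos, of p a q b] by (simp add: z'_def z)
  define st' where "st' = st1\<lparr>J_array := JJ, partial_sum := partial_sum st1 + z' * JJ N1 n\<rparr>"
  have "fst (visit A p a q b n x i z top ?\<kappa> N\<^sub>0 N st) = (z', N1, st')"
    unfolding st'_def by (rule fst_visit[OF _ JJ1_def JJ_def z'_def]) (use st1 in simp)
  moreover have "inv S' st'"
    unfolding inv_def
  proof (intro conjI ballI allI impI)
    show "inj_on (idx (D_array st')) (reserved m n S')" using new(2) by (simp add: st'_def)
    show "idx (D_array st') \<nu> < next_index st'" if "\<nu> \<in> reserved m n S'" for \<nu>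
      using new(3) that by (simp add: st'_def)
    show "J_array st' (idx (D_array st') \<nu>) t = Jack A x t \<nu>" if "\<nu> \<in> S'" "1 \<le> t" "t \<le> n" for \<nu> t
    proof (cases "\<nu> = ?\<kappa>")
      case True
      then show ?thesis using JJ(1) that new(4) by (simp add: st'_def)
    next
      case False
      then have "\<nu> \<in> S" using that by (simp add: S'_def S_def)
      then show ?thesis using JJ(2)[OF ne] J that by (simp add: st'_def)
    qed
    show "J_array st' N t = 0" if "N \<notin> idx (D_array st') ` S'" for N t
    proof -
      have "N \<noteq> N1" "N \<notin> idx ?D ` S" using that new(4) by (auto simp: st'_def S'_def S_def)
      then show ?thesis using JJ(2) J0 by (simp add: st'_def)
    qed
    have "partial_sum st1 = (\<Sum>\<nu>\<in>S. Q \<nu> * Jack A x n \<nu>)" using inv by (simp add: new(6) inv_def S_def)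
    moreover have "S' = insert ?\<kappa> S" "finite S" by (simp_all add: S'_def S_def finite_before)
    ultimately show "partial_sum st' = (\<Sum>\<nu>\<in>S'. Q \<nu> * Jack A x n \<nu>)"
      using \<open>?\<kappa> \<notin> S\<close> JJ(1)[OF n order_refl] z' by (simp add: st'_def)
  qed
  moreover have "keeps S st st'" using new(1) by (simp add: keeps_def st'_def)
  moreover have "N1 = idx (D_array st') ?\<kappa>" using new(4) by (simp add: st'_def)
  ultimately show ?thesis using that z' by (simp add: S_def S'_def)
qed

end

context hg_run
begin

text \<open>The outer induction follows the calls from row \<open>n\<close> up to row 1, the inner one the loop from its
  end. Besides the invariant, a call must keep the indices already given, since the calling loop goes
  on using them.\<close>

lemma summation_correct:
  assumes "node m n \<kappa> i" "inv (before m n \<kappa> i 1) st" "N = idx (D_array st) \<kappa>" "z = Q \<kappa>"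
  defines "st' \<equiv> fst (summation A p a q b n x i z (m - psize \<kappa>) \<kappa> N st)"
  shows "inv (before m n \<kappa> i (Suc (node.top m \<kappa> i))) st' \<and> keeps (before m n \<kappa> i 1) st st'"
  using assms(1-4) unfolding st'_def
proof (induction "n - i" arbitrary: \<kappa> i z N st rule: less_induct)
  case IH: (less i \<kappa> z N st)
  interpret node m n \<kappa> i by fact
  interpret hg_node m n \<kappa> i \<alpha> p a q b x ..
  let ?j = "m - psize \<kappa>"
  have mono: "before m n \<kappa> i l \<subseteq> before m n \<kappa> i (Suc l)" for l by (auto simp: before_def)
  have loop: "inv (before m n \<kappa> i (Suc top)) (fst (summation_loop A p a q b n x i z ?j top l \<kappa> N\<^sub>0 N st)) \<and>
      keeps (before m n \<kappa> i l) st (fst (summation_loop A p a q b n x i z ?j top l \<kappa> N\<^sub>0 N st))"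
    if "l \<le> Suc top" "1 \<le> l" "inv (before m n \<kappa> i l) st" "N\<^sub>0 = idx (D_array st) \<kappa>"
      "N = idx (D_array st) (\<kappa>(i := l - 1))" "z = Q (\<kappa>(i := l - 1))" for l z N\<^sub>0 N st
    using that
  proof (induction l arbitrary: z N\<^sub>0 N st rule: inc_induct)
    case base
    then show ?case by (simp add: summation_loop_unfold fst_counted keeps_def)
  next
    case (step l)
    then have l: "1 \<le> l" "l \<le> top" by auto
    let ?\<kappa> = "\<kappa>(i := l)" and ?S = "before m n \<kappa> i l" and ?S' = "insert (\<kappa>(i := l)) (before m n \<kappa> i l)"
    obtain z' N' st' where v: "fst (visit A p a q b n x i z top ?\<kappa> N\<^sub>0 N st) = (z', N', st')"
      and z': "z' = Q ?\<kappa>" and N': "N' = idx (D_array st') ?\<kappa>" and inv': "inv ?S' st'" and keeps': "keeps ?S st st'"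
      using visit_correct[OF l step.prems(2-5)] by metis
    define C where "C = (if l < ?j \<and> i < n
         then charge 2 (summation A p a q b n x (i + 1) z' (?j - l) ?\<kappa> N' st') else cret st')"
    have S': "before m n ?\<kappa> (Suc i) 1 = ?S'" by (rule before_visit[OF l(2)])
    have C: "inv (before m n \<kappa> i (Suc l)) (fst C) \<and> keeps ?S' st' (fst C)"
    proof (cases "l < ?j \<and> i < n")
      case True
      then have "inv (before m n ?\<kappa> (Suc i) (Suc (node.top m ?\<kappa> (Suc i))))
            (fst (summation A p a q b n x (Suc i) z' (m - psize ?\<kappa>) ?\<kappa> N' st')) \<and>
          keeps (before m n ?\<kappa> (Suc i) 1) st' (fst (summation A p a q b n x (Suc i) z' (m - psize ?\<kappa>) ?\<kappa> N' st'))"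
        using inv' N' z' S' by (intro IH(1) node_child[OF l(2)]) auto
      then show ?thesis using True before_child[OF l(2)] psize_upd[OF l(2)] S'
        by (simp add: C_def snd_counted)
    next
      case False
      then have "fst C = st'" by (auto simp: C_def fst_counted)
      then show ?thesis using before_leaf[OF l(2) False] inv' S' by (simp add: keeps_def)
    qed
    have sub: "?S' \<subseteq> before m n \<kappa> i (Suc l)"
      using mono upd_mem_before[OF l(2)] by blast
    have keepsC: "keeps ?S st (fst C)" using keeps_trans[OF keeps' conjunct2[OF C]] by blast
    have "N\<^sub>0 = idx (D_array (fst C)) \<kappa>"
      using keepsC step.prems(3) mem_before[OF l(1)] downward_reserved[OF downward_before]
      unfolding keeps_def by (metis subsetD)
    moreover have "N' = idx (D_array (fst C)) ?\<kappa>"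
    proof -
      have "downward m n ?S'" using downward_before[of m n ?\<kappa> "Suc i" 1] unfolding S' .
      then have "?\<kappa> \<in> reserved m n ?S'" using downward_reserved by blast
      then show ?thesis using C N' by (simp add: keeps_def)
    qed
    ultimately have L: "inv (before m n \<kappa> i (Suc top)) (fst (summation_loop A p a q b n x i z' ?j top (Suc l) \<kappa> N\<^sub>0 N' (fst C))) \<and>
      keeps (before m n \<kappa> i (Suc l)) (fst C) (fst (summation_loop A p a q b n x i z' ?j top (Suc l) \<kappa> N\<^sub>0 N' (fst C)))"
    proof (intro step.IH)
      show "inv (before m n \<kappa> i (Suc l)) (fst C)" using C by simp
    qed (use z' in \<open>simp_all only: diff_Suc_Suc diff_zero One_nat_def Suc_le_mono le0\<close>)
    moreover have "fst (summation_loop A p a q b n x i z ?j top l \<kappa> N\<^sub>0 N st)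
        = fst (summation_loop A p a q b n x i z' ?j top (Suc l) \<kappa> N\<^sub>0 N' (fst C))"
      unfolding summation_loop_unfold(1)[OF l] fst_counted v case_prod_conv C_def[symmetric] by simp
    ultimately show ?case
      using keeps_trans[OF keepsC conjunct2[OF L] mono] by simp
  qed
  have "summation A p a q b n x i z ?j \<kappa> N st = summation_loop A p a q b n x i z ?j top 1 \<kappa> N N st"
    by (subst summation.simps) (simp add: top_def)
  then show ?case using loop[of 1 st N N z] IH(3-5) by (simp add: upd_zero)
qed

lemma pFq_trunc_eq: "pFq_trunc m A p a q b n x = (\<Sum>\<kappa>\<in>bounded_partitions m n. Q \<kappa> * Jack A x n \<kappa>)"
proof -
  have "pFq_trunc m A p a q b n x = (\<Sum>k=0..m. \<Sum>\<kappa>\<in>partitions_of k. Q \<kappa> * Jack A x n \<kappa>)"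
    unfolding pFq_trunc_def
    by (intro sum.cong refl)
       (simp add: partitions_of_def C_diag_def Q_coeff_def field_simps)
  also have "\<dots> = (\<Sum>\<kappa>\<in>(\<Union>k\<in>{0..m}. partitions_of k). Q \<kappa> * Jack A x n \<kappa>)"
    by (rule sum.UNION_disjoint[symmetric]) (auto simp: finite_partitions_of, auto simp: partitions_of_def)
  also have "\<dots> = (\<Sum>\<kappa>\<in>bounded_partitions m n. Q \<kappa> * Jack A x n \<kappa>)"
  proof (rule sum.mono_neutral_right)
    show "finite (\<Union>k\<in>{0..m}. partitions_of k)" by (simp add: finite_partitions_of)
    show "bounded_partitions m n \<subseteq> (\<Union>k\<in>{0..m}. partitions_of k)"
      by (auto simp: bounded_partitions_def partitions_of_def)
    show "\<forall>\<kappa>\<in>(\<Union>k\<in>{0..m}. partitions_of k) - bounded_partitions m n. Q \<kappa> * Jack A x n \<kappa> = 0"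
      using Jack_zero[OF n, of _ A x] by (auto simp: bounded_partitions_def partitions_of_def)
  qed
  finally show ?thesis .
qed

lemma hg_correct: "hg_value m A p a q b n x = pFq_trunc m A p a q b n x"
proof -
  let ?st = "\<lparr>next_index = m + 1, D_array = (\<lambda>_. 0), J_array = (\<lambda>N t. if N = 0 then 1 else 0), partial_sum = 1 :: complex\<rparr>"
  let ?S = "{\<lambda>_. 0 :: nat}"
  have one: "conj_part \<nu> 1 \<le> 1" if "\<nu> \<in> reserved m n ?S" for \<nu>
  proof (rule ccontr)
    assume "\<not> conj_part \<nu> 1 \<le> 1"
    then have "\<nu>(conj_part \<nu> 1 := 1) = (\<lambda>_. 0)" using that by (auto simp: reserved_def)
    from fun_cong[OF this, of "conj_part \<nu> 1"] show False by simp
  qed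
  have idx: "idx D \<nu> = \<nu> 1" if "\<nu> \<in> reserved m n ?S" for \<nu> D
    using one[OF that] by (rule idx_one_row)
  have "conj_part (\<lambda>_. 0) 1 = 0" by (simp add: conj_part_def)
  then have idx0: "idx D (\<lambda>_. 0) = 0" for D by (simp add: idx_one_row)
  have "inv ?S ?st"
    unfolding inv_def
  proof (intro conjI ballI allI impI)
    show "inj_on (idx (D_array ?st)) (reserved m n ?S)"
    proof (rule inj_onI, rule ext)
      fix \<mu> \<nu> r assume \<mu>: "\<mu> \<in> reserved m n ?S" and \<nu>: "\<nu> \<in> reserved m n ?S" and eq: "idx (D_array ?st) \<mu> = idx (D_array ?st) \<nu>"
      have part: "is_partition \<mu>" "is_partition \<nu>" using \<mu> \<nu> by (auto simp: reserved_def bounded_partitions_def)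
      have "\<mu> 1 = \<nu> 1" using eq idx[OF \<mu>] idx[OF \<nu>] by simp
      moreover have "\<mu> r = 0" "\<nu> r = 0" if "1 < r"
        using partition_conj_part_zero[OF part(1), of r] partition_conj_part_zero[OF part(2), of r]
          one[OF \<mu>] one[OF \<nu>] that by auto
      moreover have "\<mu> 0 = \<nu> 0" using part by (simp add: is_partition_def)
      ultimately show "\<mu> r = \<nu> r" by (metis less_one linorder_neqE_nat)
    qed
    show "idx (D_array ?st) \<nu> < next_index ?st" if "\<nu> \<in> reserved m n ?S" for \<nu>
      using idx[OF that] that partition_part_le[of \<nu> 1] by (auto simp: reserved_def bounded_partitions_def)
    show "J_array ?st (idx (D_array ?st) \<nu>) t = Jack A x t \<nu>" if "\<nu> \<in> ?S" "1 \<le> t" "t \<le> n" for \<nu> t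
      using that by (simp add: idx0 Jack_empty)
    show "J_array ?st N t = 0" if "N \<notin> idx (D_array ?st) ` ?S" for N t
      using that by (simp add: idx0)
    show "partial_sum ?st = (\<Sum>\<nu>\<in>?S. Q \<nu> * Jack A x n \<nu>)"
      using n by (simp add: Q_coeff_empty Jack_empty)
  qed
  then have "inv (before m n (\<lambda>_. 0) 1 1) ?st" by (simp only: before_start)
  from summation_correct[OF node_root[OF n] this, of 0 1]
  have "inv (before m n (\<lambda>_. 0) 1 (Suc (node.top m (\<lambda>_. 0) 1))) (fst (summation A p a q b n x 1 1 m (\<lambda>_. 0) 0 ?st))"
    by (simp add: idx0 Q_coeff_empty psize_empty)
  moreover have "node.top m (\<lambda>_. 0) 1 = m" unfolding node.top_def[OF node_root[OF n]] by (simp add: psize_empty)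
  ultimately have "inv (bounded_partitions m n) (fst (summation A p a q b n x 1 1 m (\<lambda>_. 0) 0 ?st))"
    by (simp only: before_end)
  then show ?thesis
    unfolding pFq_trunc_eq inv_def hg_value_def hg_def by (simp only: fst_counted snd_counted)
qed

end

theorem mainTheorem3:
  fixes p q :: nat
  shows "
    (\<forall>m n (\<alpha>::real) (a::nat \<Rightarrow> complex) (b::nat \<Rightarrow> complex) (x::nat \<Rightarrow> complex).
        n \<ge> 1 \<longrightarrow> \<alpha> > 0 \<longrightarrow>
        (\<forall>\<kappa>\<in>bounded_partitions m n. \<forall>r\<in>{1..q}. gpoch (of_real \<alpha>) (b r) \<kappa> \<noteq> 0) \<longrightarrow>
        hg_value m (of_real \<alpha>) p a q b n x = pFq_trunc m (of_real \<alpha>) p a q b n x)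
    \<and> (\<exists>C. \<forall>m n (\<alpha>::real) (a::nat \<Rightarrow> complex) (b::nat \<Rightarrow> complex) (x::nat \<Rightarrow> complex).
        n \<ge> 1 \<longrightarrow> \<alpha> > 0 \<longrightarrow>
        real (hg_cost m (of_real \<alpha>) p a q b n x) \<le> C * ((real (Pmn m n))\<^sup>2 * real n))
    \<and> (\<forall>m n. Pmn m n \<le> (\<Sum>i=0..m. num_partitions i))
    \<and> (\<lambda>m. real (\<Sum>i=0..m. num_partitions i)) \<in> O(\<lambda>m. exp (pi * sqrt (2 * real m / 3)))
    \<and> (\<exists>C. \<forall>m n. (real (Pmn m n))\<^sup>2 \<le> C * exp (2 * pi * sqrt (2 * real m / 3)))
    \<and> (\<exists>g. subexponential g \<and>
        (\<forall>m n (\<alpha>::real) (a::nat \<Rightarrow> complex) (b::nat \<Rightarrow> complex) (x::nat \<Rightarrow> complex).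
          n \<ge> 1 \<longrightarrow> \<alpha> > 0 \<longrightarrow>
          real (hg_cost m (of_real \<alpha>) p a q b n x) \<le> g m * real n))"
proof (intro conjI)
  let ?E = "\<lambda>m. exp (pi * sqrt (2 * real m / 3))"
  let ?c = "2 * p + 2 * q + 1020"
  have P: "(real (Pmn m n))\<^sup>2 \<le> exp (2 * pi * sqrt (2 * real m / 3))" for m n
  proof -
    have "real (Pmn m n) \<le> ?E m" using Pmn_le[of m n] Pmn_le_exp[of m] by linarith
    then have "(real (Pmn m n))\<^sup>2 \<le> (?E m)\<^sup>2" by (intro power_mono) auto
    also have "\<dots> = exp (2 * pi * sqrt (2 * real m / 3))"
      by (simp add: mult.assoc flip: exp_double)
    finally show ?thesis .
  qed
  have cost: "real (hg_cost m (of_real \<alpha>) p a q b n x) \<le> real ?c * ((real (Pmn m n))\<^sup>2 * real n)"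
    if "n \<ge> 1" for m n and \<alpha> :: real and a b x :: "nat \<Rightarrow> complex"
  proof -
    have "real (hg_cost m (of_real \<alpha>) p a q b n x) \<le> real (?c * ((Pmn m n)\<^sup>2 * n))"
      by (intro of_nat_mono hg_cost_le that)
    then show ?thesis by (simp only: of_nat_mult of_nat_power)
  qed
  show "\<forall>m n (\<alpha>::real) (a::nat \<Rightarrow> complex) (b::nat \<Rightarrow> complex) (x::nat \<Rightarrow> complex).
      n \<ge> 1 \<longrightarrow> \<alpha> > 0 \<longrightarrow>
      (\<forall>\<kappa>\<in>bounded_partitions m n. \<forall>r\<in>{1..q}. gpoch (of_real \<alpha>) (b r) \<kappa> \<noteq> 0) \<longrightarrow>
      hg_value m (of_real \<alpha>) p a q b n x = pFq_trunc m (of_real \<alpha>) p a q b n x"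
    by (intro allI impI hg_run.hg_correct hg_run.intro)
  show "\<exists>C. \<forall>m n (\<alpha>::real) (a::nat \<Rightarrow> complex) (b::nat \<Rightarrow> complex) (x::nat \<Rightarrow> complex).
      n \<ge> 1 \<longrightarrow> \<alpha> > 0 \<longrightarrow>
      real (hg_cost m (of_real \<alpha>) p a q b n x) \<le> C * ((real (Pmn m n))\<^sup>2 * real n)"
    using cost by blast
  show "\<forall>m n. Pmn m n \<le> (\<Sum>i=0..m. num_partitions i)"
    using Pmn_le by (simp add: sum_num_partitions)
  show "(\<lambda>m. real (\<Sum>i=0..m. num_partitions i)) \<in> O(?E)"
    unfolding sum_num_partitions
    by (intro landau_o.big_mono always_eventually) (simp add: Pmn_le_exp)
  show "\<exists>C. \<forall>m n. (real (Pmn m n))\<^sup>2 \<le> C * exp (2 * pi * sqrt (2 * real m / 3))"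
    using P by (intro exI[of _ 1]) simp
  show "\<exists>g. subexponential g \<and>
      (\<forall>m n (\<alpha>::real) (a::nat \<Rightarrow> complex) (b::nat \<Rightarrow> complex) (x::nat \<Rightarrow> complex).
        n \<ge> 1 \<longrightarrow> \<alpha> > 0 \<longrightarrow> real (hg_cost m (of_real \<alpha>) p a q b n x) \<le> g m * real n)"
  proof (intro exI conjI allI impI)
    let ?g = "\<lambda>m. real ?c * exp (2 * pi * sqrt (2 * real m / 3))"
    have "(\<lambda>m. exp (2 * pi * sqrt (2 * real m / 3))) \<in> o(\<lambda>m. exp (\<epsilon> * real m))" if "\<epsilon> > 0" for \<epsilon> :: real
      using that by real_asymp
    then show "subexponential ?g"
      unfolding subexponential_def by (intro allI impI landau_o.small.cmult_in_iff[THEN iffD2]) auto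
    fix m n :: nat and \<alpha> :: real and a b x :: "nat \<Rightarrow> complex"
    assume "n \<ge> 1"
    have "real ?c * ((real (Pmn m n))\<^sup>2 * real n) \<le> real ?c * (exp (2 * pi * sqrt (2 * real m / 3)) * real n)"
      by (intro mult_left_mono mult_right_mono P) auto
    then show "real (hg_cost m (of_real \<alpha>) p a q b n x) \<le> ?g m * real n"
      using cost[OF \<open>n \<ge> 1\<close>, of m \<alpha> a b x] by (simp only: mult.assoc)
  qed
qed

end
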